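(* Let $\Gamma$ be a finitely generated amenable group with a finite symmetric generating set $S$, and let $N$ be the spectral distribution of the Laplace operator of the uniform probability measure on $S$. Let $0<\alpha\le1$. Assume there exists $\epsilon>0$ such that the cardinality of a ball of radius $r$ in $\Gamma$ (with respect to the word metric of $S$) is bounded below by $\exp(\epsilon r^\alpha)$ for large $r$. Then, near zero, $$N(\lambda)\preceq\exp(-\lambda^{-\alpha/2}).$$ In particular, if $\Gamma$ has exponential growth, then $N(\lambda)\preceq\exp(-\lambda^{-1/2})$ near zero.
   Context: Spectral distribution: for the uniform probability measure $\mu=\frac1{|S|}\sum_{s\in S}\delta_s$, let $R_\mu:l^2(\Gamma)\to l^2(\Gamma)$, $R_\mu(f)(x)=\sum_{\gamma}f(x\gamma^{-1})\mu(\gamma)$, and $\Delta=\mathrm{id}-R_\mu$. Then $N(\lambda)=\langle\chi_{(-\infty,\lambda]}(\Delta)\delta_e,\delta_e\rangle_{l^2(\Gamma)}$ for $\lambda\ge0$. Asymptotic comparison: $f\preceq g$ near zero means there are $C,D,\epsilon'>0$ with $f(\lambda)\le Cg(D\lambda)$ for all $\lambda\in[0,\epsilon')$; the expression $\exp(-\lambda^{-\alpha/2})$ is given the value $0$ at $\lambda=0$. *)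

theory Defs
  imports "HOL-Probability.Probability" "HOL-Algebra.Generated_Groups"
begin

section \<open>Groups: amenability, word metric, growth\<close>

text \<open>Amenability in von Neumann's sense: a finitely additive, left-invariant probability
  measure on all subsets of the group.\<close>

definition amenable :: "('a, 'b) monoid_scheme \<Rightarrow> bool" where
  "amenable G \<longleftrightarrow> (\<exists>m :: 'a set \<Rightarrow> real.
     (\<forall>A. A \<subseteq> carrier G \<longrightarrow> 0 \<le> m A) \<and>
     m (carrier G) = 1 \<and>
     (\<forall>A B. A \<subseteq> carrier G \<longrightarrow> B \<subseteq> carrier G \<longrightarrow> A \<inter> B = {} \<longrightarrow> m (A \<union> B) = m A + m B) \<and>
     (\<forall>g\<in>carrier G. \<forall>A. A \<subseteq> carrier G \<longrightarrow> m ((\<lambda>x. g \<otimes>\<^bsub>G\<^esub> x) ` A) = m A))"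

definition symmetric_subset :: "('a, 'b) monoid_scheme \<Rightarrow> 'a set \<Rightarrow> bool" where
  "symmetric_subset G S \<longleftrightarrow> S \<subseteq> carrier G \<and> (\<forall>s\<in>S. inv\<^bsub>G\<^esub> s \<in> S)"

text \<open>The generating sets considered are symmetric, so words in \<open>S\<close> need no formal inverses.\<close>

definition word_length :: "('a, 'b) monoid_scheme \<Rightarrow> 'a set \<Rightarrow> 'a \<Rightarrow> nat" where
  "word_length G S x =
     (LEAST n. \<exists>ws. set ws \<subseteq> S \<and> length ws = n \<and> foldr (\<lambda>s y. s \<otimes>\<^bsub>G\<^esub> y) ws \<one>\<^bsub>G\<^esub> = x)"

definition word_dist :: "('a, 'b) monoid_scheme \<Rightarrow> 'a set \<Rightarrow> 'a \<Rightarrow> 'a \<Rightarrow> nat" where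
  "word_dist G S x y = word_length G S (inv\<^bsub>G\<^esub> x \<otimes>\<^bsub>G\<^esub> y)"

definition word_ball :: "('a, 'b) monoid_scheme \<Rightarrow> 'a set \<Rightarrow> real \<Rightarrow> 'a set" where
  "word_ball G S r = {x \<in> carrier G. real (word_dist G S \<one>\<^bsub>G\<^esub> x) \<le> r}"

definition exponential_growth :: "('a, 'b) monoid_scheme \<Rightarrow> 'a set \<Rightarrow> bool" where
  "exponential_growth G S \<longleftrightarrow>
     (\<exists>c>1. \<forall>\<^sub>F n in sequentially. c ^ n \<le> real (card (word_ball G S (real n))))"

section \<open>The Hilbert space of square-summable functions on a group\<close>

text \<open>Elements are complex functions on the whole type that vanish outside the carrier.\<close>

definition l2 :: "('a, 'b) monoid_scheme \<Rightarrow> ('a \<Rightarrow> complex) set" where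
  "l2 G = {f. (\<forall>x. x \<notin> carrier G \<longrightarrow> f x = 0) \<and> (\<lambda>x. (cmod (f x))\<^sup>2) summable_on carrier G}"

definition l2_inner :: "('a, 'b) monoid_scheme \<Rightarrow> ('a \<Rightarrow> complex) \<Rightarrow> ('a \<Rightarrow> complex) \<Rightarrow> complex" where
  "l2_inner G f g = (\<Sum>\<^sub>\<infinity>x\<in>carrier G. f x * cnj (g x))"

definition l2_norm :: "('a, 'b) monoid_scheme \<Rightarrow> ('a \<Rightarrow> complex) \<Rightarrow> real" where
  "l2_norm G f = sqrt (\<Sum>\<^sub>\<infinity>x\<in>carrier G. (cmod (f x))\<^sup>2)"

definition point_mass :: "'a \<Rightarrow> 'a \<Rightarrow> complex" where
  "point_mass a = (\<lambda>x. if x = a then 1 else 0)"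

section \<open>Spectral projections\<close>

definition orthogonal_projection ::
    "('a, 'b) monoid_scheme \<Rightarrow> (('a \<Rightarrow> complex) \<Rightarrow> ('a \<Rightarrow> complex)) \<Rightarrow> bool" where
  "orthogonal_projection G P \<longleftrightarrow>
     (\<forall>f\<in>l2 G. P f \<in> l2 G) \<and>
     (\<forall>f\<in>l2 G. \<forall>g\<in>l2 G. P (\<lambda>x. f x + g x) = (\<lambda>x. P f x + P g x)) \<and>
     (\<forall>c. \<forall>f\<in>l2 G. P (\<lambda>x. c * f x) = (\<lambda>x. c * P f x)) \<and>
     (\<forall>f\<in>l2 G. P (P f) = P f) \<and>
     (\<forall>f\<in>l2 G. \<forall>g\<in>l2 G. l2_inner G (P f) g = l2_inner G f (P g))"

text \<open>Countable additivity is with respect to the strong operator topology;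
  it entails that the empty set is sent to zero.\<close>

definition projection_valued_measure ::
    "('a, 'b) monoid_scheme \<Rightarrow> (real set \<Rightarrow> ('a \<Rightarrow> complex) \<Rightarrow> ('a \<Rightarrow> complex)) \<Rightarrow> bool" where
  "projection_valued_measure G E \<longleftrightarrow>
     (\<forall>A\<in>sets borel. orthogonal_projection G (E A)) \<and>
     (\<forall>f\<in>l2 G. E UNIV f = f) \<and>
     (\<forall>A\<in>sets borel. \<forall>B\<in>sets borel. \<forall>f\<in>l2 G. E (A \<inter> B) f = E A (E B f)) \<and>
     (\<forall>A :: nat \<Rightarrow> real set. range A \<subseteq> sets borel \<longrightarrow> disjoint_family A \<longrightarrow>
        (\<forall>f\<in>l2 G.
           (\<lambda>n. l2_norm G (\<lambda>x. E (\<Union>i. A i) f x - (\<Sum>i<n. E (A i) f x))) \<longlonglongrightarrow> 0))"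

text \<open>The Borel measure that sends \<open>A\<close> to the inner product of \<open>E A f\<close> with \<open>f\<close>.\<close>

definition scalar_spectral_measure ::
    "('a, 'b) monoid_scheme \<Rightarrow> (real set \<Rightarrow> ('a \<Rightarrow> complex) \<Rightarrow> ('a \<Rightarrow> complex)) \<Rightarrow>
     ('a \<Rightarrow> complex) \<Rightarrow> real measure" where
  "scalar_spectral_measure G E f =
     measure_of UNIV (sets borel) (\<lambda>A. ennreal (Re (l2_inner G (E A f) f)))"

text \<open>\<open>T\<close> is the integral of the identity function against \<open>E\<close>. Since the scalars are complex,
  it is enough by polarization to state this for the quadratic forms.\<close>

definition spectral_measure_of ::
    "('a, 'b) monoid_scheme \<Rightarrow> (('a \<Rightarrow> complex) \<Rightarrow> ('a \<Rightarrow> complex)) \<Rightarrow>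
     (real set \<Rightarrow> ('a \<Rightarrow> complex) \<Rightarrow> ('a \<Rightarrow> complex)) \<Rightarrow> bool" where
  "spectral_measure_of G T E \<longleftrightarrow>
     projection_valued_measure G E \<and>
     (\<forall>f\<in>l2 G. integrable (scalar_spectral_measure G E f) (\<lambda>t. t) \<and>
        l2_inner G (T f) f = of_real (\<integral>t. t \<partial>(scalar_spectral_measure G E f)))"

text \<open>The operator \<open>\<chi>\<^sub>A(T)\<close> of the Borel functional calculus, for a bounded self-adjoint \<open>T\<close>
  and a Borel set \<open>A\<close>. By the spectral theorem the projection-valued measure of \<open>T\<close> exists, and
  its values on Borel sets and square-summable functions are unique; hence the choice operator
  only fixes irrelevant values.\<close>

definition spectral_projection ::
    "('a, 'b) monoid_scheme \<Rightarrow> (('a \<Rightarrow> complex) \<Rightarrow> ('a \<Rightarrow> complex)) \<Rightarrow> real set \<Rightarrow>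
     ('a \<Rightarrow> complex) \<Rightarrow> ('a \<Rightarrow> complex)" where
  "spectral_projection G T A = (SOME E. spectral_measure_of G T E) A"

section \<open>The Laplace operator and its spectral distribution\<close>

definition convolution_operator ::
    "('a, 'b) monoid_scheme \<Rightarrow> 'a pmf \<Rightarrow> ('a \<Rightarrow> complex) \<Rightarrow> ('a \<Rightarrow> complex)" where
  "convolution_operator G \<mu> f = (\<lambda>x. if x \<in> carrier G
     then \<Sum>\<^sub>\<infinity>\<gamma>\<in>carrier G. f (x \<otimes>\<^bsub>G\<^esub> inv\<^bsub>G\<^esub> \<gamma>) * of_real (pmf \<mu> \<gamma>) else 0)"

definition laplace_operator ::
    "('a, 'b) monoid_scheme \<Rightarrow> 'a pmf \<Rightarrow> ('a \<Rightarrow> complex) \<Rightarrow> ('a \<Rightarrow> complex)" where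
  "laplace_operator G \<mu> f = (\<lambda>x. f x - convolution_operator G \<mu> f x)"

definition spectral_distribution :: "('a, 'b) monoid_scheme \<Rightarrow> 'a pmf \<Rightarrow> real \<Rightarrow> real" where
  "spectral_distribution G \<mu> u =
     Re (l2_inner G (spectral_projection G (laplace_operator G \<mu>) {..u} (point_mass \<one>\<^bsub>G\<^esub>))
                    (point_mass \<one>\<^bsub>G\<^esub>))"

section \<open>Asymptotic comparison near zero\<close>

definition preceq_near_zero :: "(real \<Rightarrow> real) \<Rightarrow> (real \<Rightarrow> real) \<Rightarrow> bool" where
  "preceq_near_zero f g \<longleftrightarrow>
     (\<exists>C>0. \<exists>D>0. \<exists>\<epsilon>>0. \<forall>u\<in>{0..<\<epsilon>}. f u \<le> C * g (D * u))"

text \<open>The value at zero is set explicitly because \<open>0 powr a = 0\<close> would give \<open>exp 0 = 1\<close>.\<close>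

definition exp_neg_powr :: "real \<Rightarrow> real \<Rightarrow> real" where
  "exp_neg_powr a u = (if u = 0 then 0 else exp (- (u powr (- a))))"

end

theory Submission
  imports Defs
begin

text \<open>
  Let \<open>P\<close> be the spectral projection of the Laplace operator \<open>\<Delta>\<close> for \<open>(-\<infinity>, \<lambda>]\<close>, let \<open>f = P \<delta>\<^sub>e\<close> and
  \<open>m = N(\<lambda>) = f(e) = \<parallel>f\<parallel>\<^sup>2\<close>. Since \<open>P\<close> commutes with left translations, the right translates of \<open>f\<close>
  satisfy \<open>\<parallel>f - R\<^sub>\<gamma> f\<parallel>\<^sup>2 = 2 (m - f(\<gamma>))\<close>. The energy bound \<open>\<langle>\<Delta> f, f\<rangle> \<le> \<lambda> m\<close> makes every generator move \<open>f\<close> by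
  at most \<open>(2 |S| \<lambda> m)\<^sup>1\<^sup>/\<^sup>2\<close>, so \<open>f(\<gamma>) \<ge> m / 2\<close> on the ball \<open>B\<close> of radius \<open>(2 |S| \<lambda>)\<^sup>-\<^sup>1\<^sup>/\<^sup>2\<close>. Summing \<open>f\<^sup>2\<close>
  over \<open>B\<close> gives \<open>|B| m\<^sup>2 / 4 \<le> m\<close>, that is \<open>N(\<lambda>) \<le> 4 / |B|\<close>.

  The spectral distribution is defined through a choice of projection-valued measure, so its existence
  has to be shown. The Bernstein polynomials of a self-adjoint \<open>0 \<le> T \<le> 1\<close> are positive operators;
  hence \<open>\<langle>p(T) x, x\<rangle>\<close> are the moments of a measure on \<open>[0, 1]\<close> (Hausdorff's moment problem, solved
  by Helly selection), and \<open>\<chi>\<^sub>A(T) x\<close> is the limit of \<open>p\<^sub>n(T) x\<close> for polynomials \<open>p\<^sub>n\<close> tending to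
  \<open>\<chi>\<^sub>A\<close> in the \<open>L\<^sup>2\<close> space of that measure.
\<close>

section \<open>Hausdorff moment problem\<close>

text \<open>The obstacle is that N is built from a projection-valued measure picked by a choice
  operator. Once existence is known, the picked one is known only by its definition, which ties it
  to \<Delta> through the energies <\<Delta> f, f> alone. So the estimate is carried out for an
  arbitrary spectral measure \<open>E\<close>. Polarizing energies shows that its projections
  commute with \<Delta>; then the range for (-infinity, u] consists of the f with ||\<Delta>^n f|| =
  O(u^n), and this description yields the commutation with left translations and with complex
  conjugation. The displacement identity asks for <R f, f> = f(g) for the right translation R by g,
  although R need not commute with the projection. It holds because f is real and invariant under
  inversion, which exchanges right and left translations. Existence is proved with real polynomials
  in a real Hilbert space; complex linearity comes afterwards from commutation with multiplication
  by scalars. Since 0 \<le> \<Delta> \<le> 2, the construction is run for \<Delta>/2 and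
  rescaled.\<close>

definition bernstein_poly :: "nat \<Rightarrow> nat \<Rightarrow> real poly" where
  "bernstein_poly n k = smult (real (n choose k)) ([:0, 1:] ^ k * [:1, -1:] ^ (n - k))"

lemma sum_bernstein_poly: "(\<Sum>k\<le>n. bernstein_poly n k) = 1"
proof -
  have "(\<Sum>k\<le>n. bernstein_poly n k) = ([:0, 1:] + [:1, -1:]) ^ n"
    unfolding binomial_ring bernstein_poly_def
    by (intro sum.cong refl) (simp add: of_nat_poly mult.assoc)
  also have "[:0, 1:] + [:1, -1:] = (1 :: real poly)"
    by (simp add: one_pCons)
  finally show ?thesis by simp
qed

text \<open>The absorption identity for binomial coefficients. It trades one factor k/n of a node
  for one factor X under the functional, which lowers the order of a moment by one.\<close>

lemma bernstein_poly_Suc: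
  assumes "k \<le> n"
  shows "smult (real (Suc k) / real (Suc n)) (bernstein_poly (Suc n) (Suc k)) =
         [:0, 1:] * bernstein_poly n k"
proof -
  have "real (Suc k) / real (Suc n) * real (Suc n choose Suc k) = real (n choose k)"
    using arg_cong[OF Suc_times_binomial_eq[of n k], of real]
    by (simp add: field_simps del: binomial_Suc_Suc)
  then show ?thesis
    by (simp add: bernstein_poly_def mult.assoc del: binomial_Suc_Suc)
qed

text \<open>\<open>L\<close> is the linear extension of the moment sequence a_j = L(X^j). Expanding
  (1 - X)^m turns \<open>L_nonneg\<close> into Hausdorff's condition that all alternating
  differences of this sequence are nonnegative.\<close>

locale completely_monotone_functional =
  fixes L :: "real poly \<Rightarrow> real"
  assumes L_add: "L (p + q) = L p + L q"
    and L_smult: "L (smult c p) = c * L p"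
    and L_nonneg: "0 \<le> L ([:0, 1:] ^ k * [:1, -1:] ^ m)"
begin

lemma L_sum: "L (\<Sum>i\<in>A. f i) = (\<Sum>i\<in>A. L (f i))"
proof -
  have "L 0 = 0" using L_smult[of 0 0] by simp
  then show ?thesis by (induction A rule: infinite_finite_induct) (auto simp: L_add)
qed

lemma L_bernstein_nonneg: "0 \<le> L (bernstein_poly n k)"
  by (simp add: bernstein_poly_def L_smult L_nonneg)

lemma sum_L_bernstein: "(\<Sum>k\<le>n. L (bernstein_poly n k)) = L 1"
  by (simp flip: L_sum add: sum_bernstein_poly)

lemma shifted: "completely_monotone_functional (\<lambda>p. L ([:0, 1:] * p))"
proof
  fix k m
  show "0 \<le> L ([:0, 1:] * ([:0, 1:] ^ k * [:1, -1:] ^ m))"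
    using L_nonneg[of "Suc k" m] by (simp only: power_Suc mult.assoc)
qed (simp_all only: distrib_left L_add mult_smult_right L_smult)

end

text \<open>The sum is the j-th moment of the discrete measure with mass L(B_{n,k}) at k/n. By
  \<open>bernstein_poly_Suc\<close>, moment j+1 at level n+1 is a moment of order j for the
  functional p \<mapsto> L(X p) with nodes (k+1)/(n+1); moving the nodes to k/n costs O(j/n). Hence
  the induction must let \<open>L\<close> vary.\<close>

lemma bernstein_moments_tendsto:
  assumes "completely_monotone_functional L"
  shows "(\<lambda>n. \<Sum>k\<le>n. (real k / real n) ^ j * L (bernstein_poly n k)) \<longlonglongrightarrow> L ([:0, 1:] ^ j)"
  using assms
proof (induction j arbitrary: L)
  case 0
  then interpret completely_monotone_functional L .
  show ?case by (simp add: sum_L_bernstein)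
next
  case (Suc j)
  interpret completely_monotone_functional L by fact
  define L' where "L' = (\<lambda>p. L ([:0, 1:] * p))"
  interpret L': completely_monotone_functional L'
    unfolding L'_def by (rule shifted)
  define a where "a n = (\<Sum>k\<le>n. (real k / real n) ^ j * L' (bernstein_poly n k))" for n
  define b where "b n = (\<Sum>k\<le>n. (real (Suc k) / real (Suc n)) ^ j * L' (bernstein_poly n k))" for n
  have lim_a: "a \<longlonglongrightarrow> L' ([:0, 1:] ^ j)"
    unfolding a_def by (rule Suc.IH) unfold_locales
  have close: "\<bar>b n - a n\<bar> \<le> real j * (1 / real n) * L' 1" if n: "n > 0" for n
  proof -
    have "\<bar>b n - a n\<bar> \<le> (\<Sum>k\<le>n. \<bar>(real (Suc k) / real (Suc n)) ^ j - (real k / real n) ^ j\<bar>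
                              * L' (bernstein_poly n k))"
      unfolding a_def b_def sum_subtractf[symmetric] left_diff_distrib[symmetric]
      by (rule order_trans[OF sum_abs]) (simp add: abs_mult L'.L_bernstein_nonneg)
    also have "\<dots> \<le> (\<Sum>k\<le>n. real j * (1 / real n) * L' (bernstein_poly n k))"
    proof (intro sum_mono mult_right_mono L'.L_bernstein_nonneg)
      fix k assume k: "k \<in> {..n}"
      have "\<bar>(real (Suc k) / real (Suc n)) ^ j - (real k / real n) ^ j\<bar>
              \<le> real j * \<bar>real (Suc k) / real (Suc n) - real k / real n\<bar>"
        using norm_power_diff[of "real (Suc k) / real (Suc n)" "real k / real n" j] k n
        by (simp add: field_simps)
      also have "real (Suc k) / real (Suc n) - real k / real n = (real n - real k) / (real n * real (Suc n))"
        using n by (simp add: field_simps)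
      also have "\<bar>\<dots>\<bar> \<le> real (Suc n) / (real n * real (Suc n))"
        using k n unfolding abs_divide abs_mult abs_of_nat by (intro divide_right_mono) auto
      also have "\<dots> = 1 / real n"
        by simp
      finally show "\<bar>(real (Suc k) / real (Suc n)) ^ j - (real k / real n) ^ j\<bar> \<le> real j * (1 / real n)"
        by (simp add: mult_left_mono)
    qed
    also have "\<dots> = real j * (1 / real n) * L' 1"
      by (simp only: L'.sum_L_bernstein flip: sum_distrib_left)
    finally show ?thesis .
  qed
  have "(\<lambda>n. b n - a n) \<longlonglongrightarrow> 0"
  proof (rule Lim_null_comparison)
    show "\<forall>\<^sub>F n in sequentially. norm (b n - a n) \<le> real j * (1 / real n) * L' 1"
      using eventually_gt_at_top[of 0] by eventually_elim (use close in simp)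
    show "(\<lambda>n. real j * (1 / real n) * L' 1) \<longlonglongrightarrow> 0"
      by (auto intro!: tendsto_eq_intros lim_1_over_n)
  qed
  from tendsto_add[OF this lim_a] have lim_b: "b \<longlonglongrightarrow> L ([:0, 1:] ^ Suc j)"
    by (simp add: L'_def)
  have "(\<Sum>k\<le>Suc n. (real k / real (Suc n)) ^ Suc j * L (bernstein_poly (Suc n) k)) = b n" for n
  proof -
    \<comment> \<open>The term k = 0 drops out because its node is 0 and the exponent is
      positive.\<close>
    have "(\<Sum>k\<le>Suc n. (real k / real (Suc n)) ^ Suc j * L (bernstein_poly (Suc n) k)) =
          (\<Sum>k\<le>n. (real (Suc k) / real (Suc n)) ^ Suc j * L (bernstein_poly (Suc n) (Suc k)))"
      by (subst sum.atMost_Suc_shift) simp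
    also have "\<dots> = b n"
      unfolding b_def
    proof (intro sum.cong refl)
      fix k assume "k \<in> {..n}"
      then have "L' (bernstein_poly n k) = (real (Suc k) / real (Suc n)) * L (bernstein_poly (Suc n) (Suc k))"
        unfolding L'_def by (subst bernstein_poly_Suc[symmetric]) (auto simp only: L_smult atMost_iff)
      then show "(real (Suc k) / real (Suc n)) ^ Suc j * L (bernstein_poly (Suc n) (Suc k)) =
                 (real (Suc k) / real (Suc n)) ^ j * L' (bernstein_poly n k)"
        by simp
    qed
    finally show ?thesis .
  qed
  then have "(\<lambda>n. \<Sum>k\<le>Suc n. (real k / real (Suc n)) ^ Suc j * L (bernstein_poly (Suc n) k))
               \<longlonglongrightarrow> L ([:0, 1:] ^ Suc j)"
    using lim_b by (simp only:)
  then show ?case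
    by (subst (asm) filterlim_sequentially_Suc)
qed

text \<open>The Bernstein weights at the nodes k/n are probability measures on [0, 1], so a
  subsequence converges weakly. Its limit has the moments of \<open>L\<close>, because the moments
  of the whole sequence converge to them.\<close>

theorem hausdorff_moment_problem:
  assumes "completely_monotone_functional L" and L1: "L 1 = 1"
  shows "\<exists>M. real_distribution M \<and> emeasure M (- {0..1}) = 0 \<and> (\<forall>p. L p = (\<integral>t. poly p t \<partial>M))"
proof -
  interpret completely_monotone_functional L by fact
  define w where "w n k = (if k \<le> n then L (bernstein_poly n k) else 0)" for n k
  define q where "q n = embed_pmf (w n)" for n
  have pmf_q: "pmf (q n) k = w n k" for n k
    unfolding q_def
  proof (rule pmf_embed_pmf)
    show "0 \<le> w n x" for x by (simp add: w_def L_bernstein_nonneg)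
    have "(\<integral>\<^sup>+x. ennreal (w n x) \<partial>count_space UNIV) = (\<Sum>k\<le>n. ennreal (w n k))"
      by (rule nn_integral_count_space'[where A = "{..n}"]) (auto simp: w_def)
    also have "\<dots> = 1"
      by (subst sum_ennreal) (auto simp: w_def L_bernstein_nonneg sum_L_bernstein L1)
    finally show "(\<integral>\<^sup>+x. ennreal (w n x) \<partial>count_space UNIV) = 1" .
  qed
  have set_q: "set_pmf (q n) \<subseteq> {..n}" for n
    by (auto simp: set_pmf_eq pmf_q w_def)
  define \<nu> where "\<nu> n = distr (measure_pmf (q n)) borel (\<lambda>k. real k / real n)" for n
  have int_\<nu>: "(\<integral>t. f t \<partial>\<nu> n) = (\<Sum>k\<le>n. f (real k / real n) * L (bernstein_poly n k))"
    if "f \<in> borel_measurable borel" for f :: "real \<Rightarrow> real" and n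
  proof -
    have "(\<integral>t. f t \<partial>\<nu> n) = (\<integral>k. f (real k / real n) \<partial>measure_pmf (q n))"
      unfolding \<nu>_def by (rule integral_distr) (use that in auto)
    also have "\<dots> = (\<Sum>k\<le>n. f (real k / real n) * pmf (q n) k)"
      by (rule integral_measure_pmf_real) (use set_q in auto)
    finally show ?thesis by (simp add: pmf_q w_def)
  qed
  have \<nu>_dist: "real_distribution (\<nu> n)" for n
    unfolding \<nu>_def by (rule prob_space.real_distribution_distr) (auto intro: measure_pmf.prob_space_axioms)
  have ratio: "real k / real n \<in> {0..1}" if "k \<le> n" for k n :: nat
    using that by (cases "n = 0") auto
  have "tight \<nu>"
    unfolding tight_def
  proof (intro conjI allI impI \<nu>_dist)
    fix e :: real assume "e > 0"
    \<comment> \<open>Tightness is stated with intervals open on the left, so the left end must lie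
      below 0 to catch the node 0.\<close>
    have "measure (\<nu> n) {-1<..1} = 1" for n
    proof -
      have "measure (\<nu> n) {-1<..1} = measure (measure_pmf (q n)) {k. real k / real n \<in> {-1<..1}}"
        unfolding \<nu>_def by (subst measure_distr) (auto simp: vimage_def)
      also have "\<dots> = 1"
      proof (subst measure_pmf.prob_eq_1)
        show "AE k in measure_pmf (q n). k \<in> {k. real k / real n \<in> {-1<..1}}"
        proof (rule AE_pmfI)
          fix k assume "k \<in> set_pmf (q n)"
          then have "k \<le> n" using set_q by auto
          then have "real k / real n \<in> {0..1}" by (rule ratio)
          moreover have "{0..1} \<subseteq> {-1<..1 :: real}" by auto
          ultimately show "k \<in> {k. real k / real n \<in> {-1<..1}}" by blast
        qed
      qed simp
      finally show ?thesis .
    qed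
    then show "\<exists>a b. a < b \<and> (\<forall>n. 1 - e < measure (\<nu> n) {a<..b})"
      using \<open>e > 0\<close> by (intro exI[of _ "-1"] exI[of _ 1]) auto
  qed
  from tight_imp_convergent_subsubsequence[OF this strict_mono_id]
  obtain r M where r: "strict_mono (r :: nat \<Rightarrow> nat)" and M: "real_distribution M"
    and conv: "weak_conv_m (\<nu> \<circ> r) M" by auto
  interpret M: real_distribution M by fact
  have lim: "(\<lambda>n. \<Sum>k\<le>r n. f (real k / real (r n)) * L (bernstein_poly (r n) k)) \<longlonglongrightarrow> (\<integral>t. f t \<partial>M)"
    if cont: "continuous_on UNIV f" and bd: "\<And>t. \<bar>f t\<bar> \<le> B" for f :: "real \<Rightarrow> real" and B
  proof -
    have "(\<lambda>n. \<integral>t. f t \<partial>((\<nu> \<circ> r) n)) \<longlonglongrightarrow> (\<integral>t. f t \<partial>M)"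
      using cont bd
      by (intro weak_conv_imp_integral_bdd_continuous_conv[OF _ M conv])
         (auto simp: \<nu>_dist continuous_on_eq_continuous_at)
    moreover have "f \<in> borel_measurable borel"
      using cont by (rule borel_measurable_continuous_onI)
    ultimately show ?thesis by (simp add: int_\<nu>)
  qed
  \<comment> \<open>Weak convergence tests only bounded continuous functions, and powers are
    unbounded on the line. Clamping to [0, 1] makes them bounded without changing them at the
    nodes.\<close>
  define c where "c t = max 0 (min 1 t)" for t :: real
  have c_cont: "continuous_on UNIV c" unfolding c_def by (intro continuous_intros)
  have c_id: "c t = t" if "t \<in> {0..1}" for t using that by (auto simp: c_def)
  have c_range: "c t \<in> {0..1}" for t by (auto simp: c_def)
  have supp: "emeasure M (- {0..1}) = 0"
  proof -
    \<comment> \<open>A bounded continuous function whose zero set is exactly [0, 1]: its integrals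
      against the approximating measures vanish, hence so does its integral against
      \<open>M\<close>.\<close>
    define h where "h t = min 1 \<bar>t - c t\<bar>" for t
    have h_cont: "continuous_on UNIV h" unfolding h_def using c_cont by (intro continuous_intros)
    have "(\<lambda>n. \<Sum>k\<le>r n. h (real k / real (r n)) * L (bernstein_poly (r n) k)) \<longlonglongrightarrow> (\<integral>t. h t \<partial>M)"
      by (rule lim[OF h_cont, of 1]) (auto simp: h_def)
    moreover have "(\<Sum>k\<le>r n. h (real k / real (r n)) * L (bernstein_poly (r n) k)) = 0" for n
      by (rule sum.neutral) (use ratio c_id in \<open>auto simp: h_def\<close>)
    ultimately have "(\<integral>t. h t \<partial>M) = 0"
      by (simp add: LIMSEQ_const_iff)
    moreover have h_meas: "h \<in> borel_measurable M"
      using borel_measurable_continuous_onI[OF h_cont] by simp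
    moreover have "integrable M h"
      by (rule M.integrable_const_bound[where B = 1]) (use h_meas in \<open>auto simp: h_def\<close>)
    ultimately have "AE t in M. h t = 0"
      by (subst (asm) integral_nonneg_eq_0_iff_AE) (auto simp: h_def)
    then have "AE t in M. t \<notin> - {0..1}"
    proof (rule AE_mp, intro AE_I2 impI)
      fix t assume "h t = 0"
      then have "t = c t" by (auto simp: h_def min_def split: if_splits)
      with c_range[of t] show "t \<notin> - {0..1}" by simp
    qed
    then show ?thesis
      by (intro AE_iff_measurable[THEN iffD1, of "- {0..1}" M "\<lambda>t. t \<notin> - {0..1}"]) auto
  qed
  have AE01: "AE t in M. t \<in> {0..1}"
    by (rule AE_I[where N = "- {0..1}"]) (use supp in auto)
  have moments: "L ([:0, 1:] ^ j) = (\<integral>t. t ^ j \<partial>M)" for j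
  proof -
    have "(\<lambda>n. \<Sum>k\<le>r n. c (real k / real (r n)) ^ j * L (bernstein_poly (r n) k)) \<longlonglongrightarrow> (\<integral>t. c t ^ j \<partial>M)"
      by (rule lim[of _ 1])
         (use c_cont in \<open>auto intro!: continuous_intros simp: power_abs power_le_one c_def\<close>)
    also have "(\<lambda>n. \<Sum>k\<le>r n. c (real k / real (r n)) ^ j * L (bernstein_poly (r n) k)) =
          (\<lambda>n. \<Sum>k\<le>n. (real k / real n) ^ j * L (bernstein_poly n k)) \<circ> r"
      using ratio c_id by (auto simp: fun_eq_iff intro!: sum.cong)
    finally have lim_c: "\<dots> \<longlonglongrightarrow> (\<integral>t. c t ^ j \<partial>M)" .
    have "((\<lambda>n. \<Sum>k\<le>n. (real k / real n) ^ j * L (bernstein_poly n k)) \<circ> r) \<longlonglongrightarrow> L ([:0, 1:] ^ j)"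
      by (rule LIMSEQ_subseq_LIMSEQ[OF bernstein_moments_tendsto r]) unfold_locales
    from LIMSEQ_unique[OF this lim_c] have "L ([:0, 1:] ^ j) = (\<integral>t. c t ^ j \<partial>M)" .
    also have "(\<integral>t. c t ^ j \<partial>M) = (\<integral>t. t ^ j \<partial>M)"
    proof (rule integral_cong_AE)
      show "(\<lambda>t. c t ^ j) \<in> borel_measurable M" by (simp add: c_def)
      show "AE t in M. c t ^ j = t ^ j"
        using AE01 by eventually_elim (simp add: c_id)
    qed simp
    finally show ?thesis .
  qed
  have int_pow: "integrable M (\<lambda>t. t ^ j)" for j
  proof (rule M.integrable_const_bound[where B = 1])
    show "AE t in M. norm (t ^ j) \<le> 1"
      using AE01 by eventually_elim (auto simp: power_abs power_le_one)
  qed auto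
  have "L p = (\<integral>t. poly p t \<partial>M)" for p
  proof -
    have "p = (\<Sum>i\<le>degree p. smult (coeff p i) ([:0, 1:] ^ i))"
      using poly_as_sum_of_monoms[of p] by (simp add: monom_altdef)
    then have "L p = (\<Sum>i\<le>degree p. coeff p i * L ([:0, 1:] ^ i))"
      by (metis (no_types, lifting) L_sum L_smult sum.cong)
    also have "\<dots> = (\<integral>t. (\<Sum>i\<le>degree p. coeff p i * t ^ i) \<partial>M)"
      by (simp add: moments int_pow)
    finally show ?thesis by (simp add: poly_altdef)
  qed
  with M supp show ?thesis by blast
qed

section \<open>Polynomial approximation in mean square\<close>

text \<open>The total mass is left free: the spectral measure of a vector x has mass <x, x>.\<close>

definition unit_measure :: "real measure \<Rightarrow> bool" where
  "unit_measure M \<longleftrightarrow> finite_measure M \<and> sets M = sets borel \<and> emeasure M (- {0..1}) = 0"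

text \<open>Boundedness is asked on [0, 1] only, so that polynomials qualify.\<close>

definition bounded_borel :: "(real \<Rightarrow> real) \<Rightarrow> bool" where
  "bounded_borel f \<longleftrightarrow> f \<in> borel_measurable borel \<and> (\<exists>B. \<forall>t\<in>{0..1}. \<bar>f t\<bar> \<le> B)"

lemma unit_measure_AE:
  assumes "unit_measure M"
  shows "AE t in M. t \<in> {0..1}"
  by (rule AE_I[where N = "- {0..1}"])
     (use assms in \<open>auto simp: unit_measure_def sets_eq_imp_space_eq\<close>)

lemma bounded_borel_cont:
  assumes "continuous_on UNIV f" shows "bounded_borel f"
proof -
  have "bounded (f ` {0..1})"
    by (intro compact_imp_bounded compact_continuous_image continuous_on_subset[OF assms]) auto
  then show ?thesis
    using assms unfolding bounded_borel_def bounded_iff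
    by (auto intro: borel_measurable_continuous_onI)
qed

lemma bounded_borel_poly: "bounded_borel (poly p)"
  by (rule bounded_borel_cont) (intro continuous_intros)

lemma bounded_borel_indicator: "A \<in> sets borel \<Longrightarrow> bounded_borel (indicator A)"
  unfolding bounded_borel_def by (auto intro!: exI[of _ 1] simp: indicator_def)

lemma bounded_borel_const: "bounded_borel (\<lambda>t. c)"
  by (rule bounded_borel_cont) (intro continuous_intros)

lemma bounded_borel_add:
  assumes "bounded_borel f" "bounded_borel g" shows "bounded_borel (\<lambda>t. f t + g t)"
proof -
  from assms obtain B C where "\<forall>t\<in>{0..1}. \<bar>f t\<bar> \<le> B" "\<forall>t\<in>{0..1}. \<bar>g t\<bar> \<le> C"
    by (auto simp: bounded_borel_def)
  then have "\<forall>t\<in>{0..1}. \<bar>f t + g t\<bar> \<le> B + C" by (meson abs_triangle_ineq add_mono order_trans)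
  then show ?thesis using assms by (auto simp: bounded_borel_def)
qed

lemma bounded_borel_mult:
  assumes "bounded_borel f" "bounded_borel g" shows "bounded_borel (\<lambda>t. f t * g t)"
proof -
  from assms obtain B C where "\<forall>t\<in>{0..1}. \<bar>f t\<bar> \<le> B" "\<forall>t\<in>{0..1}. \<bar>g t\<bar> \<le> C"
    by (auto simp: bounded_borel_def)
  then have "\<forall>t\<in>{0..1}. \<bar>f t * g t\<bar> \<le> B * C"
    unfolding abs_mult by (meson abs_ge_zero mult_mono order_trans)
  then show ?thesis using assms by (auto simp: bounded_borel_def)
qed

lemma bounded_borel_diff:
  assumes "bounded_borel f" "bounded_borel g" shows "bounded_borel (\<lambda>t. f t - g t)"
  using bounded_borel_add[OF assms(1) bounded_borel_mult[OF bounded_borel_const[of "-1"] assms(2)]]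
  by simp

lemma bounded_borel_power2: "bounded_borel f \<Longrightarrow> bounded_borel (\<lambda>t. (f t)\<^sup>2)"
  unfolding power2_eq_square by (rule bounded_borel_mult)

lemma bounded_borel_abs: "bounded_borel f \<Longrightarrow> bounded_borel (\<lambda>t. \<bar>f t\<bar>)"
  unfolding bounded_borel_def by auto

lemma bounded_borel_sum:
  "(\<And>i. i \<in> A \<Longrightarrow> bounded_borel (f i)) \<Longrightarrow> bounded_borel (\<lambda>t. \<Sum>i\<in>A. f i t)"
  by (induction A rule: infinite_finite_induct) (auto intro: bounded_borel_const bounded_borel_add)

lemmas bounded_borel_intros = bounded_borel_poly bounded_borel_indicator bounded_borel_const
  bounded_borel_add bounded_borel_mult bounded_borel_diff bounded_borel_power2 bounded_borel_abs
  bounded_borel_sum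

lemma unit_measure_integrable:
  assumes M: "unit_measure M" and f: "bounded_borel f"
  shows "integrable M f"
proof -
  from f obtain B where B: "\<forall>t\<in>{0..1}. \<bar>f t\<bar> \<le> B" by (auto simp: bounded_borel_def)
  interpret finite_measure M using M by (simp add: unit_measure_def)
  have "AE t in M. norm (f t) \<le> B"
    using unit_measure_AE[OF M] by eventually_elim (use B in auto)
  moreover have "f \<in> borel_measurable M"
    using f M by (simp add: bounded_borel_def unit_measure_def cong: measurable_cong_sets)
  ultimately show ?thesis by (rule integrable_const_bound)
qed

lemma unit_measure_integral_mono:
  assumes "unit_measure M" "bounded_borel f" "bounded_borel g" "\<And>t. t \<in> {0..1} \<Longrightarrow> f t \<le> g t"
  shows "(\<integral>t. f t \<partial>M) \<le> (\<integral>t. g t \<partial>M)"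
proof (rule integral_mono_AE)
  show "AE t in M. f t \<le> g t"
    using unit_measure_AE[OF assms(1)] by eventually_elim (use assms in auto)
qed (use assms unit_measure_integrable in auto)

lemma square_diff_triangle: "(a - c)\<^sup>2 \<le> 2 * (a - b)\<^sup>2 + 2 * (b - c)\<^sup>2" for a b c :: real
proof -
  have "0 \<le> ((a - b) - (b - c))\<^sup>2" by simp
  then show ?thesis by (simp add: power2_eq_square algebra_simps)
qed

text \<open>A substitute for Minkowski's inequality that works with squared distances; the factor 2
  is harmless where only convergence to 0 matters.\<close>

lemma L2_triangle:
  assumes M: "unit_measure M" and "bounded_borel f" "bounded_borel g" "bounded_borel h"
  shows "(\<integral>t. (f t - h t)\<^sup>2 \<partial>M) \<le> 2 * (\<integral>t. (f t - g t)\<^sup>2 \<partial>M) + 2 * (\<integral>t. (g t - h t)\<^sup>2 \<partial>M)"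
proof -
  have "(\<integral>t. (f t - h t)\<^sup>2 \<partial>M) \<le> (\<integral>t. 2 * (f t - g t)\<^sup>2 + 2 * (g t - h t)\<^sup>2 \<partial>M)"
    by (intro unit_measure_integral_mono[OF M] bounded_borel_intros assms square_diff_triangle)
  also have "\<dots> = 2 * (\<integral>t. (f t - g t)\<^sup>2 \<partial>M) + 2 * (\<integral>t. (g t - h t)\<^sup>2 \<partial>M)"
    using assms
    by (subst Bochner_Integration.integral_add)
       (auto intro!: unit_measure_integrable bounded_borel_intros simp: M)
  finally show ?thesis .
qed

text \<open>One polynomial has to serve several measures at once: applied to the spectral measures of \<open>x\<close>,
  \<open>y\<close> and \<open>x + y\<close>, this is what makes the spectral projections additive.\<close>

definition L2_approximable :: "real measure set \<Rightarrow> (real \<Rightarrow> real) \<Rightarrow> bool" where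
  "L2_approximable F f \<longleftrightarrow> (\<forall>e>0. \<exists>p. \<forall>M\<in>F. (\<integral>t. (poly p t - f t)\<^sup>2 \<partial>M) < e)"

lemma polynomial_uniform_approximation:
  fixes f :: "real \<Rightarrow> real"
  assumes "continuous_on {0..1} f" "0 < e"
  obtains p where "\<And>t. t \<in> {0..1} \<Longrightarrow> \<bar>f t - poly p t\<bar> < e"
proof -
  obtain g where g: "real_polynomial_function g" "\<And>t. t \<in> {0..1} \<Longrightarrow> \<bar>f t - g t\<bar> < e"
    using Stone_Weierstrass_real_polynomial_function[OF _ assms] compact_Icc by metis
  then obtain a n where "g = (\<lambda>x. \<Sum>i\<le>n. a i * x ^ i)"
    by (auto simp: real_polynomial_function_iff_sum)
  then have "g = poly (\<Sum>i\<le>n. monom (a i) i)"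
    by (auto simp: fun_eq_iff poly_sum poly_monom)
  with g that show thesis by auto
qed

lemma L2_approximable_continuous:
  assumes F: "\<And>M. M \<in> F \<Longrightarrow> unit_measure M" "finite F" and f: "continuous_on UNIV f"
  shows "L2_approximable F f"
  unfolding L2_approximable_def
proof (intro allI impI)
  fix e :: real assume e: "e > 0"
  \<comment> \<open>\<open>K\<close> strictly exceeds the mass of every measure in \<open>F\<close>
    and stays positive when all of them vanish; \<open>d\<close> is then chosen with d^2 K =
    e.\<close>
  define K where "K = 1 + (\<Sum>M\<in>F. measure M UNIV)"
  have K: "K > 0" "\<And>M. M \<in> F \<Longrightarrow> measure M UNIV < K"
    unfolding K_def using F(2)
    by (auto intro!: add_pos_nonneg sum_nonneg le_less_trans[OF member_le_sum[of _ F "\<lambda>M. measure M UNIV"]])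
  define d where "d = sqrt (e / K)"
  have d: "d > 0" using e K by (simp add: d_def)
  obtain p where p: "\<And>t. t \<in> {0..1} \<Longrightarrow> \<bar>f t - poly p t\<bar> < d"
    using polynomial_uniform_approximation[OF continuous_on_subset[OF f] d] by auto
  have "(\<integral>t. (poly p t - f t)\<^sup>2 \<partial>M) < e" if M: "M \<in> F" for M
  proof -
    note u = F(1)[OF M]
    interpret finite_measure M using u by (simp add: unit_measure_def)
    have sp: "space M = UNIV" using u by (auto simp: unit_measure_def dest: sets_eq_imp_space_eq)
    have "(\<integral>t. (poly p t - f t)\<^sup>2 \<partial>M) \<le> (\<integral>t. d\<^sup>2 \<partial>M)"
    proof (rule unit_measure_integral_mono[OF u])
      fix t :: real assume "t \<in> {0..1}"
      then have "\<bar>poly p t - f t\<bar> \<le> \<bar>d\<bar>" using p[of t] d by (simp add: abs_minus_commute)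
      then show "(poly p t - f t)\<^sup>2 \<le> d\<^sup>2" by (simp add: abs_le_square_iff)
    qed (intro bounded_borel_intros bounded_borel_cont f)+
    also have "\<dots> = d\<^sup>2 * measure M UNIV" by (simp add: sp)
    also have "\<dots> < d\<^sup>2 * K" using K(2)[OF M] d by simp
    also have "\<dots> = e" using e K by (simp add: d_def)
    finally show ?thesis .
  qed
  then show "\<exists>p. \<forall>M\<in>F. (\<integral>t. (poly p t - f t)\<^sup>2 \<partial>M) < e" by blast
qed

text \<open>Closedness under mean-square limits. Finiteness of \<open>F\<close> lets one index n
  serve all the measures; the quarters of e compensate the factor 2 of
  \<open>L2_triangle\<close>.\<close>

lemma L2_approximable_limit:
  assumes F: "\<And>M. M \<in> F \<Longrightarrow> unit_measure M" "finite F" and f: "bounded_borel f"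
    and g: "\<And>n. bounded_borel (g n)" "\<And>n. L2_approximable F (g n)"
    and lim: "\<And>M. M \<in> F \<Longrightarrow> (\<lambda>n. \<integral>t. (g n t - f t)\<^sup>2 \<partial>M) \<longlonglongrightarrow> 0"
  shows "L2_approximable F f"
  unfolding L2_approximable_def
proof (intro allI impI)
  fix e :: real assume e: "e > 0"
  have "\<forall>\<^sub>F n in sequentially. \<forall>M\<in>F. (\<integral>t. (g n t - f t)\<^sup>2 \<partial>M) < e / 4"
    using F(2) lim e by (auto intro!: eventually_ball_finite order_tendstoD(2))
  then obtain n where n: "\<forall>M\<in>F. (\<integral>t. (g n t - f t)\<^sup>2 \<partial>M) < e / 4"
    by (auto simp: eventually_sequentially)
  from g(2)[of n] e obtain p where p: "\<forall>M\<in>F. (\<integral>t. (poly p t - g n t)\<^sup>2 \<partial>M) < e / 4"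
    unfolding L2_approximable_def by (meson divide_pos_pos zero_less_numeral)
  have "(\<integral>t. (poly p t - f t)\<^sup>2 \<partial>M) < e" if M: "M \<in> F" for M
    using L2_triangle[OF F(1)[OF M] bounded_borel_poly[of p] g(1)[of n] f] n p M by fastforce
  then show "\<exists>p. \<forall>M\<in>F. (\<integral>t. (poly p t - f t)\<^sup>2 \<partial>M) < e" by blast
qed

lemma L2_approximable_add:
  assumes F: "\<And>M. M \<in> F \<Longrightarrow> unit_measure M"
    and f: "bounded_borel f" "L2_approximable F f" and g: "bounded_borel g" "L2_approximable F g"
  shows "L2_approximable F (\<lambda>t. f t + g t)"
  unfolding L2_approximable_def
proof (intro allI impI)
  fix e :: real assume e: "e > 0"
  from f(2) e obtain p where p: "\<forall>M\<in>F. (\<integral>t. (poly p t - f t)\<^sup>2 \<partial>M) < e / 4"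
    unfolding L2_approximable_def by (meson divide_pos_pos zero_less_numeral)
  from g(2) e obtain q where q: "\<forall>M\<in>F. (\<integral>t. (poly q t - g t)\<^sup>2 \<partial>M) < e / 4"
    unfolding L2_approximable_def by (meson divide_pos_pos zero_less_numeral)
  have "(\<integral>t. (poly (p + q) t - (f t + g t))\<^sup>2 \<partial>M) < e" if M: "M \<in> F" for M
  proof -
    have "(\<integral>t. (poly (p + q) t - (f t + g t))\<^sup>2 \<partial>M)
        \<le> 2 * (\<integral>t. (poly (p + q) t - (f t + poly q t))\<^sup>2 \<partial>M)
          + 2 * (\<integral>t. ((f t + poly q t) - (f t + g t))\<^sup>2 \<partial>M)"
      by (intro L2_triangle[OF F[OF M]] bounded_borel_intros f g)
    then show ?thesis using p q M by (fastforce simp: algebra_simps)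
  qed
  then show "\<exists>p. \<forall>M\<in>F. (\<integral>t. (poly p t - (f t + g t))\<^sup>2 \<partial>M) < e" by blast
qed

lemma L2_approximable_sum:
  assumes F: "\<And>M. M \<in> F \<Longrightarrow> unit_measure M"
    and f: "\<And>i. i \<in> I \<Longrightarrow> bounded_borel (f i)" "\<And>i. i \<in> I \<Longrightarrow> L2_approximable F (f i)"
  shows "L2_approximable F (\<lambda>t. \<Sum>i\<in>I. f i t)"
  using f
proof (induction I rule: infinite_finite_induct)
  case (insert i I)
  then show ?case by (simp add: L2_approximable_add[OF F] bounded_borel_sum)
qed (auto simp: L2_approximable_def intro!: exI[of _ 0])

lemma bounded_convergence_L2:
  assumes M: "unit_measure M" and f: "bounded_borel f" and g: "\<And>n. bounded_borel (g n)"
    and lim: "\<And>t. (\<lambda>n. g n t) \<longlonglongrightarrow> f t" and bd: "\<And>n t. \<bar>g n t - f t\<bar> \<le> 1"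
  shows "(\<lambda>n. \<integral>t. (g n t - f t)\<^sup>2 \<partial>M) \<longlonglongrightarrow> 0"
proof -
  have "(\<lambda>n. \<integral>t. (g n t - f t)\<^sup>2 \<partial>M) \<longlonglongrightarrow> (\<integral>t. 0 \<partial>M)"
  proof (rule integral_dominated_convergence[where w = "\<lambda>_. 1"])
    show "integrable M (\<lambda>_. 1 :: real)"
      by (rule unit_measure_integrable[OF M bounded_borel_const])
    show "(\<lambda>t. (g n t - f t)\<^sup>2) \<in> borel_measurable M" for n
      by (intro borel_measurable_integrable unit_measure_integrable[OF M] bounded_borel_intros f g)
    show "AE t in M. (\<lambda>n. (g n t - f t)\<^sup>2) \<longlonglongrightarrow> 0"
      using lim by (intro AE_I2) (auto intro!: tendsto_eq_intros)
    show "AE t in M. norm ((g n t - f t)\<^sup>2) \<le> 1" for n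
      using bd by (intro AE_I2) (simp add: abs_square_le_1)
  qed auto
  then show ?thesis by simp
qed

lemma disjoint_indicator_sums:
  assumes "disjoint_family A"
  shows "(\<lambda>n. \<Sum>i<n. indicator (A i) t :: real) \<longlonglongrightarrow> indicator (\<Union>i. A i) t"
    and "\<bar>(\<Sum>i<n. indicator (A i) t) - indicator (\<Union>i. A i) t\<bar> \<le> (1 :: real)"
proof -
  have eq: "(\<Sum>i<n. indicator (A i) t :: real) = indicator (\<Union>i<n. A i) t" for n
    by (rule indicator_UN_disjoint[symmetric])
       (use assms in \<open>auto simp: disjoint_family_on_def\<close>)
  show "\<bar>(\<Sum>i<n. indicator (A i) t) - indicator (\<Union>i. A i) t\<bar> \<le> (1 :: real)"
    unfolding eq by (auto simp: indicator_def)
  show "(\<lambda>n. \<Sum>i<n. indicator (A i) t :: real) \<longlonglongrightarrow> indicator (\<Union>i. A i) t"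
    unfolding eq by (rule LIMSEQ_indicator_UN)
qed

text \<open>A Dynkin argument: closed half-lines are an intersection-stable generator of the Borel
  sets, complements correspond to the polynomials 1 - p, and a disjoint union is the mean-square
  limit of its finite partial sums.\<close>

lemma L2_approximable_indicator:
  assumes F: "\<And>M. M \<in> F \<Longrightarrow> unit_measure M" "finite F" and A: "A \<in> sets borel"
  shows "L2_approximable F (indicator A)"
proof -
  have ray: "L2_approximable F (indicator {..a})" for a
  proof -
    \<comment> \<open>A ramp that is 1 up to and including \<open>a\<close> and, for positive n, 0
      from a + 1/n on, so the pointwise limit is the indicator of the closed half-line.\<close>
    define g where "g n t = max 0 (min 1 (1 - real n * (t - a)))" for n :: nat and t
    have g_cont: "continuous_on UNIV (g n)" for n
      unfolding g_def by (intro continuous_intros)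
    have lim: "(\<lambda>n. g n t) \<longlonglongrightarrow> indicator {..a} t" for t
    proof (cases "t \<le> a")
      case True
      then have "real n * (t - a) \<le> 0" for n by (simp add: mult_nonneg_nonpos)
      then have "g n t = 1" for n by (smt (verit) g_def)
      with True show ?thesis by simp
    next
      case False
      have "\<forall>\<^sub>F n in sequentially. g n t = 0"
      proof -
        have "\<forall>\<^sub>F n in sequentially. 1 / (t - a) < real n"
          using filterlim_real_sequentially by (auto simp: filterlim_at_top_dense)
        then show ?thesis
          by eventually_elim (use False in \<open>auto simp: g_def field_simps max_def min_def\<close>)
      qed
      with False show ?thesis by (auto intro: tendsto_eventually)
    qed
    show ?thesis
    proof (rule L2_approximable_limit[OF F _ _ _ bounded_convergence_L2])
      show "L2_approximable F (g n)" for n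
        by (rule L2_approximable_continuous[OF F g_cont])
      show "\<bar>g n t - indicator {..a} t\<bar> \<le> 1" for n t
        by (auto simp: g_def indicator_def)
    qed (use lim F in \<open>auto intro: bounded_borel_intros bounded_borel_cont g_cont\<close>)
  qed
  have sigma: "sets (borel :: real measure) = sigma_sets UNIV (range (\<lambda>a. {..a}))"
    unfolding borel_eq_atMost by (rule sets_measure_of) auto
  show ?thesis
  proof (rule sigma_sets_induct_disjoint[of "range (\<lambda>a::real. {..a})" UNIV A])
    show "A \<in> sigma_sets UNIV (range (\<lambda>a. {..a}))" using A sigma by simp
    show "Int_stable (range (\<lambda>a::real. {..a}))"
      by (auto simp: Int_stable_def)
    show "L2_approximable F (indicator {})"
      by (auto simp: L2_approximable_def intro!: exI[of _ 0])
    show "L2_approximable F (indicator B)" if "B \<in> range (\<lambda>a. {..a})" for B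
      using ray that by auto
    show "L2_approximable F (indicator (UNIV - B))"
      if "L2_approximable F (indicator B)" for B
      unfolding L2_approximable_def
    proof (intro allI impI)
      fix e :: real assume "e > 0"
      with that obtain p where "\<forall>M\<in>F. (\<integral>t. (poly p t - indicator B t)\<^sup>2 \<partial>M) < e"
        unfolding L2_approximable_def by blast
      moreover have "(poly (1 - p) t - indicator (UNIV - B) t)\<^sup>2 = (poly p t - indicator B t)\<^sup>2" for t
        by (auto simp: indicator_def power2_commute)
      ultimately show "\<exists>p. \<forall>M\<in>F. (\<integral>t. (poly p t - indicator (UNIV - B) t)\<^sup>2 \<partial>M) < e"
        by (intro exI[of _ "1 - p"]) simp
    qed
    fix B :: "nat \<Rightarrow> real set"
    assume B: "disjoint_family B" "range B \<subseteq> sigma_sets UNIV (range (\<lambda>a. {..a}))"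
      and IH: "\<And>i. L2_approximable F (indicator (B i))"
    have B_borel: "B i \<in> sets borel" for i
      unfolding sigma using B(2) by auto
    show "L2_approximable F (indicator (\<Union>i. B i))"
    proof (rule L2_approximable_limit[OF F, where g = "\<lambda>n t. \<Sum>i<n. indicator (B i) t"])
      show "L2_approximable F (\<lambda>t. \<Sum>i<n. indicator (B i) t)" for n
        by (intro L2_approximable_sum F IH bounded_borel_intros B_borel)
      show "(\<lambda>n. \<integral>t. ((\<Sum>i<n. indicator (B i) t :: real) - indicator (\<Union>i. B i) t)\<^sup>2 \<partial>M) \<longlonglongrightarrow> 0"
        if "M \<in> F" for M
      proof (rule bounded_convergence_L2[OF F(1)[OF that], where f = "indicator (\<Union>i. B i)"
              and g = "\<lambda>n t. \<Sum>i<n. indicator (B i) t"])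
      qed (intro disjoint_indicator_sums[OF B(1)] bounded_borel_intros sets.countable_UN;
            use B_borel in auto)+
    qed (use B_borel in \<open>auto intro!: bounded_borel_intros\<close>)
  qed auto
qed

section \<open>Spectral theorem for positive contractions\<close>

lemma tendsto_zero_squeeze:
  fixes a b :: "nat \<Rightarrow> real"
  assumes "\<And>n. a n \<le> b n" "b \<longlonglongrightarrow> 0" "\<And>n. 0 \<le> a n"
  shows "a \<longlonglongrightarrow> 0"
  by (rule tendsto_sandwich[OF _ _ tendsto_const assms(2)]) (use assms in auto)

text \<open>The cross term in g^2 = f^2 + (g - f)^2 + 2 f (g - f) is split pointwise by the weighted
  inequality 2 |f (g - f)| \<le> (g - f)^2 / d + d f^2, and the weight d is sent to 0 with
  e.\<close>

lemma L2_square_tendsto: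
  assumes M: "unit_measure M" and f: "bounded_borel f" and g: "\<And>n. bounded_borel (g n)"
    and lim: "(\<lambda>n. \<integral>t. (g n t - f t)\<^sup>2 \<partial>M) \<longlonglongrightarrow> 0"
  shows "(\<lambda>n. \<integral>t. (g n t)\<^sup>2 \<partial>M) \<longlonglongrightarrow> (\<integral>t. (f t)\<^sup>2 \<partial>M)"
proof (rule LIMSEQ_I)
  note int = unit_measure_integrable[OF M]
  fix e :: real assume e: "e > 0"
  define I where "I = (\<integral>t. (f t)\<^sup>2 \<partial>M)"
  have I: "I \<ge> 0" unfolding I_def by simp
  \<comment> \<open>Chosen to give d I < e/2; adding 1 in the denominator covers I = 0.\<close>
  define d where "d = e / (2 * (I + 1))"
  have d: "d > 0" "d * I < e / 2"
    using e I by (auto simp: d_def field_simps add_pos_nonneg)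
  have bound: "\<bar>(\<integral>t. (g n t)\<^sup>2 \<partial>M) - I\<bar> \<le> (1 + 1 / d) * (\<integral>t. (g n t - f t)\<^sup>2 \<partial>M) + d * I" for n
  proof -
    have pw: "\<bar>(g n t)\<^sup>2 - (f t)\<^sup>2\<bar> \<le> (1 + 1 / d) * (g n t - f t)\<^sup>2 + d * (f t)\<^sup>2" for t
    proof -
      have "0 \<le> (f t * d + (g n t - f t))\<^sup>2" "0 \<le> (f t * d - (g n t - f t))\<^sup>2" by simp_all
      then have "\<bar>2 * f t * (g n t - f t)\<bar> * d \<le> (g n t - f t)\<^sup>2 + d * (f t)\<^sup>2 * d"
        using d(1) by (simp add: abs_if power2_eq_square algebra_simps)
      then have "\<bar>2 * f t * (g n t - f t)\<bar> \<le> (1 / d) * (g n t - f t)\<^sup>2 + d * (f t)\<^sup>2"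
        using d(1) by (simp add: field_simps)
      moreover have "(g n t)\<^sup>2 - (f t)\<^sup>2 = (g n t - f t)\<^sup>2 + 2 * f t * (g n t - f t)"
        by (simp add: power2_eq_square algebra_simps)
      ultimately show ?thesis
        using zero_le_power2[of "g n t - f t"] by (simp only: distrib_right mult_1)
    qed
    have "(\<integral>t. (g n t)\<^sup>2 \<partial>M) - I = (\<integral>t. (g n t)\<^sup>2 - (f t)\<^sup>2 \<partial>M)"
      unfolding I_def
      by (rule Bochner_Integration.integral_diff[symmetric]; intro int bounded_borel_intros f g)
    also have "\<bar>\<dots>\<bar> \<le> (\<integral>t. \<bar>(g n t)\<^sup>2 - (f t)\<^sup>2\<bar> \<partial>M)"
      by (rule integral_abs_bound)
    also have "\<dots> \<le> (\<integral>t. (1 + 1 / d) * (g n t - f t)\<^sup>2 + d * (f t)\<^sup>2 \<partial>M)"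
      by (intro unit_measure_integral_mono[OF M] bounded_borel_intros f g pw)
    also have "\<dots> = (1 + 1 / d) * (\<integral>t. (g n t - f t)\<^sup>2 \<partial>M) + d * I"
      unfolding I_def
      by (subst Bochner_Integration.integral_add) (auto intro!: int bounded_borel_intros f g)
    finally show ?thesis .
  qed
  have "(\<lambda>n. (1 + 1 / d) * (\<integral>t. (g n t - f t)\<^sup>2 \<partial>M)) \<longlonglongrightarrow> 0"
    using lim by (rule tendsto_mult_right_zero)
  then have "\<forall>\<^sub>F n in sequentially. (1 + 1 / d) * (\<integral>t. (g n t - f t)\<^sup>2 \<partial>M) < e / 2"
    by (rule order_tendstoD) (use e in simp)
  then have "\<forall>\<^sub>F n in sequentially. norm ((\<integral>t. (g n t)\<^sup>2 \<partial>M) - I) < e"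
  proof eventually_elim
    case (elim n)
    with bound[of n] d(2) show ?case unfolding real_norm_def by linarith
  qed
  then show "\<exists>no. \<forall>n\<ge>no. norm ((\<integral>t. (g n t)\<^sup>2 \<partial>M) - (\<integral>t. (f t)\<^sup>2 \<partial>M)) < e"
    by (simp add: I_def eventually_sequentially)
qed

lemma L2_approximable_sequence:
  assumes "L2_approximable F f"
  obtains p where "\<forall>M\<in>F. (\<lambda>n. \<integral>t. (poly (p n) t - f t)\<^sup>2 \<partial>M) \<longlonglongrightarrow> 0"
proof -
  have "\<exists>p. \<forall>M\<in>F. (\<integral>t. (poly p t - f t)\<^sup>2 \<partial>M) < inverse (real (Suc n))" for n
    using assms unfolding L2_approximable_def by (meson inverse_positive_iff_positive of_nat_0_less_iff zero_less_Suc)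
  then obtain p where p: "\<And>n M. M \<in> F \<Longrightarrow> (\<integral>t. (poly (p n) t - f t)\<^sup>2 \<partial>M) < inverse (real (Suc n))"
    by metis
  show thesis
  proof (rule that, rule ballI)
    fix M assume "M \<in> F"
    show "(\<lambda>n. \<integral>t. (poly (p n) t - f t)\<^sup>2 \<partial>M) \<longlonglongrightarrow> 0"
      by (rule tendsto_zero_squeeze[OF less_imp_le[OF p[OF \<open>M \<in> F\<close>]] LIMSEQ_inverse_real_of_nat]) simp
  qed
qed

lemma tendsto_norm_square_zero:
  fixes f :: "nat \<Rightarrow> 'a :: real_normed_vector"
  assumes "(\<lambda>n. (norm (f n - l))\<^sup>2) \<longlonglongrightarrow> 0"
  shows "f \<longlonglongrightarrow> l"
proof -
  from tendsto_real_sqrt[OF assms] have "(\<lambda>n. norm (f n - l)) \<longlonglongrightarrow> 0" by simp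
  then show ?thesis by (simp only: tendsto_norm_zero_iff LIM_zero_iff)
qed

text \<open>The form of self-adjointness with 0 \<le> T \<le> 1 that a real inner product can
  express; polynomials with real coefficients stay within it.\<close>

locale positive_contraction =
  fixes T :: "'h :: {real_inner, complete_space} \<Rightarrow> 'h"
  assumes bounded_linear_T: "bounded_linear T"
    and T_sym: "inner (T x) y = inner x (T y)"
    and T_nonneg: "0 \<le> inner (T x) x"
    and T_le: "inner (T x) x \<le> inner x x"
begin

section \<open>Polynomials of a positive contraction\<close>

definition poly_op :: "real poly \<Rightarrow> 'h \<Rightarrow> 'h" where
  "poly_op p = fold_coeffs (\<lambda>a f x. a *\<^sub>R x + T (f x)) p (\<lambda>x. 0)"

lemma poly_op_0 [simp]: "poly_op 0 x = 0"
  by (simp add: poly_op_def)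

lemma T_0 [simp]: "T 0 = 0"
  using bounded_linear_T by (rule linear_simps)

lemma poly_op_pCons [simp]: "poly_op (pCons a p) x = a *\<^sub>R x + T (poly_op p x)"
  by (cases "p = 0 \<and> a = 0")
     (auto simp: poly_op_def fold_coeffs_pCons_coeff_not_0_eq fold_coeffs_pCons_not_0_0_eq)

lemma poly_op_1 [simp]: "poly_op 1 x = x"
  by (simp add: one_pCons)

lemma bounded_linear_poly_op: "bounded_linear (poly_op p)"
proof (induction p)
  case 0
  have "poly_op 0 = (\<lambda>x. 0)" by (simp add: fun_eq_iff)
  then show ?case by (simp add: bounded_linear_zero)
next
  case (pCons a p)
  have "bounded_linear (\<lambda>x. a *\<^sub>R x + T (poly_op p x))"
    by (intro bounded_linear_add bounded_linear_scaleR_right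
        bounded_linear_compose[OF bounded_linear_T pCons.IH])
  moreover have "poly_op (pCons a p) = (\<lambda>x. a *\<^sub>R x + T (poly_op p x))" by (simp add: fun_eq_iff)
  ultimately show ?case by simp
qed

lemmas poly_op_linear_simps = linear_simps[OF bounded_linear_poly_op]
lemmas T_linear_simps = linear_simps[OF bounded_linear_T]

lemma poly_op_add: "poly_op (p + q) x = poly_op p x + poly_op q x"
  by (induction p q rule: poly_induct2) (simp_all add: T_linear_simps algebra_simps)

lemma poly_op_smult: "poly_op (smult c p) x = c *\<^sub>R poly_op p x"
  by (induction p) (simp_all add: T_linear_simps algebra_simps)

lemma poly_op_diff: "poly_op (p - q) x = poly_op p x - poly_op q x"
  using poly_op_add[of p "smult (-1) q" x] poly_op_smult[of "-1" q x] by simp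

lemma poly_op_mult: "poly_op (p * q) x = poly_op p (poly_op q x)"
  by (induction p) (simp_all add: poly_op_add poly_op_smult)

lemma poly_op_commute:
  assumes "bounded_linear J" "\<And>x. J (T x) = T (J x)"
  shows "J (poly_op p x) = poly_op p (J x)"
  by (induction p) (simp_all add: linear_simps[OF assms(1)] assms(2))

lemma poly_op_sym: "inner (poly_op p x) y = inner x (poly_op p y)"
proof (induction p arbitrary: x y)
  case (pCons a p)
  have "inner (poly_op (pCons a p) x) y = a * inner x y + inner (poly_op p x) (T y)"
    by (simp add: inner_add_left T_sym)
  also have "inner (poly_op p x) (T y) = inner x (T (poly_op p y))"
    using pCons.IH[of x "T y"] poly_op_commute[OF bounded_linear_T, of p y] by simp
  finally show ?case by (simp add: inner_add_right)
qed simp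

text \<open>A product of commuting positive operators is positive, obtained here without square
  roots of operators. Even powers are squares q^2, and q(T) moves to the other side of the inner
  product, so both exponents reduce to 0 or 1. The one mixed case X Y, with Y = 1 - X, is X Y^2 + Y
  X^2, a sum of conjugates of positive operators.\<close>

lemma poly_op_bernstein_nonneg: "0 \<le> inner (poly_op ([:0, 1:] ^ k * [:1, -1:] ^ m) x) x"
proof -
  define X Y :: "real poly" where "X = [:0, 1:]" and "Y = [:1, -1:]"
  have sq: "inner (poly_op (r * q\<^sup>2) x) x = inner (poly_op r (poly_op q x)) (poly_op q x)" for r q x
  proof -
    have "r * q\<^sup>2 = q * (r * q)" by (simp add: power2_eq_square ac_simps)
    then show ?thesis by (simp only: poly_op_mult poly_op_sym[of q])
  qed
  have X: "0 \<le> inner (poly_op X x) x" for x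
    using T_nonneg[of x] by (simp add: X_def)
  have Y: "0 \<le> inner (poly_op Y x) x" for x
    using T_le[of x] by (simp add: Y_def inner_add_left T_linear_simps inner_diff_left)
  have "X + Y = 1" by (simp add: X_def Y_def one_pCons)
  then have "X * Y = X * Y * (X + Y)" by simp
  then have "X * Y = X * Y\<^sup>2 + Y * X\<^sup>2" by (simp only: power2_eq_square algebra_simps)
  then have XY: "0 \<le> inner (poly_op (X * Y) x) x" for x
    using X[of "poly_op Y x"] Y[of "poly_op X x"] by (simp add: poly_op_add inner_add_left sq)
  have "X ^ k * Y ^ m = (X ^ (k mod 2) * Y ^ (m mod 2)) * (X ^ (k div 2) * Y ^ (m div 2))\<^sup>2"
  proof -
    have "k = k mod 2 + 2 * (k div 2)" "m = m mod 2 + 2 * (m div 2)" by simp_all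
    then have "X ^ k = X ^ (k mod 2) * (X ^ (k div 2))\<^sup>2" "Y ^ m = Y ^ (m mod 2) * (Y ^ (m div 2))\<^sup>2"
      by (metis power_add power_mult mult.commute)+
    then show ?thesis by (simp only: power_mult_distrib ac_simps)
  qed
  moreover have "0 \<le> inner (poly_op (X ^ (k mod 2) * Y ^ (m mod 2)) y) y" for y
    using X Y XY by (cases "even k"; cases "even m") (simp_all add: odd_iff_mod_2_eq_one)
  ultimately show ?thesis
    using sq unfolding X_def Y_def by simp
qed

text \<open>The moment theorem produces a probability measure, so the functional is divided by <x,
  x> and the measure is multiplied by it afterwards. For x = 0 no such normalization exists and the
  null measure serves.\<close>

lemma spectral_measure_exists:
  "\<exists>M. unit_measure M \<and> (\<forall>p. inner (poly_op p x) x = (\<integral>t. poly p t \<partial>M))"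
proof (cases "x = 0")
  case True
  have "unit_measure (null_measure borel)"
    by (auto simp: unit_measure_def intro!: finite_measureI)
  with True show ?thesis by (intro exI[of _ "null_measure borel"]) (simp add: integral_null_measure)
next
  case False
  define c where "c = inner x x"
  have c: "c > 0" using False by (simp add: c_def)
  define L where "L p = inner (poly_op p x) x / c" for p
  have "completely_monotone_functional L"
    by standard (use c in \<open>auto simp: L_def poly_op_add poly_op_smult inner_add_left add_divide_distrib
                      poly_op_bernstein_nonneg intro!: divide_nonneg_pos\<close>)
  moreover have "L 1 = 1" using c by (simp add: L_def c_def)
  ultimately obtain M where M: "real_distribution M" "emeasure M (- {0..1}) = 0"
    and L: "\<And>p. L p = (\<integral>t. poly p t \<partial>M)"
    using hausdorff_moment_problem by blast
  interpret real_distribution M by fact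
  define N where "N = density M (\<lambda>_. ennreal c)"
  have em: "emeasure N A = ennreal c * emeasure M A" if "A \<in> sets borel" for A
    unfolding N_def by (subst emeasure_density) (use that in \<open>auto simp: nn_integral_cmult\<close>)
  have "unit_measure N"
    unfolding unit_measure_def
  proof (intro conjI)
    show "sets N = sets borel" by (simp add: N_def)
    show "emeasure N (- {0..1}) = 0" by (simp add: em M)
    show "finite_measure N"
    proof (rule finite_measureI)
      have "space N = UNIV" by (simp add: N_def)
      moreover have "emeasure M UNIV = 1" using emeasure_space_1 by simp
      ultimately show "emeasure N (space N) \<noteq> \<infinity>" using em[of UNIV] by simp
    qed
  qed
  moreover have "inner (poly_op p x) x = (\<integral>t. poly p t \<partial>N)" for p
  proof -
    have "poly p \<in> borel_measurable M"
      using bounded_borel_poly[of p] by (simp add: bounded_borel_def cong: measurable_cong_sets)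
    then have "(\<integral>t. poly p t \<partial>N) = c * (\<integral>t. poly p t \<partial>M)"
      unfolding N_def by (subst integral_density) (use c in auto)
    also have "\<dots> = inner (poly_op p x) x" using c by (simp flip: L add: L_def)
    finally show ?thesis by simp
  qed
  ultimately show ?thesis by blast
qed

section \<open>Scalar spectral measures and the mean-square calculus\<close>

definition spec_measure :: "'h \<Rightarrow> real measure" where
  "spec_measure x = (SOME M. unit_measure M \<and> (\<forall>p. inner (poly_op p x) x = (\<integral>t. poly p t \<partial>M)))"

lemma unit_measure_spec [simp]: "unit_measure (spec_measure x)"
  and inner_poly_op: "inner (poly_op p x) x = (\<integral>t. poly p t \<partial>spec_measure x)"
proof -
  have "unit_measure (spec_measure x) \<and> (\<forall>p. inner (poly_op p x) x = (\<integral>t. poly p t \<partial>spec_measure x))"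
    unfolding spec_measure_def by (rule someI_ex[OF spectral_measure_exists])
  then show "unit_measure (spec_measure x)" "inner (poly_op p x) x = (\<integral>t. poly p t \<partial>spec_measure x)"
    by blast+
qed

lemma norm_poly_op: "(norm (poly_op p x))\<^sup>2 = (\<integral>t. (poly p t)\<^sup>2 \<partial>spec_measure x)"
proof -
  have "(norm (poly_op p x))\<^sup>2 = inner (poly_op (p * p) x) x"
    by (simp add: power2_norm_eq_inner poly_op_mult poly_op_sym[of p])
  then show ?thesis by (simp add: inner_poly_op power2_eq_square)
qed

text \<open>\<open>calculus x f h\<close> means \<open>h = f(T) x\<close>. The map \<open>f \<mapsto> f(T) x\<close> is isometric on the \<open>L\<^sup>2\<close> space of
  \<^term>\<open>spec_measure x\<close>.\<close>

definition calculus :: "'h \<Rightarrow> (real \<Rightarrow> real) \<Rightarrow> 'h \<Rightarrow> bool" where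
  "calculus x f h \<longleftrightarrow> (\<exists>p. (\<lambda>n. \<integral>t. (poly (p n) t - f t)\<^sup>2 \<partial>spec_measure x) \<longlonglongrightarrow> 0 \<and>
     (\<lambda>n. poly_op (p n) x) \<longlonglongrightarrow> h)"

lemma calculus_norm:
  assumes "bounded_borel f" "calculus x f h"
  shows "(norm h)\<^sup>2 = (\<integral>t. (f t)\<^sup>2 \<partial>spec_measure x)"
proof -
  obtain p where p: "(\<lambda>n. \<integral>t. (poly (p n) t - f t)\<^sup>2 \<partial>spec_measure x) \<longlonglongrightarrow> 0"
    and h: "(\<lambda>n. poly_op (p n) x) \<longlonglongrightarrow> h"
    using assms(2) by (auto simp: calculus_def)
  have "(\<lambda>n. (norm (poly_op (p n) x))\<^sup>2) \<longlonglongrightarrow> (norm h)\<^sup>2"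
    by (intro tendsto_intros h)
  moreover have "(\<lambda>n. (norm (poly_op (p n) x))\<^sup>2) \<longlonglongrightarrow> (\<integral>t. (f t)\<^sup>2 \<partial>spec_measure x)"
    unfolding norm_poly_op
    by (intro L2_square_tendsto bounded_borel_intros assms p unit_measure_spec)
  ultimately show ?thesis by (rule LIMSEQ_unique)
qed

lemma calculus_lincomb:
  assumes bb: "bounded_borel f" "bounded_borel g" and f: "calculus x f h" and g: "calculus x g k"
  shows "calculus x (\<lambda>t. a * f t + b * g t) (a *\<^sub>R h + b *\<^sub>R k)"
proof -
  let ?M = "spec_measure x"
  obtain p where p: "(\<lambda>n. \<integral>t. (poly (p n) t - f t)\<^sup>2 \<partial>?M) \<longlonglongrightarrow> 0"
    and h: "(\<lambda>n. poly_op (p n) x) \<longlonglongrightarrow> h"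
    using f by (auto simp: calculus_def)
  obtain q where q: "(\<lambda>n. \<integral>t. (poly (q n) t - g t)\<^sup>2 \<partial>?M) \<longlonglongrightarrow> 0"
    and k: "(\<lambda>n. poly_op (q n) x) \<longlonglongrightarrow> k"
    using g by (auto simp: calculus_def)
  define r where "r n = smult a (p n) + smult b (q n)" for n
  have "(\<integral>t. (poly (r n) t - (a * f t + b * g t))\<^sup>2 \<partial>?M) \<le>
          2 * (a\<^sup>2 * (\<integral>t. (poly (p n) t - f t)\<^sup>2 \<partial>?M)) + 2 * (b\<^sup>2 * (\<integral>t. (poly (q n) t - g t)\<^sup>2 \<partial>?M))" for n
  proof -
    have "(\<integral>t. (poly (r n) t - (a * f t + b * g t))\<^sup>2 \<partial>?M) \<le>
        2 * (\<integral>t. (poly (r n) t - (a * f t + b * poly (q n) t))\<^sup>2 \<partial>?M) +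
        2 * (\<integral>t. ((a * f t + b * poly (q n) t) - (a * f t + b * g t))\<^sup>2 \<partial>?M)"
      by (intro L2_triangle bounded_borel_intros bb unit_measure_spec)
    also have "(\<lambda>t. (poly (r n) t - (a * f t + b * poly (q n) t))\<^sup>2) = (\<lambda>t. a\<^sup>2 * (poly (p n) t - f t)\<^sup>2)"
      by (simp add: r_def fun_eq_iff power2_eq_square algebra_simps)
    also have "(\<lambda>t. ((a * f t + b * poly (q n) t) - (a * f t + b * g t))\<^sup>2) = (\<lambda>t. b\<^sup>2 * (poly (q n) t - g t)\<^sup>2)"
      by (simp add: fun_eq_iff power2_eq_square algebra_simps)
    finally show ?thesis by simp
  qed
  moreover have "(\<lambda>n. 2 * (a\<^sup>2 * (\<integral>t. (poly (p n) t - f t)\<^sup>2 \<partial>?M)) +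
      2 * (b\<^sup>2 * (\<integral>t. (poly (q n) t - g t)\<^sup>2 \<partial>?M))) \<longlonglongrightarrow> 0"
    using p q by (auto intro!: tendsto_eq_intros)
  ultimately have "(\<lambda>n. \<integral>t. (poly (r n) t - (a * f t + b * g t))\<^sup>2 \<partial>?M) \<longlonglongrightarrow> 0"
    by (rule tendsto_zero_squeeze) simp
  moreover have "(\<lambda>n. poly_op (r n) x) \<longlonglongrightarrow> a *\<^sub>R h + b *\<^sub>R k"
    unfolding r_def poly_op_add poly_op_smult by (intro tendsto_intros h k)
  ultimately show ?thesis unfolding calculus_def by blast
qed

lemma calculus_diff:
  assumes "bounded_borel f" "bounded_borel g" "calculus x f h" "calculus x g k"
  shows "calculus x (\<lambda>t. f t - g t) (h - k)"
  using calculus_lincomb[OF assms, of 1 "-1"] by simp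

text \<open>The difference of the two vectors represents the zero function, so the isometry gives it
  norm 0. The result is independent of the approximating polynomials.\<close>

lemma calculus_unique:
  assumes "bounded_borel f" "calculus x f h" "calculus x f k"
  shows "h = k"
proof -
  have "calculus x (\<lambda>t. 0) (h - k)"
    using calculus_diff[OF assms(1) assms(1) assms(2,3)] by simp
  from calculus_norm[OF bounded_borel_const this] show ?thesis by simp
qed

lemma calculus_poly: "calculus x (poly p) (poly_op p x)"
  unfolding calculus_def by (intro exI[of _ "\<lambda>_. p"]) auto

lemma calculus_0: "calculus x (\<lambda>t. 0) 0"
  using calculus_poly[of x 0] by (simp add: poly_0[abs_def])

lemma calculus_sum:
  assumes "\<And>i. i \<in> I \<Longrightarrow> bounded_borel (f i)" "\<And>i. i \<in> I \<Longrightarrow> calculus x (f i) (h i)"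
  shows "calculus x (\<lambda>t. \<Sum>i\<in>I. f i t) (\<Sum>i\<in>I. h i)"
  using assms
proof (induction I rule: infinite_finite_induct)
  case (insert i I)
  then have "calculus x (\<lambda>t. 1 * f i t + 1 * (\<Sum>i\<in>I. f i t)) (1 *\<^sub>R h i + 1 *\<^sub>R (\<Sum>i\<in>I. h i))"
    by (intro calculus_lincomb bounded_borel_sum) auto
  with insert.hyps show ?case by simp
qed (use calculus_0 in simp_all)

text \<open>Multiplication by q enlarges a mean-square error at most by the maximum of q^2 on
  [0, 1]. With an indicator for f, this computes p(T) applied to a spectral projection.\<close>

lemma calculus_poly_mult:
  assumes bb: "bounded_borel f" and f: "calculus x f h"
  shows "calculus x (\<lambda>t. poly q t * f t) (poly_op q h)"
proof -
  let ?M = "spec_measure x"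
  obtain p where p: "(\<lambda>n. \<integral>t. (poly (p n) t - f t)\<^sup>2 \<partial>?M) \<longlonglongrightarrow> 0"
    and h: "(\<lambda>n. poly_op (p n) x) \<longlonglongrightarrow> h"
    using f by (auto simp: calculus_def)
  obtain B where B: "\<And>t. t \<in> {0..1} \<Longrightarrow> \<bar>poly q t\<bar> \<le> B"
    using bounded_borel_poly[of q] unfolding bounded_borel_def by blast
  have "(\<integral>t. (poly (q * p n) t - poly q t * f t)\<^sup>2 \<partial>?M) \<le> B\<^sup>2 * (\<integral>t. (poly (p n) t - f t)\<^sup>2 \<partial>?M)" for n
  proof -
    have "(\<integral>t. (poly (q * p n) t - poly q t * f t)\<^sup>2 \<partial>?M) \<le> (\<integral>t. B\<^sup>2 * (poly (p n) t - f t)\<^sup>2 \<partial>?M)"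
    proof (rule unit_measure_integral_mono)
      fix t :: real assume t: "t \<in> {0..1}"
      have "(poly (q * p n) t - poly q t * f t)\<^sup>2 = (poly q t)\<^sup>2 * (poly (p n) t - f t)\<^sup>2"
        by (simp add: power2_eq_square algebra_simps)
      moreover have "(poly q t)\<^sup>2 \<le> B\<^sup>2"
        using power_mono[OF B[OF t], of 2] by simp
      ultimately show "(poly (q * p n) t - poly q t * f t)\<^sup>2 \<le> B\<^sup>2 * (poly (p n) t - f t)\<^sup>2"
        by (simp add: mult_right_mono)
    qed (intro bounded_borel_intros bb unit_measure_spec)+
    then show ?thesis by simp
  qed
  moreover have "(\<lambda>n. B\<^sup>2 * (\<integral>t. (poly (p n) t - f t)\<^sup>2 \<partial>?M)) \<longlonglongrightarrow> 0"
    using p by (auto intro!: tendsto_eq_intros)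
  ultimately have "(\<lambda>n. \<integral>t. (poly (q * p n) t - poly q t * f t)\<^sup>2 \<partial>?M) \<longlonglongrightarrow> 0"
    by (rule tendsto_zero_squeeze) simp
  moreover have "(\<lambda>n. poly_op (q * p n) x) \<longlonglongrightarrow> poly_op q h"
    unfolding poly_op_mult by (rule bounded_linear.tendsto[OF bounded_linear_poly_op h])
  ultimately show ?thesis unfolding calculus_def by (intro exI conjI)
qed

text \<open>The isometry turns a mean-square Cauchy sequence of polynomials into a Cauchy sequence
  of vectors, and the space is complete.\<close>

lemma calculus_convergent:
  assumes bb: "bounded_borel f"
    and p: "(\<lambda>n. \<integral>t. (poly (p n) t - f t)\<^sup>2 \<partial>spec_measure x) \<longlonglongrightarrow> 0"
  shows "\<exists>h. (\<lambda>n. poly_op (p n) x) \<longlonglongrightarrow> h"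
proof -
  let ?a = "\<lambda>n. \<integral>t. (poly (p n) t - f t)\<^sup>2 \<partial>spec_measure x"
  have dist: "(norm (poly_op (p m) x - poly_op (p n) x))\<^sup>2 \<le> 2 * ?a m + 2 * ?a n" for m n
  proof -
    have "(norm (poly_op (p m) x - poly_op (p n) x))\<^sup>2 = (\<integral>t. (poly (p m) t - poly (p n) t)\<^sup>2 \<partial>spec_measure x)"
      using norm_poly_op[of "p m - p n" x] by (simp add: poly_op_diff)
    also have "\<dots> \<le> 2 * ?a m + 2 * (\<integral>t. (f t - poly (p n) t)\<^sup>2 \<partial>spec_measure x)"
      by (intro L2_triangle bounded_borel_intros bb unit_measure_spec)
    finally show ?thesis by (simp add: power2_commute)
  qed
  have "Cauchy (\<lambda>n. poly_op (p n) x)"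
  proof (rule CauchyI)
    fix e :: real assume e: "e > 0"
    then have "\<forall>\<^sub>F n in sequentially. ?a n < e\<^sup>2 / 4"
      using p by (intro order_tendstoD) auto
    then obtain N where N: "\<And>n. n \<ge> N \<Longrightarrow> ?a n < e\<^sup>2 / 4" by (auto simp: eventually_sequentially)
    have "norm (poly_op (p m) x - poly_op (p n) x) < e" if "m \<ge> N" "n \<ge> N" for m n
    proof -
      have "(norm (poly_op (p m) x - poly_op (p n) x))\<^sup>2 < e\<^sup>2"
        using dist[of m n] N[OF that(1)] N[OF that(2)] by linarith
      then show ?thesis by (rule power_less_imp_less_base) (use e in simp)
    qed
    then show "\<exists>M. \<forall>m\<ge>M. \<forall>n\<ge>M. norm (poly_op (p m) x - poly_op (p n) x) < e" by blast
  qed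
  then show ?thesis by (simp add: Cauchy_convergent_iff convergent_def)
qed

section \<open>Spectral projections as limits of polynomials\<close>

definition spec_proj :: "real set \<Rightarrow> 'h \<Rightarrow> 'h" where
  "spec_proj A x = (THE h. calculus x (indicator A) h)"

lemma calculus_spec_proj:
  assumes "A \<in> sets borel"
  shows "calculus x (indicator A) (spec_proj A x)"
proof -
  have "L2_approximable {spec_measure x} (indicator A)"
    by (rule L2_approximable_indicator) (use assms in auto)
  from L2_approximable_sequence[OF this]
  obtain p where "\<forall>M\<in>{spec_measure x}. (\<lambda>n. \<integral>t. (poly (p n) t - indicator A t)\<^sup>2 \<partial>M) \<longlonglongrightarrow> 0" .
  then have p: "(\<lambda>n. \<integral>t. (poly (p n) t - indicator A t)\<^sup>2 \<partial>spec_measure x) \<longlonglongrightarrow> 0"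
    by blast
  obtain h where "(\<lambda>n. poly_op (p n) x) \<longlonglongrightarrow> h"
    using calculus_convergent[OF bounded_borel_indicator[OF assms] p] by auto
  with p have h: "calculus x (indicator A) h"
    unfolding calculus_def by (intro exI conjI)
  then have "spec_proj A x = h"
    unfolding spec_proj_def
    by (rule the_equality) (rule calculus_unique[OF bounded_borel_indicator[OF assms] _ h])
  with h show ?thesis by simp
qed

text \<open>Additivity, symmetry and commutation relate several vectors and hold for every p(T).
  They survive the limit when all the vectors are treated with the same polynomials.\<close>

lemma spec_proj_simultaneous_approximation:
  assumes A: "A \<in> sets borel" and X: "finite X"
  obtains p where "\<forall>x\<in>X. (\<lambda>n. poly_op (p n) x) \<longlonglongrightarrow> spec_proj A x"
    and "\<forall>x\<in>X. (\<lambda>n. \<integral>t. (poly (p n) t - indicator A t)\<^sup>2 \<partial>spec_measure x) \<longlonglongrightarrow> 0"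
proof -
  have "L2_approximable (spec_measure ` X) (indicator A)"
    by (rule L2_approximable_indicator) (use assms in auto)
  from L2_approximable_sequence[OF this]
  obtain p where "\<forall>M\<in>spec_measure ` X. (\<lambda>n. \<integral>t. (poly (p n) t - indicator A t)\<^sup>2 \<partial>M) \<longlonglongrightarrow> 0" .
  then have
    p: "\<And>x. x \<in> X \<Longrightarrow> (\<lambda>n. \<integral>t. (poly (p n) t - indicator A t)\<^sup>2 \<partial>spec_measure x) \<longlonglongrightarrow> 0"
    by blast
  have "(\<lambda>n. poly_op (p n) x) \<longlonglongrightarrow> spec_proj A x" if x: "x \<in> X" for x
  proof -
    obtain h where h: "(\<lambda>n. poly_op (p n) x) \<longlonglongrightarrow> h"
      using calculus_convergent[OF bounded_borel_indicator[OF A] p[OF x]] by blast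
    with p[OF x] have "calculus x (indicator A) h" unfolding calculus_def by (intro exI conjI)
    then have "h = spec_proj A x"
      by (rule calculus_unique[OF bounded_borel_indicator[OF A] _ calculus_spec_proj[OF A]])
    with h show ?thesis by simp
  qed
  with p show thesis by (intro that ballI)
qed

lemma spec_proj_commute:
  assumes A: "A \<in> sets borel" and J: "bounded_linear J" "\<And>x. J (T x) = T (J x)"
  shows "J (spec_proj A x) = spec_proj A (J x)"
proof -
  have "finite {x, J x}" by simp
  from spec_proj_simultaneous_approximation[OF A this]
  obtain p where p: "\<forall>y\<in>{x, J x}. (\<lambda>n. poly_op (p n) y) \<longlonglongrightarrow> spec_proj A y" .
  have "(\<lambda>n. J (poly_op (p n) x)) \<longlonglongrightarrow> J (spec_proj A x)"
    by (rule bounded_linear.tendsto[OF J(1) bspec[OF p]]) simp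
  moreover have "(\<lambda>n. J (poly_op (p n) x)) \<longlonglongrightarrow> spec_proj A (J x)"
    using bspec[OF p, of "J x"] by (simp add: poly_op_commute[OF J])
  ultimately show ?thesis by (rule LIMSEQ_unique)
qed

lemma spec_proj_add:
  assumes A: "A \<in> sets borel"
  shows "spec_proj A (x + y) = spec_proj A x + spec_proj A y"
proof -
  have "finite {x, y, x + y}" by simp
  from spec_proj_simultaneous_approximation[OF A this]
  obtain p where p: "\<forall>z\<in>{x, y, x + y}. (\<lambda>n. poly_op (p n) z) \<longlonglongrightarrow> spec_proj A z" .
  have "(\<lambda>n. poly_op (p n) x + poly_op (p n) y) \<longlonglongrightarrow> spec_proj A x + spec_proj A y"
    by (intro tendsto_add bspec[OF p]) auto
  moreover have "(\<lambda>n. poly_op (p n) x + poly_op (p n) y) \<longlonglongrightarrow> spec_proj A (x + y)"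
    using bspec[OF p, of "x + y"] by (simp add: poly_op_linear_simps)
  ultimately have "spec_proj A x + spec_proj A y = spec_proj A (x + y)" by (rule LIMSEQ_unique)
  then show ?thesis ..
qed

lemma spec_proj_sym:
  assumes A: "A \<in> sets borel"
  shows "inner (spec_proj A x) y = inner x (spec_proj A y)"
proof -
  have "finite {x, y}" by simp
  from spec_proj_simultaneous_approximation[OF A this]
  obtain p where p: "\<forall>z\<in>{x, y}. (\<lambda>n. poly_op (p n) z) \<longlonglongrightarrow> spec_proj A z" .
  have "(\<lambda>n. inner (poly_op (p n) x) y) \<longlonglongrightarrow> inner (spec_proj A x) y"
    by (intro tendsto_intros bspec[OF p]) auto
  moreover have "(\<lambda>n. inner (poly_op (p n) x) y) \<longlonglongrightarrow> inner x (spec_proj A y)"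
    unfolding poly_op_sym by (intro tendsto_intros bspec[OF p]) auto
  ultimately show ?thesis by (rule LIMSEQ_unique)
qed

lemma spec_proj_UNIV: "spec_proj UNIV x = x"
proof (rule calculus_unique[OF _ calculus_spec_proj])
  show "calculus x (indicator UNIV) x"
    using calculus_poly[of x 1] by (simp add: poly_1[abs_def] indicator_def[abs_def])
qed (auto intro: bounded_borel_intros)

text \<open>With y = \<open>spec_proj B x\<close>, the vectors p_n(T) y tend to
  \<open>spec_proj A y\<close> by the choice of p_n. They also tend to
  \<open>spec_proj (A \<inter> B) x\<close>, since multiplying p_n - \<open>indicator A\<close> by
  \<open>indicator B\<close> cannot increase its absolute value.\<close>

lemma spec_proj_Int:
  assumes A: "A \<in> sets borel" and B: "B \<in> sets borel"
  shows "spec_proj (A \<inter> B) x = spec_proj A (spec_proj B x)"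
proof -
  define y where "y = spec_proj B x"
  note bb = bounded_borel_indicator[OF A] bounded_borel_indicator[OF B]
    bounded_borel_indicator[OF sets.Int[OF A B]]
  have "finite {x, y}" by simp
  from spec_proj_simultaneous_approximation[OF A this]
  obtain p where p: "\<forall>z\<in>{x, y}. (\<lambda>n. poly_op (p n) z) \<longlonglongrightarrow> spec_proj A z"
    and "\<forall>z\<in>{x, y}. (\<lambda>n. \<integral>t. (poly (p n) t - indicator A t)\<^sup>2 \<partial>spec_measure z) \<longlonglongrightarrow> 0" .
  then have p': "(\<lambda>n. \<integral>t. (poly (p n) t - indicator A t)\<^sup>2 \<partial>spec_measure x) \<longlonglongrightarrow> 0"
    by blast
  have "(norm (poly_op (p n) y - spec_proj (A \<inter> B) x))\<^sup>2
        \<le> (\<integral>t. (poly (p n) t - indicator A t)\<^sup>2 \<partial>spec_measure x)" for n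
  proof -
    have "(norm (poly_op (p n) y - spec_proj (A \<inter> B) x))\<^sup>2 =
        (\<integral>t. (poly (p n) t * indicator B t - indicator (A \<inter> B) t)\<^sup>2 \<partial>spec_measure x)"
      unfolding y_def using A B
      by (intro calculus_norm calculus_diff calculus_poly_mult calculus_spec_proj bounded_borel_intros) auto
    also have "\<dots> \<le> (\<integral>t. (poly (p n) t - indicator A t)\<^sup>2 \<partial>spec_measure x)"
      by (intro unit_measure_integral_mono unit_measure_spec bounded_borel_diff bounded_borel_mult
            bounded_borel_power2 bounded_borel_poly bb)
         (auto simp: indicator_def)
    finally show ?thesis .
  qed
  then have "(\<lambda>n. (norm (poly_op (p n) y - spec_proj (A \<inter> B) x))\<^sup>2) \<longlonglongrightarrow> 0"
    by (rule tendsto_zero_squeeze[OF _ p']) simp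
  then have "(\<lambda>n. poly_op (p n) y) \<longlonglongrightarrow> spec_proj (A \<inter> B) x"
    by (rule tendsto_norm_square_zero)
  moreover have "(\<lambda>n. poly_op (p n) y) \<longlonglongrightarrow> spec_proj A y" by (rule bspec[OF p]) simp
  ultimately show ?thesis unfolding y_def by (rule LIMSEQ_unique)
qed

text \<open>Identifies the scalar measure of the projections with the measure from the moment
  problem; this is how the integral of t against the projections is known to give back T.\<close>

lemma inner_spec_proj:
  assumes A: "A \<in> sets borel"
  shows "inner (spec_proj A x) x = measure (spec_measure x) A"
proof -
  have sets: "sets (spec_measure x) = sets borel"
    using unit_measure_spec[of x] by (simp add: unit_measure_def)
  have "inner (spec_proj A x) x = (norm (spec_proj A x))\<^sup>2"
    using spec_proj_Int[OF A A, of x] spec_proj_sym[OF A, of "spec_proj A x" x]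
    by (simp add: power2_norm_eq_inner)
  also have "\<dots> = (\<integral>t. (indicator A t)\<^sup>2 \<partial>spec_measure x)"
    by (rule calculus_norm[OF bounded_borel_indicator[OF A] calculus_spec_proj[OF A]])
  also have "\<dots> = (\<integral>t. indicator A t \<partial>spec_measure x)"
    by (simp add: power2_eq_square flip: indicator_inter_arith)
  also have "\<dots> = measure (spec_measure x) A"
    using A sets by (simp add: sets_eq_imp_space_eq[OF sets])
  finally show ?thesis .
qed

text \<open>By the isometry, strong convergence of the partial sums is mean-square convergence of
  indicators, which bounded convergence provides.\<close>

lemma spec_proj_countably_additive:
  assumes "range A \<subseteq> sets borel" "disjoint_family A"
  shows "(\<lambda>n. spec_proj (\<Union>i. A i) x - (\<Sum>i<n. spec_proj (A i) x)) \<longlonglongrightarrow> 0"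
proof -
  have A: "A i \<in> sets borel" "(\<Union>i. A i) \<in> sets borel" for i using assms(1) by auto
  have eq: "(norm (spec_proj (\<Union>i. A i) x - (\<Sum>i<n. spec_proj (A i) x)))\<^sup>2 =
      (\<integral>t. ((\<Sum>i<n. indicator (A i) t) - indicator (\<Union>i. A i) t)\<^sup>2 \<partial>spec_measure x)" for n
  proof -
    have "(norm (spec_proj (\<Union>i. A i) x - (\<Sum>i<n. spec_proj (A i) x)))\<^sup>2 =
      (\<integral>t. (indicator (\<Union>i. A i) t - (\<Sum>i<n. indicator (A i) t))\<^sup>2 \<partial>spec_measure x)"
      using A by (intro calculus_norm calculus_diff calculus_sum calculus_spec_proj bounded_borel_intros) auto
    then show ?thesis by (simp add: power2_commute)
  qed
  have "(\<lambda>n. (norm (spec_proj (\<Union>i. A i) x - (\<Sum>i<n. spec_proj (A i) x)))\<^sup>2) \<longlonglongrightarrow> 0"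
    unfolding eq
    by (rule bounded_convergence_L2)
       (use A disjoint_indicator_sums[OF assms(2)] in \<open>auto intro!: bounded_borel_intros\<close>)
  then show ?thesis
    using tendsto_norm_square_zero[of "\<lambda>n. spec_proj (\<Union>i. A i) x - (\<Sum>i<n. spec_proj (A i) x)" 0] by simp
qed

lemma integral_spec_measure: "inner (T x) x = (\<integral>t. t \<partial>spec_measure x)"
  using inner_poly_op[of "[:0, 1:]" x] by simp

end

section \<open>Hilbert space of square-summable functions\<close>

text \<open>A type cannot depend on the carrier of the group, so all of the type serves as index set; the
  space \<^term>\<open>l2 G\<close> is recovered as the subspace of functions supported on the carrier.\<close>

typedef 'a ell2 = "{f :: 'a \<Rightarrow> complex. (\<lambda>x. (cmod (f x))\<^sup>2) summable_on UNIV}"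
  morphisms coord Abs_ell2
  by (rule exI[of _ "\<lambda>_. 0"]) simp

lemma coord_summable: "(\<lambda>x. (cmod (coord f x))\<^sup>2) summable_on UNIV"
  using coord[of f] by simp

lemma coord_Abs: "(\<lambda>x. (cmod (f x))\<^sup>2) summable_on UNIV \<Longrightarrow> coord (Abs_ell2 f) = f"
  by (rule Abs_ell2_inverse) simp

lemma ell2_eqI: "(\<And>x. coord f x = coord g x) \<Longrightarrow> f = g"
  using coord_inject by blast

lemma square_summable_add:
  fixes f g :: "'a \<Rightarrow> complex"
  assumes "(\<lambda>x. (cmod (f x))\<^sup>2) summable_on A" "(\<lambda>x. (cmod (g x))\<^sup>2) summable_on A"
  shows "(\<lambda>x. (cmod (f x + g x))\<^sup>2) summable_on A"
proof (rule summable_on_comparison_test)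
  show "(\<lambda>x. 2 * (cmod (f x))\<^sup>2 + 2 * (cmod (g x))\<^sup>2) summable_on A"
    by (intro summable_on_add summable_on_cmult_right assms)
  fix x
  have "(cmod (f x + g x))\<^sup>2 \<le> (cmod (f x) + cmod (g x))\<^sup>2"
    by (intro power_mono norm_triangle_ineq) auto
  also have "\<dots> \<le> 2 * (cmod (f x))\<^sup>2 + 2 * (cmod (g x))\<^sup>2"
    using zero_le_power2[of "cmod (f x) - cmod (g x)"] by (simp add: power2_eq_square algebra_simps)
  finally show "(cmod (f x + g x))\<^sup>2 \<le> 2 * (cmod (f x))\<^sup>2 + 2 * (cmod (g x))\<^sup>2" .
qed auto

lemma square_summable_cmult:
  fixes f :: "'a \<Rightarrow> complex"
  assumes "(\<lambda>x. (cmod (f x))\<^sup>2) summable_on A"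
  shows "(\<lambda>x. (cmod (c * f x))\<^sup>2) summable_on A"
  using summable_on_cmult_right[OF assms, of "(cmod c)\<^sup>2"] by (simp add: norm_mult power_mult_distrib)

lemma inner_square_summable:
  fixes f g :: "'a \<Rightarrow> complex"
  assumes "(\<lambda>x. (cmod (f x))\<^sup>2) summable_on A" "(\<lambda>x. (cmod (g x))\<^sup>2) summable_on A"
  shows "(\<lambda>x. inner (f x) (g x)) summable_on A"
proof (rule abs_summable_summable, rule summable_on_comparison_test)
  show "(\<lambda>x. (cmod (f x))\<^sup>2 + (cmod (g x))\<^sup>2) summable_on A"
    by (intro summable_on_add assms)
  fix x
  have "norm (inner (f x) (g x)) \<le> cmod (f x) * cmod (g x)"
    using Cauchy_Schwarz_ineq2[of "f x" "g x"] by simp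
  also have "\<dots> \<le> (cmod (f x))\<^sup>2 + (cmod (g x))\<^sup>2"
    using zero_le_power2[of "cmod (f x) - cmod (g x)"] zero_le_power2[of "cmod (f x) + cmod (g x)"]
    unfolding power2_diff power2_sum by linarith
  finally show "norm (inner (f x) (g x)) \<le> (cmod (f x))\<^sup>2 + (cmod (g x))\<^sup>2" .
qed auto

instantiation ell2 :: (type) real_inner
begin

definition zero_ell2 :: "'a ell2" where "0 = Abs_ell2 (\<lambda>_. 0)"
definition plus_ell2 :: "'a ell2 \<Rightarrow> 'a ell2 \<Rightarrow> 'a ell2" where
  "f + g = Abs_ell2 (\<lambda>x. coord f x + coord g x)"
definition uminus_ell2 :: "'a ell2 \<Rightarrow> 'a ell2" where "- f = Abs_ell2 (\<lambda>x. - coord f x)"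
definition minus_ell2 :: "'a ell2 \<Rightarrow> 'a ell2 \<Rightarrow> 'a ell2" where "f - g = f + - (g :: 'a ell2)"
definition scaleR_ell2 :: "real \<Rightarrow> 'a ell2 \<Rightarrow> 'a ell2" where
  "c *\<^sub>R f = Abs_ell2 (\<lambda>x. c *\<^sub>R coord f x)"
definition inner_ell2 :: "'a ell2 \<Rightarrow> 'a ell2 \<Rightarrow> real" where
  "inner f g = (\<Sum>\<^sub>\<infinity>x. inner (coord f x) (coord g x))"
definition norm_ell2 :: "'a ell2 \<Rightarrow> real" where "norm f = sqrt (inner f (f :: 'a ell2))"
definition sgn_ell2 :: "'a ell2 \<Rightarrow> 'a ell2" where "sgn f = inverse (norm (f :: 'a ell2)) *\<^sub>R f"
definition dist_ell2 :: "'a ell2 \<Rightarrow> 'a ell2 \<Rightarrow> real" where "dist f g = norm (f - (g :: 'a ell2))"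
definition uniformity_ell2 :: "('a ell2 \<times> 'a ell2) filter" where
  "uniformity_ell2 = (INF e\<in>{0<..}. principal {(x, y). dist x (y :: 'a ell2) < e})"
definition open_ell2 :: "'a ell2 set \<Rightarrow> bool" where
  "open_ell2 U = (\<forall>x\<in>U. eventually (\<lambda>(x', y). x' = x \<longrightarrow> y \<in> U) (uniformity :: ('a ell2 \<times> 'a ell2) filter))"

lemma coord_zero [simp]: "coord 0 x = 0"
  unfolding zero_ell2_def by (subst coord_Abs) auto

lemma coord_plus [simp]: "coord (f + g) x = coord f x + coord g x"
  unfolding plus_ell2_def by (subst coord_Abs) (auto intro: square_summable_add coord_summable)

lemma coord_uminus [simp]: "coord (- f) x = - coord f x"
  unfolding uminus_ell2_def by (subst coord_Abs) (auto intro: coord_summable)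

lemma coord_minus [simp]: "coord (f - g) x = coord f x - coord g x"
  unfolding minus_ell2_def by simp

lemma coord_scaleR [simp]: "coord (c *\<^sub>R f) x = c *\<^sub>R coord f x"
  unfolding scaleR_ell2_def
  by (subst coord_Abs) (auto intro: square_summable_cmult coord_summable simp: scaleR_conv_of_real)

lemma inner_coord_summable: "(\<lambda>x. inner (coord f x) (coord g x)) summable_on UNIV"
  by (intro inner_square_summable coord_summable)

instance
proof
  fix f g h :: "'a ell2" and a b :: real
  show "f + g + h = f + (g + h)" "f + g = g + f" "0 + f = f" "- f + f = 0" "f - g = f + - g"
    "a *\<^sub>R (f + g) = a *\<^sub>R f + a *\<^sub>R g" "(a + b) *\<^sub>R f = a *\<^sub>R f + b *\<^sub>R f"
    "a *\<^sub>R b *\<^sub>R f = (a * b) *\<^sub>R f" "1 *\<^sub>R f = f"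
    by (auto intro!: ell2_eqI simp: algebra_simps)
  show "dist f g = norm (f - g)" by (rule dist_ell2_def)
  show "sgn f = inverse (norm f) *\<^sub>R f" by (rule sgn_ell2_def)
  show "norm f = sqrt (inner f f)" by (rule norm_ell2_def)
  show "(uniformity :: ('a ell2 \<times> 'a ell2) filter) = (INF e\<in>{0<..}. principal {(x, y). dist x y < e})"
    by (rule uniformity_ell2_def)
  show "open U = (\<forall>x\<in>U. eventually (\<lambda>(x', y). x' = x \<longrightarrow> y \<in> U) uniformity)" for U :: "'a ell2 set"
    by (rule open_ell2_def)
  show "inner f g = inner g f" by (simp add: inner_ell2_def inner_commute)
  show "inner (f + g) h = inner f h + inner g h"
    unfolding inner_ell2_def coord_plus inner_add_left
    by (intro infsum_add inner_coord_summable)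
  show "inner (a *\<^sub>R f) g = a * inner f g"
    by (simp add: inner_ell2_def infsum_cmult_right')
  show "0 \<le> inner f f" by (simp add: inner_ell2_def infsum_nonneg)
  show "(inner f f = 0) = (f = 0)"
  proof
    assume "inner f f = 0"
    then have "inner (coord f x) (coord f x) = 0" for x
      by (intro nonneg_infsum_le_0D[where f = "\<lambda>x. inner (coord f x) (coord f x)" and A = UNIV])
         (auto simp: inner_ell2_def inner_coord_summable)
    then show "f = 0" by (intro ell2_eqI) simp
  qed (simp add: inner_ell2_def)
qed

end

lemma norm_coord_le: "cmod (coord f x) \<le> norm f"
proof -
  have "(cmod (coord f x))\<^sup>2 = (\<Sum>\<^sub>\<infinity>y\<in>{x}. inner (coord f y) (coord f y))"
    by (simp add: power2_norm_eq_inner)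
  also have "\<dots> \<le> inner f f"
    unfolding inner_ell2_def
    by (intro infsum_mono2 inner_coord_summable) auto
  finally show ?thesis by (simp add: norm_eq_sqrt_inner real_le_rsqrt)
qed

lemma sum_coord_le: "finite F \<Longrightarrow> (\<Sum>x\<in>F. (cmod (coord f x))\<^sup>2) \<le> (norm f)\<^sup>2"
  unfolding power2_norm_eq_inner inner_ell2_def
  by (rule finite_sum_le_infsum[OF inner_coord_summable]) auto

lemma norm_le_if_finite_sums_le:
  assumes "\<And>F. finite F \<Longrightarrow> (\<Sum>x\<in>F. (cmod (coord f x))\<^sup>2) \<le> c\<^sup>2" "0 \<le> c"
  shows "norm f \<le> c"
proof -
  have "(norm f)\<^sup>2 \<le> c\<^sup>2"
    unfolding power2_norm_eq_inner[of f] inner_ell2_def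
    by (rule infsum_le_finite_sums[OF inner_coord_summable])
       (use assms in \<open>simp add: power2_norm_eq_inner\<close>)
  then show ?thesis by (rule power2_le_imp_le) (rule assms(2))
qed

instance ell2 :: (type) complete_space
proof
  fix X :: "nat \<Rightarrow> 'a ell2" assume X: "Cauchy X"
  have "Cauchy (\<lambda>n. coord (X n) x)" for x
  proof (rule CauchyI)
    fix e :: real assume "e > 0"
    then obtain N where N: "\<And>m n. m \<ge> N \<Longrightarrow> n \<ge> N \<Longrightarrow> norm (X m - X n) < e"
      using CauchyD[OF X] by blast
    have "cmod (coord (X m) x - coord (X n) x) < e" if "m \<ge> N" "n \<ge> N" for m n
      using norm_coord_le[of "X m - X n" x] N[OF that] by simp
    then show "\<exists>M. \<forall>m\<ge>M. \<forall>n\<ge>M. cmod (coord (X m) x - coord (X n) x) < e" by blast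
  qed
  then have "\<forall>x. \<exists>l. (\<lambda>n. coord (X n) x) \<longlonglongrightarrow> l"
    by (simp add: Cauchy_convergent_iff convergent_def)
  then obtain l where l: "\<And>x. (\<lambda>n. coord (X n) x) \<longlonglongrightarrow> l x" by metis
  have close: "\<exists>N. \<forall>n\<ge>N. \<forall>F. finite F \<longrightarrow> (\<Sum>x\<in>F. (cmod (coord (X n) x - l x))\<^sup>2) \<le> e\<^sup>2" if e: "e > 0" for e
  proof -
    obtain N where N: "\<And>m n. m \<ge> N \<Longrightarrow> n \<ge> N \<Longrightarrow> norm (X m - X n) < e"
      using CauchyD[OF X e] by blast
    have "(\<Sum>x\<in>F. (cmod (coord (X n) x - l x))\<^sup>2) \<le> e\<^sup>2" if "n \<ge> N" "finite F" for n F
    proof (rule LIMSEQ_le_const2)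
      show "(\<lambda>m. \<Sum>x\<in>F. (cmod (coord (X n) x - coord (X m) x))\<^sup>2) \<longlonglongrightarrow> (\<Sum>x\<in>F. (cmod (coord (X n) x - l x))\<^sup>2)"
        by (intro tendsto_intros l)
      have "(\<Sum>x\<in>F. (cmod (coord (X n) x - coord (X m) x))\<^sup>2) \<le> e\<^sup>2" if "m \<ge> N" for m
      proof -
        have "(\<Sum>x\<in>F. (cmod (coord (X n) x - coord (X m) x))\<^sup>2) \<le> (norm (X n - X m))\<^sup>2"
          using sum_coord_le[OF \<open>finite F\<close>, of "X n - X m"] by simp
        also have "\<dots> \<le> e\<^sup>2"
          using N[OF \<open>n \<ge> N\<close> that] by (intro power_mono) auto
        finally show ?thesis .
      qed
      then show "\<exists>N. \<forall>m\<ge>N. (\<Sum>x\<in>F. (cmod (coord (X n) x - coord (X m) x))\<^sup>2) \<le> e\<^sup>2" by blast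
    qed
    then show ?thesis by blast
  qed
  obtain N where N: "\<And>F. finite F \<Longrightarrow> (\<Sum>x\<in>F. (cmod (coord (X N) x - l x))\<^sup>2) \<le> 1"
    using close[of 1] by auto
  have "(\<lambda>x. (cmod (coord (X N) x - l x))\<^sup>2) summable_on UNIV"
    by (rule nonneg_bdd_above_summable_on) (auto intro!: bdd_aboveI2[where M = 1] N)
  \<comment> \<open>The limit is recovered as X_N - (X_N - l), a difference of square-summable
    functions.\<close>
  then have "(\<lambda>x. (cmod (coord (X N) x + (-1) * (coord (X N) x - l x)))\<^sup>2) summable_on UNIV"
    by (intro square_summable_add square_summable_cmult coord_summable)
  then have "(\<lambda>x. (cmod (l x))\<^sup>2) summable_on UNIV" by simp
  then have cl: "coord (Abs_ell2 l) = l" by (rule coord_Abs)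
  have "X \<longlonglongrightarrow> Abs_ell2 l"
  proof (rule LIMSEQ_I)
    fix e :: real assume e: "e > 0"
    then obtain N where N: "\<forall>n\<ge>N. \<forall>F. finite F \<longrightarrow> (\<Sum>x\<in>F. (cmod (coord (X n) x - l x))\<^sup>2) \<le> (e / 2)\<^sup>2"
      using close[of "e / 2"] by auto
    have "norm (X n - Abs_ell2 l) < e" if "n \<ge> N" for n
    proof -
      have "norm (X n - Abs_ell2 l) \<le> e / 2"
        by (rule norm_le_if_finite_sums_le) (use N that e in \<open>auto simp: cl\<close>)
      with e show ?thesis by simp
    qed
    then show "\<exists>N. \<forall>n\<ge>N. norm (X n - Abs_ell2 l) < e" by blast
  qed
  then show "convergent X" by (auto simp: convergent_def)
qed

section \<open>Laplace operator of a Cayley graph\<close>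

definition cscale :: "complex \<Rightarrow> 'a ell2 \<Rightarrow> 'a ell2" where
  "cscale c f = Abs_ell2 (\<lambda>x. c * coord f x)"

definition conj_ell2 :: "'a ell2 \<Rightarrow> 'a ell2" where
  "conj_ell2 f = Abs_ell2 (\<lambda>x. cnj (coord f x))"

definition delta :: "'a \<Rightarrow> 'a ell2" where
  "delta a = Abs_ell2 (point_mass a)"

text \<open>One construction covers the left and right translations, inversion and, with the
  identity map, restriction to the carrier. Injectivity of \<sigma> on \<open>C\<close> keeps the
  result square summable.\<close>

definition pull :: "'a set \<Rightarrow> ('a \<Rightarrow> 'a) \<Rightarrow> 'a ell2 \<Rightarrow> 'a ell2" where
  "pull C \<sigma> f = Abs_ell2 (\<lambda>x. if x \<in> C then coord f (\<sigma> x) else 0)"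

lemma coord_cscale [simp]: "coord (cscale c f) x = c * coord f x"
  unfolding cscale_def by (subst coord_Abs) (auto intro: square_summable_cmult coord_summable)

lemma coord_conj [simp]: "coord (conj_ell2 f) x = cnj (coord f x)"
  unfolding conj_ell2_def by (subst coord_Abs) (auto intro: coord_summable)

lemma coord_delta [simp]: "coord (delta a) x = (if x = a then 1 else 0)"
proof -
  have "(\<lambda>x. (cmod (point_mass a x))\<^sup>2) summable_on {a}" by simp
  then have "(\<lambda>x. (cmod (point_mass a x))\<^sup>2) summable_on UNIV"
    by (rule summable_on_cong_neutral[THEN iffD1, rotated -1]) (auto simp: point_mass_def)
  then show ?thesis unfolding delta_def by (subst coord_Abs) (auto simp: point_mass_def)
qed

lemma coord_pull:
  assumes "inj_on \<sigma> C"
  shows "coord (pull C \<sigma> f) x = (if x \<in> C then coord f (\<sigma> x) else 0)"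
proof -
  have "(\<lambda>x. (cmod (coord f x))\<^sup>2) summable_on \<sigma> ` C"
    by (rule summable_on_subset_banach[OF coord_summable]) auto
  then have "(\<lambda>x. (cmod (coord f (\<sigma> x)))\<^sup>2) summable_on C"
    by (simp add: summable_on_reindex[OF assms] o_def)
  then have "(\<lambda>x. (cmod (if x \<in> C then coord f (\<sigma> x) else 0))\<^sup>2) summable_on UNIV"
    by (rule summable_on_cong_neutral[THEN iffD1, rotated -1]) auto
  then show ?thesis unfolding pull_def by (subst coord_Abs) auto
qed

lemma inner_delta: "inner f (delta a) = Re (coord f a)"
proof -
  have "inner f (delta a) = (\<Sum>\<^sub>\<infinity>x\<in>{a}. inner (coord f x) (coord (delta a) x))"
    unfolding inner_ell2_def by (rule infsum_cong_neutral) auto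
  then show ?thesis by (simp add: inner_complex_def)
qed

lemma inner_conj: "inner (conj_ell2 f) g = inner f (conj_ell2 g)"
  by (simp add: inner_ell2_def inner_complex_def)

lemma inner_cscale: "inner (cscale c f) g = inner f (cscale (cnj c) g)"
  by (simp add: inner_ell2_def inner_complex_def algebra_simps)

lemma norm_cscale: "norm (cscale c f) = cmod c * norm f"
proof -
  have "inner (cscale c f) (cscale c f) = (cmod c)\<^sup>2 * inner f f"
    by (simp add: inner_ell2_def norm_mult power_mult_distrib infsum_cmult_right'
        flip: power2_norm_eq_inner)
  then show ?thesis by (simp add: norm_eq_sqrt_inner real_sqrt_mult)
qed

lemma bounded_linear_cscale: "bounded_linear (cscale c)"
  by (rule bounded_linear_intro[where K = "cmod c"])
     (auto intro!: ell2_eqI simp: algebra_simps norm_cscale scaleR_conv_of_real)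

lemma bounded_linear_conj: "bounded_linear (conj_ell2 :: 'a ell2 \<Rightarrow> 'a ell2)"
proof (rule bounded_linear_intro[where K = 1])
  fix f :: "'a ell2"
  have "inner (conj_ell2 f) (conj_ell2 f) = inner f f"
    by (simp add: inner_ell2_def inner_complex_def)
  then have "norm (conj_ell2 f) = norm f" by (simp add: norm_eq_sqrt_inner)
  then show "norm (conj_ell2 f) \<le> norm f * 1" by simp
qed (auto intro!: ell2_eqI simp: scaleR_conv_of_real)

lemma norm_pull_le:
  assumes "inj_on \<sigma> C"
  shows "norm (pull C \<sigma> f) \<le> norm f"
proof (rule norm_le_if_finite_sums_le)
  fix F :: "'a set" assume F: "finite F"
  have "(\<Sum>x\<in>F. (cmod (coord (pull C \<sigma> f) x))\<^sup>2) = (\<Sum>x\<in>F \<inter> C. (cmod (coord f (\<sigma> x)))\<^sup>2)"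
    using F by (intro sum.mono_neutral_cong_right) (auto simp: coord_pull[OF assms])
  also have "\<dots> = (\<Sum>x\<in>\<sigma> ` (F \<inter> C). (cmod (coord f x))\<^sup>2)"
    by (subst sum.reindex) (auto intro: inj_on_subset[OF assms])
  also have "\<dots> \<le> (norm f)\<^sup>2"
    using F by (intro sum_coord_le) auto
  finally show "(\<Sum>x\<in>F. (cmod (coord (pull C \<sigma> f) x))\<^sup>2) \<le> (norm f)\<^sup>2" .
qed simp

lemma bounded_linear_pull:
  assumes "inj_on \<sigma> C"
  shows "bounded_linear (pull C \<sigma>)"
  by (rule bounded_linear_intro[where K = 1])
     (auto intro!: ell2_eqI simp: coord_pull[OF assms] norm_pull_le[OF assms])

lemma inner_pull:
  assumes bij: "bij_betw \<sigma> C C" "bij_betw \<tau> C C" and inv: "\<And>x. x \<in> C \<Longrightarrow> \<sigma> (\<tau> x) = x"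
  shows "inner (pull C \<sigma> f) g = inner f (pull C \<tau> g)"
proof -
  note inj = bij_betw_imp_inj_on[OF bij(1)] bij_betw_imp_inj_on[OF bij(2)]
  have "inner (pull C \<sigma> f) g = (\<Sum>\<^sub>\<infinity>x\<in>C. inner (coord f (\<sigma> x)) (coord g x))"
    unfolding inner_ell2_def by (rule infsum_cong_neutral) (auto simp: coord_pull inj)
  also have "\<dots> = (\<Sum>\<^sub>\<infinity>x\<in>C. inner (coord f (\<sigma> (\<tau> x))) (coord g (\<tau> x)))"
    by (rule infsum_reindex_bij_betw[OF bij(2), symmetric])
  also have "\<dots> = inner f (pull C \<tau> g)"
    unfolding inner_ell2_def by (rule infsum_cong_neutral) (auto simp: coord_pull inj inv)
  finally show ?thesis .
qed

text \<open>Nonemptiness makes \<open>pmf_of_set S\<close> the uniform measure; the final theorem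
  treats the empty set separately.\<close>

locale cayley = group G for G :: "('a, 'b) monoid_scheme" (structure) +
  fixes S :: "'a set"
  assumes finite_S: "finite S" and S_nonempty: "S \<noteq> {}"
    and S_carrier: "S \<subseteq> carrier G" and S_inv: "s \<in> S \<Longrightarrow> inv s \<in> S"
begin

abbreviation restr :: "'a ell2 \<Rightarrow> 'a ell2" where
  "restr \<equiv> pull (carrier G) (\<lambda>x. x)"

definition rshift :: "'a \<Rightarrow> 'a ell2 \<Rightarrow> 'a ell2" where
  "rshift g = pull (carrier G) (\<lambda>x. x \<otimes> inv g)"

definition lshift :: "'a \<Rightarrow> 'a ell2 \<Rightarrow> 'a ell2" where
  "lshift g = pull (carrier G) (\<lambda>x. inv g \<otimes> x)"

lemma bij_rshift: "g \<in> carrier G \<Longrightarrow> bij_betw (\<lambda>x. x \<otimes> inv g) (carrier G) (carrier G)"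
  by (rule bij_betw_byWitness[where f' = "\<lambda>x. x \<otimes> g"]) (auto simp: m_assoc)

lemma bij_lshift: "g \<in> carrier G \<Longrightarrow> bij_betw (\<lambda>x. inv g \<otimes> x) (carrier G) (carrier G)"
  by (rule bij_betw_byWitness[where f' = "\<lambda>x. g \<otimes> x"]) (auto simp flip: m_assoc)

lemma coord_restr [simp]: "coord (restr f) x = (if x \<in> carrier G then coord f x else 0)"
  by (rule coord_pull) auto

lemma coord_rshift [simp]:
  "g \<in> carrier G \<Longrightarrow> coord (rshift g f) x = (if x \<in> carrier G then coord f (x \<otimes> inv g) else 0)"
  unfolding rshift_def by (rule coord_pull[OF bij_betw_imp_inj_on[OF bij_rshift]])

lemma coord_lshift [simp]:
  "g \<in> carrier G \<Longrightarrow> coord (lshift g f) x = (if x \<in> carrier G then coord f (inv g \<otimes> x) else 0)"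
  unfolding lshift_def by (rule coord_pull[OF bij_betw_imp_inj_on[OF bij_lshift]])

lemma bounded_linear_restr: "bounded_linear restr"
  by (rule bounded_linear_pull) auto

lemma bounded_linear_rshift: "g \<in> carrier G \<Longrightarrow> bounded_linear (rshift g)"
  unfolding rshift_def by (rule bounded_linear_pull[OF bij_betw_imp_inj_on[OF bij_rshift]])

lemma bounded_linear_lshift: "g \<in> carrier G \<Longrightarrow> bounded_linear (lshift g)"
  unfolding lshift_def by (rule bounded_linear_pull[OF bij_betw_imp_inj_on[OF bij_lshift]])

lemma norm_rshift_le: "g \<in> carrier G \<Longrightarrow> norm (rshift g f) \<le> norm f"
  unfolding rshift_def by (rule norm_pull_le[OF bij_betw_imp_inj_on[OF bij_rshift]])

lemma inner_restr: "inner (restr f) g = inner f (restr g)"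
  by (rule inner_pull) (auto simp: bij_betw_def)

lemma inner_rshift: "g \<in> carrier G \<Longrightarrow> inner (rshift g f) h = inner f (rshift (inv g) h)"
  unfolding rshift_def by (rule inner_pull[OF bij_rshift bij_rshift]) (auto simp: m_assoc)

lemma inner_lshift: "g \<in> carrier G \<Longrightarrow> inner (lshift g f) h = inner f (lshift (inv g) h)"
  unfolding lshift_def by (rule inner_pull[OF bij_lshift bij_lshift]) (auto simp flip: m_assoc)

text \<open>The leading term is \<open>restr f\<close> instead of f, so that the operator is the
  Laplace operator on the carrier extended by zero to the whole type. This keeps it symmetric and
  positive there.\<close>

definition lap :: "'a ell2 \<Rightarrow> 'a ell2" where
  "lap f = restr f - (1 / real (card S)) *\<^sub>R (\<Sum>s\<in>S. rshift s f)"

lemma coord_sum: "coord (\<Sum>i\<in>I. f i) x = (\<Sum>i\<in>I. coord (f i) x)"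
  by (induction I rule: infinite_finite_induct) auto

lemma coord_lap: "coord (lap f) x = (if x \<in> carrier G
    then coord f x - (\<Sum>s\<in>S. coord f (x \<otimes> inv s)) / of_nat (card S) else 0)"
proof -
  have "(\<Sum>s\<in>S. coord (rshift s f) x) = (if x \<in> carrier G then \<Sum>s\<in>S. coord f (x \<otimes> inv s) else 0)"
    using S_carrier by (auto intro!: sum.cong sum.neutral)
  then show ?thesis by (simp add: lap_def coord_sum scaleR_conv_of_real)
qed

lemma bounded_linear_lap: "bounded_linear lap"
  unfolding lap_def[abs_def] using S_carrier
  by (intro bounded_linear_sub bounded_linear_restr bounded_linear_sum
      bounded_linear_compose[OF bounded_linear_scaleR_right] bounded_linear_rshift) auto

lemma card_S_pos: "0 < real (card S)"
  using finite_S S_nonempty by (simp add: card_gt_0_iff)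

lemma inner_lap_eq: "inner (lap f) g = inner (restr f) g - (\<Sum>s\<in>S. inner (rshift s f) g) / real (card S)"
  by (simp add: lap_def inner_diff_left inner_sum_left)

lemma lap_sym: "inner (lap f) g = inner f (lap g)"
proof -
  have "(\<Sum>s\<in>S. inner (rshift s f) g) = (\<Sum>s\<in>S. inner f (rshift (inv s) g))"
    using S_carrier by (intro sum.cong) (auto simp: inner_rshift)
  also have "\<dots> = (\<Sum>s\<in>S. inner f (rshift s g))"
    by (rule sum.reindex_bij_witness[where i = "\<lambda>s. inv s" and j = "\<lambda>s. inv s"])
       (use S_carrier S_inv in auto)
  finally have "inner (lap f) g = inner f (restr g) - (\<Sum>s\<in>S. inner f (rshift s g)) / real (card S)"
    by (simp add: inner_lap_eq inner_restr)
  then show ?thesis by (simp add: lap_def inner_diff_right inner_sum_right)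
qed

text \<open>Cauchy-Schwarz is applied to \<open>restr f\<close>: a bound by the full norm of f would
  be too weak for the positivity of \<open>lap\<close> when f has mass outside the carrier.\<close>

lemma abs_inner_rshift_le: "g \<in> carrier G \<Longrightarrow> \<bar>inner (rshift g f) f\<bar> \<le> inner (restr f) f"
proof -
  assume g: "g \<in> carrier G"
  have "restr (restr f) = restr f" "rshift g f = restr (rshift g (restr f))"
    using g by (auto intro!: ell2_eqI)
  then have eq: "inner (rshift g f) f = inner (rshift g (restr f)) (restr f)"
      "inner (restr f) f = inner (restr f) (restr f)"
    by (metis inner_restr)+
  have "\<bar>inner (rshift g (restr f)) (restr f)\<bar> \<le> norm (rshift g (restr f)) * norm (restr f)"
    by (rule Cauchy_Schwarz_ineq2)
  also have "\<dots> \<le> norm (restr f) * norm (restr f)"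
    using norm_rshift_le[OF g] by (intro mult_right_mono) auto
  finally show ?thesis unfolding eq by (simp add: dot_square_norm power2_eq_square)
qed

lemma lap_nonneg: "0 \<le> inner (lap f) f" and lap_le: "inner (lap f) f \<le> 2 * inner f f"
proof -
  have "\<bar>\<Sum>s\<in>S. inner (rshift s f) f\<bar> \<le> (\<Sum>s\<in>S. inner (restr f) f)"
    using S_carrier by (intro order_trans[OF sum_abs] sum_mono abs_inner_rshift_le) auto
  then have "\<bar>(\<Sum>s\<in>S. inner (rshift s f) f) / real (card S)\<bar> \<le> inner (restr f) f"
    using card_S_pos by (simp add: field_simps)
  then show "0 \<le> inner (lap f) f" "inner (lap f) f \<le> 2 * inner f f"
  proof -
    assume *: "\<bar>(\<Sum>s\<in>S. inner (rshift s f) f) / real (card S)\<bar> \<le> inner (restr f) f"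
    then show "0 \<le> inner (lap f) f" unfolding inner_lap_eq by linarith
    have "inner (restr f) f \<le> norm (restr f) * norm f" by (rule norm_cauchy_schwarz)
    also have "\<dots> \<le> norm f * norm f" by (intro mult_right_mono norm_pull_le) auto
    finally have "inner (restr f) f \<le> inner f f" by (simp add: dot_square_norm power2_eq_square)
    with * show "inner (lap f) f \<le> 2 * inner f f" unfolding inner_lap_eq by linarith
  qed
qed

lemma lap_restr: "lap (restr f) = lap f" and restr_lap: "restr (lap f) = lap f"
  using S_carrier by (auto intro!: ell2_eqI sum.cong simp: coord_lap subset_iff)

text \<open>The Laplace operator multiplies on the right, so by associativity it does not see
  translations on the left.\<close>

lemma lap_lshift: "g \<in> carrier G \<Longrightarrow> lshift g (lap f) = lap (lshift g f)"
  using S_carrier by (auto intro!: ell2_eqI sum.cong simp: coord_lap m_assoc subset_iff)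

lemma lap_conj: "conj_ell2 (lap f) = lap (conj_ell2 f)"
  by (auto intro!: ell2_eqI simp: coord_lap)

lemma lap_cscale: "cscale c (lap f) = lap (cscale c f)"
  by (auto intro!: ell2_eqI simp: coord_lap sum_distrib_left right_diff_distrib)

section \<open>Passage between \<open>l2 G\<close> and the Hilbert space type\<close>

lemma l2_summable_UNIV: "f \<in> l2 G \<Longrightarrow> (\<lambda>x. (cmod (f x))\<^sup>2) summable_on UNIV"
  unfolding l2_def by (auto elim!: summable_on_cong_neutral[THEN iffD1, rotated -1])

lemma coord_Abs_l2: "f \<in> l2 G \<Longrightarrow> coord (Abs_ell2 f) = f"
  by (rule coord_Abs[OF l2_summable_UNIV])

lemma restr_Abs_l2: "f \<in> l2 G \<Longrightarrow> restr (Abs_ell2 f) = Abs_ell2 f"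
  by (rule ell2_eqI) (auto simp: coord_Abs_l2, simp add: l2_def)

lemma coord_in_l2: "restr f = f \<Longrightarrow> coord f \<in> l2 G"
proof -
  assume f: "restr f = f"
  have "coord f x = 0" if "x \<notin> carrier G" for x
    using coord_restr[of f x] that by (simp add: f)
  moreover have "(\<lambda>x. (cmod (coord f x))\<^sup>2) summable_on carrier G"
    by (rule summable_on_subset_banach[OF coord_summable]) auto
  ultimately show ?thesis by (simp add: l2_def)
qed

text \<open>The Hermitian product is recovered from the real one: its imaginary part is the real
  product with i g. Complex statements thus reduce to real ones plus commutation with
  \<open>cscale\<close>.\<close>

lemma l2_inner_coord:
  assumes f: "restr f = f"
  shows "l2_inner G (coord f) (coord g) = Complex (inner f g) (inner f (cscale \<i> g))"
proof -
  have zero: "coord f x = 0" if "x \<notin> carrier G" for x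
    using coord_restr[of f x] that by (simp add: f)
  have summ: "(\<lambda>x. coord f x * cnj (coord g x)) summable_on UNIV"
  proof (rule abs_summable_summable, rule summable_on_comparison_test)
    show "(\<lambda>x. (cmod (coord f x))\<^sup>2 + (cmod (coord g x))\<^sup>2) summable_on UNIV"
      by (intro summable_on_add coord_summable)
    show "norm (coord f x * cnj (coord g x)) \<le> (cmod (coord f x))\<^sup>2 + (cmod (coord g x))\<^sup>2" for x
      using zero_le_power2[of "cmod (coord f x) - cmod (coord g x)"]
        zero_le_power2[of "cmod (coord f x) + cmod (coord g x)"]
      unfolding power2_diff power2_sum norm_mult complex_mod_cnj by linarith
  qed auto
  have "l2_inner G (coord f) (coord g) = (\<Sum>\<^sub>\<infinity>x. coord f x * cnj (coord g x))"
    unfolding l2_inner_def by (rule infsum_cong_neutral) (auto simp: zero)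
  moreover have "Re (\<Sum>\<^sub>\<infinity>x. coord f x * cnj (coord g x)) = inner f g"
    by (subst infsum_Re[OF summ, symmetric]) (simp add: inner_ell2_def inner_complex_def)
  moreover have "Im (\<Sum>\<^sub>\<infinity>x. coord f x * cnj (coord g x)) = inner f (cscale \<i> g)"
    by (subst infsum_Im[OF summ, symmetric]) (simp add: inner_ell2_def inner_complex_def algebra_simps)
  ultimately show ?thesis by (simp add: complex_eq_iff)
qed

lemma l2_norm_coord:
  assumes f: "restr f = f"
  shows "l2_norm G (coord f) = norm f"
proof -
  have zero: "coord f x = 0" if "x \<notin> carrier G" for x
    using coord_restr[of f x] that by (simp add: f)
  have "(\<Sum>\<^sub>\<infinity>x\<in>carrier G. (cmod (coord f x))\<^sup>2) = inner f f"
    unfolding inner_ell2_def by (rule infsum_cong_neutral) (auto simp: zero power2_norm_eq_inner)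
  then show ?thesis by (simp add: l2_norm_def norm_eq_sqrt_inner)
qed

lemma laplace_operator_coord:
  assumes f: "restr f = f"
  shows "laplace_operator G (pmf_of_set S) (coord f) = coord (lap f)"
proof
  fix x
  have zero: "coord f x = 0" if "x \<notin> carrier G" for x
    using coord_restr[of f x] that by (simp add: f)
  have "(\<Sum>\<^sub>\<infinity>\<gamma>\<in>carrier G. coord f (x \<otimes> inv \<gamma>) * of_real (pmf (pmf_of_set S) \<gamma>)) =
      (\<Sum>\<^sub>\<infinity>\<gamma>\<in>S. coord f (x \<otimes> inv \<gamma>) / of_nat (card S))"
    using S_carrier by (intro infsum_cong_neutral) (auto simp: pmf_of_set[OF S_nonempty finite_S])
  also have "\<dots> = (\<Sum>\<gamma>\<in>S. coord f (x \<otimes> inv \<gamma>)) / of_nat (card S)"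
    using finite_S by (simp add: sum_divide_distrib)
  finally show "laplace_operator G (pmf_of_set S) (coord f) x = coord (lap f) x"
    by (simp add: laplace_operator_def convolution_operator_def coord_lap zero)
qed

lemma positive_contraction_half_lap: "positive_contraction (\<lambda>f. (1 / 2) *\<^sub>R lap f)"
proof (rule positive_contraction.intro)
  show "bounded_linear (\<lambda>f. (1 / 2) *\<^sub>R lap f)"
    by (rule bounded_linear_compose[OF bounded_linear_scaleR_right bounded_linear_lap])
qed (use lap_nonneg lap_le in \<open>auto simp: lap_sym mult.commute[of _ 2]\<close>)

lemma l2_eq: "l2 G = coord ` {f. restr f = f}"
proof safe
  fix f assume "f \<in> l2 G"
  then show "f \<in> coord ` {f. restr f = f}"
    by (intro image_eqI[of _ _ "Abs_ell2 f"]) (simp_all add: coord_Abs_l2 restr_Abs_l2)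
qed (rule coord_in_l2)

text \<open>The calculus applies to \<Delta>/2, and \<chi>_A(\<Delta>) is its projection for the set
  \<open>D A\<close> of all t with 2 t in A. Commutation with \<open>restr\<close> keeps the
  projections inside \<open>l2 G\<close>; commutation with \<open>cscale\<close> makes them complex
  linear and Hermitian.\<close>

lemma spectral_measure_exists:
  "\<exists>E. spectral_measure_of G (laplace_operator G (pmf_of_set S)) E"
proof -
  interpret T: positive_contraction "\<lambda>f. (1 / 2) *\<^sub>R lap f"
    by (rule positive_contraction_half_lap)
  define D :: "real set \<Rightarrow> real set" where "D A = (\<lambda>t. 2 * t) -` A" for A
  have D: "D A \<in> sets borel" if "A \<in> sets borel" for A
    using measurable_sets[of "\<lambda>t::real. 2 * t" borel borel A] that by (simp add: D_def)
  define Q where "Q A = T.spec_proj (D A)" for A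
  define E where "E A f = coord (Q A (Abs_ell2 f))" for A f
  have E: "E A (coord f) = coord (Q A f)" for A f
    by (simp add: E_def coord_inverse)
  have commute: "J (Q A f) = Q A (J f)"
    if "A \<in> sets borel" "bounded_linear J" "\<And>f. J (lap f) = lap (J f)" for A J f
    unfolding Q_def
    by (rule T.spec_proj_commute[OF D]) (use that in \<open>auto simp: linear_simps\<close>)
  have restr_Q: "restr (Q A f) = Q A f" if "restr f = f" "A \<in> sets borel" for A f
    using commute[OF that(2) bounded_linear_restr, of f] that(1) by (simp add: restr_lap lap_restr)
  have cscale_Q: "cscale c (Q A f) = Q A (cscale c f)" if "A \<in> sets borel" for A c f
    using commute[OF that bounded_linear_cscale] lap_cscale by blast
  have sym: "inner (Q A f) g = inner f (Q A g)" if "A \<in> sets borel" for A f g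
    unfolding Q_def by (rule T.spec_proj_sym[OF D[OF that]])
  have proj: "orthogonal_projection G (E A)" if A: "A \<in> sets borel" for A
    unfolding orthogonal_projection_def l2_eq
  proof (intro conjI ballI allI; clarsimp simp: E)
    fix f g :: "'a ell2" assume f: "restr f = f"
    show "coord (Q A f) \<in> coord ` {f. restr f = f}"
      using restr_Q[OF f A] by auto
    show "coord (Q A (Q A f)) = coord (Q A f)"
      using T.spec_proj_Int[OF D[OF A] D[OF A], of f] by (simp add: Q_def)
    fix c
    have mult: "(\<lambda>x. c * coord f x) = coord (cscale c f)" by (auto simp: fun_eq_iff)
    show "E A (\<lambda>x. c * coord f x) = (\<lambda>x. c * coord (Q A f) x)"
      unfolding mult E by (simp add: fun_eq_iff flip: cscale_Q[OF A])
    assume g: "restr g = g"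
    have add: "(\<lambda>x. coord f x + coord g x) = coord (f + g)" by (auto simp: fun_eq_iff)
    show "E A (\<lambda>x. coord f x + coord g x) = (\<lambda>x. coord (Q A f) x + coord (Q A g) x)"
      unfolding add E by (simp add: fun_eq_iff Q_def T.spec_proj_add[OF D[OF A]])
    show "l2_inner G (coord (Q A f)) (coord g) = l2_inner G (coord f) (coord (Q A g))"
      using restr_Q[OF f A] f by (simp add: l2_inner_coord sym[OF A] cscale_Q[OF A])
  qed
  have pvm: "projection_valued_measure G E"
    unfolding projection_valued_measure_def
  proof (intro conjI ballI allI impI proj)
    fix f assume "f \<in> l2 G"
    then obtain h where f: "f = coord h" and h: "restr h = h" by (auto simp: l2_eq)
    show "E UNIV f = f"
      by (simp add: f E Q_def D_def T.spec_proj_UNIV)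
    show "E (A \<inter> B) f = E A (E B f)" if "A \<in> sets borel" "B \<in> sets borel" for A B
      using T.spec_proj_Int[OF D[OF that(1)] D[OF that(2)], of h]
      by (simp add: f E Q_def D_def vimage_Int)
    fix A :: "nat \<Rightarrow> real set" assume A: "range A \<subseteq> sets borel" "disjoint_family A"
    have A': "A i \<in> sets borel" "(\<Union>i. A i) \<in> sets borel" for i using A(1) by auto
    define r where "r n = Q (\<Union>i. A i) h - (\<Sum>i<n. Q (A i) h)" for n
    have "restr (r n) = r n" for n
      unfolding r_def linear_simps[OF bounded_linear_restr] linear_sum[OF bounded_linear.linear[OF bounded_linear_restr]]
      using h A' by (simp add: restr_Q)
    moreover have "(\<lambda>x. E (\<Union>i. A i) f x - (\<Sum>i<n. E (A i) f x)) = coord (r n)" for n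
      by (simp add: fun_eq_iff f E r_def coord_sum)
    moreover have "r \<longlonglongrightarrow> 0"
    proof -
      have "(\<lambda>n. T.spec_proj (\<Union>i. D (A i)) h - (\<Sum>i<n. T.spec_proj (D (A i)) h)) \<longlonglongrightarrow> 0"
        by (rule T.spec_proj_countably_additive)
           (use D A' A(2) in \<open>auto simp: disjoint_family_on_def D_def vimage_Int[symmetric]\<close>)
      moreover have "(\<Union>i. D (A i)) = D (\<Union>i. A i)" by (auto simp: D_def)
      ultimately show ?thesis by (simp add: r_def[abs_def] Q_def)
    qed
    ultimately show "(\<lambda>n. l2_norm G (\<lambda>x. E (\<Union>i. A i) f x - (\<Sum>i<n. E (A i) f x))) \<longlonglongrightarrow> 0"
      by (simp add: l2_norm_coord tendsto_norm_zero)
  qed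
  have "spectral_measure_of G (laplace_operator G (pmf_of_set S)) E"
    unfolding spectral_measure_of_def
  proof (intro conjI ballI pvm)
    fix f assume "f \<in> l2 G"
    then obtain h where f: "f = coord h" and h: "restr h = h" by (auto simp: l2_eq)
    let ?M = "T.spec_measure h"
    have M: "unit_measure ?M" by simp
    then have sets_M: "sets ?M = sets borel" and fin: "finite_measure ?M" by (auto simp: unit_measure_def)
    have meas: "(\<lambda>t::real. 2 * t) \<in> measurable ?M borel"
      using sets_M by (simp cong: measurable_cong_sets)
    define N where "N = distr ?M borel (\<lambda>t. 2 * t)"
    have N: "scalar_spectral_measure G E f = N"
    proof -
      \<comment> \<open>The set function agrees with \<open>emeasure N\<close> on Borel sets, so
        \<open>measure_of\<close> rebuilds N and its countable additivity is inherited.\<close>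
      have "scalar_spectral_measure G E f = measure_of (space N) (sets N) (emeasure N)"
        unfolding scalar_spectral_measure_def
      proof (subst measure_of_eq)
        fix A :: "real set" assume "A \<in> sigma_sets UNIV (sets borel)"
        then have A: "A \<in> sets borel" using sets.sigma_sets_eq[of "borel :: real measure"] by simp
        have "Re (l2_inner G (E A f) f) = inner (Q A h) h"
          using restr_Q[OF h A] by (simp add: f E l2_inner_coord)
        also have "\<dots> = measure ?M (D A)"
          unfolding Q_def by (rule T.inner_spec_proj[OF D[OF A]])
        finally show "ennreal (Re (l2_inner G (E A f) f)) = emeasure N A"
          using A sets_eq_imp_space_eq[OF sets_M]
          by (simp add: N_def emeasure_distr[OF meas] D_def finite_measure.emeasure_eq_measure[OF fin])
      qed (auto simp: N_def)
      then show ?thesis by (simp only: measure_of_of_measure)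
    qed
    have bb: "bounded_borel (\<lambda>t. 2 * t)"
      by (rule bounded_borel_cont) (intro continuous_intros)
    show "integrable (scalar_spectral_measure G E f) (\<lambda>t. t)"
      unfolding N N_def
      by (rule integrable_distr_eq[OF meas, of "\<lambda>t. t", THEN iffD2, OF _ unit_measure_integrable[OF M bb]]) simp
    have int: "(\<integral>t. t \<partial>scalar_spectral_measure G E f) = inner (lap h) h"
      unfolding N N_def
      using T.integral_spec_measure[of h] by (subst integral_distr[OF meas]) simp_all
    \<comment> \<open>The imaginary part of <\<Delta> h, h>. Multiplication by i is skew and
      commutes with the symmetric \<open>lap\<close>, so this number equals its own
      negative.\<close>
    have "inner (lap h) (cscale \<i> h) = inner (cscale (- \<i>) (lap h)) h"
      by (simp add: inner_cscale)
    also have "\<dots> = inner (lap h) (cscale \<i> h) * -1"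
    proof -
      have "cscale (- \<i>) (lap h) = - lap (cscale \<i> h)"
        by (rule ell2_eqI) (simp flip: lap_cscale)
      then have "inner (cscale (- \<i>) (lap h)) h = - inner (lap (cscale \<i> h)) h" by simp
      also have "inner (lap (cscale \<i> h)) h = inner (lap h) (cscale \<i> h)"
        by (metis lap_sym inner_commute)
      finally show ?thesis by simp
    qed
    finally have "inner (lap h) (cscale \<i> h) = 0" by simp
    then show "l2_inner G (laplace_operator G (pmf_of_set S) f) f =
        of_real (\<integral>t. t \<partial>scalar_spectral_measure G E f)"
      unfolding int by (simp add: f laplace_operator_coord[OF h] l2_inner_coord restr_lap complex_eq_iff)
  qed
  then show ?thesis by blast
qed

end

section \<open>Spectral projections commute with translations\<close>

text \<open>\<open>E\<close> stands for whatever the choice operator returns, hence nothing of the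
  construction above is assumed about it.\<close>

locale spectral_resolution = cayley +
  fixes E :: "real set \<Rightarrow> ('a \<Rightarrow> complex) \<Rightarrow> 'a \<Rightarrow> complex"
  assumes E: "spectral_measure_of G (laplace_operator G (pmf_of_set S)) E"
begin

text \<open>The values of \<open>E\<close> are controlled on \<open>l2 G\<close> only; composing
  with \<open>restr\<close> gives an operator on the whole Hilbert space type that vanishes on
  functions supported off the carrier.\<close>

definition P :: "real set \<Rightarrow> 'a ell2 \<Rightarrow> 'a ell2" where
  "P A f = Abs_ell2 (E A (coord (restr f)))"

lemma restr_restr [simp]: "restr (restr f) = restr f"
  by (rule ell2_eqI) simp

lemma coord_restr_in_l2: "coord (restr f) \<in> l2 G"
  by (rule coord_in_l2) simp

lemma pvm: "projection_valued_measure G E"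
  using E by (simp add: spectral_measure_of_def)

lemma proj: "A \<in> sets borel \<Longrightarrow> orthogonal_projection G (E A)"
  using pvm by (simp add: projection_valued_measure_def)

context
  fixes A :: "real set" assumes A: "A \<in> sets borel"
begin

lemma E_in_l2: "E A (coord (restr f)) \<in> l2 G"
  using proj[OF A] coord_restr_in_l2 unfolding orthogonal_projection_def by blast

lemma coord_P: "coord (P A f) = E A (coord (restr f))"
  unfolding P_def by (rule coord_Abs_l2[OF E_in_l2])

lemma restr_P [simp]: "restr (P A f) = P A f"
  unfolding P_def by (rule restr_Abs_l2[OF E_in_l2])

lemma P_add: "P A (f + g) = P A f + P A g"
proof (rule ell2_eqI)
  fix x
  have "coord (restr (f + g)) = (\<lambda>x. coord (restr f) x + coord (restr g) x)" by (auto simp: fun_eq_iff)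
  moreover have "E A (\<lambda>x. coord (restr f) x + coord (restr g) x) =
      (\<lambda>x. E A (coord (restr f)) x + E A (coord (restr g)) x)"
    using proj[OF A] coord_restr_in_l2 unfolding orthogonal_projection_def by blast
  ultimately show "coord (P A (f + g)) x = coord (P A f + P A g) x"
    by (simp only: coord_plus coord_P)
qed

lemma P_sym: "inner (P A f) g = inner f (P A g)"
proof -
  have eq: "l2_inner G (E A (coord (restr f))) (coord (restr g)) =
      l2_inner G (coord (restr f)) (E A (coord (restr g)))"
    using proj[OF A] coord_restr_in_l2 unfolding orthogonal_projection_def by blast
  have "inner (P A f) (restr g) = Re (l2_inner G (coord (P A f)) (coord (restr g)))"
    by (simp only: l2_inner_coord[OF restr_P]) simp
  also have "\<dots> = Re (l2_inner G (coord (restr f)) (coord (P A g)))"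
    by (simp only: coord_P eq)
  also have "\<dots> = inner (restr f) (P A g)"
    by (simp only: l2_inner_coord[OF restr_restr]) simp
  finally have "inner (restr (P A f)) g = inner f (restr (P A g))"
    by (simp only: inner_restr)
  then show ?thesis by simp
qed

end

lemma P_Int:
  assumes A: "A \<in> sets borel" and B: "B \<in> sets borel"
  shows "P (A \<inter> B) f = P A (P B f)"
proof -
  have "E (A \<inter> B) (coord (restr f)) = E A (E B (coord (restr f)))"
    using pvm A B coord_restr_in_l2 unfolding projection_valued_measure_def by blast
  also have "\<dots> = E A (coord (restr (P B f)))"
    by (simp only: restr_P[OF B] coord_P[OF B])
  finally show ?thesis by (simp add: P_def)
qed

lemma P_idem: "A \<in> sets borel \<Longrightarrow> P A (P A f) = P A f"
  using P_Int[of A A f] by simp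

lemma P_UNIV: "P UNIV f = restr f"
  using pvm coord_restr_in_l2[of f] unfolding projection_valued_measure_def P_def
  by (simp add: coord_inverse)

lemma inner_P_norm: "A \<in> sets borel \<Longrightarrow> inner (P A f) f = (norm (P A f))\<^sup>2"
  using P_sym[of A "P A f" f] by (simp add: P_idem power2_norm_eq_inner)

lemma norm_P_le: "A \<in> sets borel \<Longrightarrow> norm (P A f) \<le> norm f"
proof -
  assume A: "A \<in> sets borel"
  have "norm (P A f) * norm (P A f) \<le> norm f * norm (P A f)"
    using norm_cauchy_schwarz[of "P A f" f] inner_P_norm[OF A, of f]
    by (simp add: power2_eq_square mult.commute)
  then show ?thesis
    by (cases "norm (P A f) = 0") (simp_all add: mult_le_cancel_right)
qed

lemma P_sums:
  assumes A: "range A \<subseteq> sets borel" "disjoint_family A"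
  shows "(\<lambda>i. P (A i) f) sums P (\<Union>i. A i) f"
proof -
  have A': "A i \<in> sets borel" "(\<Union>i. A i) \<in> sets borel" for i using A(1) by auto
  define r where "r n = P (\<Union>i. A i) f - (\<Sum>i<n. P (A i) f)" for n
  have restr_r: "restr (r n) = r n" for n
    unfolding r_def linear_simps[OF bounded_linear_restr]
      linear_sum[OF bounded_linear.linear[OF bounded_linear_restr]]
    using A' by simp
  have "(\<lambda>n. l2_norm G (\<lambda>x. E (\<Union>i. A i) (coord (restr f)) x - (\<Sum>i<n. E (A i) (coord (restr f)) x)))
      \<longlonglongrightarrow> 0"
    using pvm A coord_restr_in_l2[of f] unfolding projection_valued_measure_def by blast
  moreover have "(\<lambda>x. E (\<Union>i. A i) (coord (restr f)) x - (\<Sum>i<n. E (A i) (coord (restr f)) x)) = coord (r n)" for n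
    by (simp add: fun_eq_iff r_def coord_sum coord_P[OF A'(2)] coord_P[OF A'(1)])
  ultimately have "(\<lambda>n. norm (r n)) \<longlonglongrightarrow> 0"
    by (simp add: l2_norm_coord[OF restr_r])
  then have "r \<longlonglongrightarrow> 0" by (simp add: tendsto_norm_zero_iff)
  from tendsto_diff[OF tendsto_const[of "P (\<Union>i. A i) f"] this] show ?thesis
    by (simp add: sums_def r_def)
qed

lemma P_empty [simp]: "P {} f = 0"
proof -
  have "(\<lambda>i::nat. P {} f) sums P (\<Union>i::nat. {}) f"
    by (rule P_sums) (auto simp: disjoint_family_on_def)
  from sums_summable[OF this] show ?thesis by (simp add: summable_const_iff)
qed

lemma P_Compl: "A \<in> sets borel \<Longrightarrow> P A f + P (- A) f = restr f"
proof -
  assume A: "A \<in> sets borel"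
  have "(\<lambda>i. P (binaryset A (- A) i) f) sums P (\<Union>i. binaryset A (- A) i) f"
    by (rule P_sums) (use A in \<open>auto simp: range_binaryset_eq disjoint_family_on_def binaryset_def\<close>)
  moreover have "(\<lambda>i. P (binaryset A (- A) i) f) sums (P A f + P (- A) f)"
    by (rule binaryset_sums) simp
  ultimately have "P A f + P (- A) f = P (\<Union>i. binaryset A (- A) i) f"
    by (rule sums_unique2[rotated])
  then show ?thesis by (simp add: UN_binaryset_eq P_UNIV)
qed

section \<open>Energies and the scalar measures of a given spectral measure\<close>

definition \<mu> :: "'a ell2 \<Rightarrow> real measure" where
  "\<mu> f = scalar_spectral_measure G E (coord (restr f))"

lemma sets_\<mu> [simp, measurable_cong]: "sets (\<mu> f) = sets borel"
  unfolding \<mu>_def scalar_spectral_measure_def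
  using sets.sigma_sets_eq[of "borel :: real measure"] by (subst sets_measure_of) auto

lemma space_\<mu> [simp]: "space (\<mu> f) = UNIV"
  by (simp add: sets_eq_imp_space_eq[OF sets_\<mu>])

text \<open>\<open>measure_of\<close> keeps a set function only if that function is positive and
  countably additive. Both have to be derived from the projection-valued measure before any integral
  against \<mu> can be evaluated.\<close>

lemma emeasure_\<mu>:
  assumes A: "A \<in> sets borel"
  shows "emeasure (\<mu> f) A = ennreal (inner (P A f) f)"
proof -
  define m where "m = (\<lambda>A. ennreal (Re (l2_inner G (E A (coord (restr f))) (coord (restr f)))))"
  have m: "m A = ennreal (inner (P A f) f)" if "A \<in> sets borel" for A
  proof -
    have "Re (l2_inner G (E A (coord (restr f))) (coord (restr f))) = inner (P A f) (restr f)"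
      unfolding coord_P[OF that, symmetric] by (simp add: l2_inner_coord[OF restr_P[OF that]])
    also have "\<dots> = inner (P A f) f"
      by (simp add: inner_restr[symmetric] that)
    finally show ?thesis by (simp add: m_def)
  qed
  have "emeasure (\<mu> f) A = m A"
  proof (rule emeasure_measure_of)
    show "\<mu> f = measure_of UNIV (sets borel) m"
      unfolding \<mu>_def scalar_spectral_measure_def m_def ..
    show "positive (sets (\<mu> f)) m" by (simp add: positive_def m)
    show "countably_additive (sets (\<mu> f)) m"
    proof (rule countably_additiveI)
      fix B :: "nat \<Rightarrow> real set"
      assume B: "range B \<subseteq> sets (\<mu> f)" "disjoint_family B"
      then have B': "B i \<in> sets borel" "(\<Union>i. B i) \<in> sets borel" for i by auto
      have "(\<lambda>i. inner (P (B i) f) f) sums inner (P (\<Union>i. B i) f) f"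
        using P_sums[of B f] B by (intro bounded_linear.sums[OF bounded_linear_inner_left]) auto
      then have "(\<Sum>i. ennreal (inner (P (B i) f) f)) = ennreal (inner (P (\<Union>i. B i) f) f)"
        by (intro suminf_ennreal_eq) (auto simp: inner_P_norm B')
      then show "(\<Sum>i. m (B i)) = m (\<Union> (range B))" by (simp add: m B')
    qed
  qed (use A in auto)
  then show ?thesis by (simp add: m A)
qed

lemma finite_measure_\<mu>: "finite_measure (\<mu> f)"
  by (rule finite_measureI) (simp add: emeasure_\<mu>)

lemma measure_\<mu>: "A \<in> sets borel \<Longrightarrow> measure (\<mu> f) A = inner (P A f) f"
  by (simp add: measure_def emeasure_\<mu> inner_P_norm)

lemma integrable_\<mu>: "integrable (\<mu> f) (\<lambda>t. t)"
  and inner_lap_\<mu>: "inner (lap f) f = (\<integral>t. t \<partial>\<mu> f)"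
proof -
  have *: "integrable (\<mu> f) (\<lambda>t. t)"
    "l2_inner G (laplace_operator G (pmf_of_set S) (coord (restr f))) (coord (restr f)) =
       of_real (\<integral>t. t \<partial>\<mu> f)"
    using E coord_restr_in_l2[of f] unfolding spectral_measure_of_def \<mu>_def by auto
  show "integrable (\<mu> f) (\<lambda>t. t)" by fact
  have "inner (lap f) (restr f) = (\<integral>t. t \<partial>\<mu> f)"
    using arg_cong[OF *(2), of Re]
    by (simp add: laplace_operator_coord[OF restr_restr] lap_restr l2_inner_coord[OF restr_lap])
  then show "inner (lap f) f = (\<integral>t. t \<partial>\<mu> f)"
    by (simp add: inner_restr[symmetric] restr_lap)
qed

text \<open>The scalar measure of \<open>P A f\<close> is that of f restricted to A, because P A P B
  P A = P (A \<inter> B) yields its value on each Borel set B.\<close>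

lemma inner_lap_P:
  assumes A: "A \<in> sets borel"
  shows "inner (lap (P A f)) (P A f) = (\<integral>t. indicator A t * t \<partial>\<mu> f)"
proof -
  have density: "\<mu> (P A f) = density (\<mu> f) (\<lambda>t. ennreal (indicator A t))"
  proof (rule measure_eqI)
    fix B assume "B \<in> sets (\<mu> (P A f))"
    then have B: "B \<in> sets borel" by simp
    have "inner (P B (P A f)) (P A f) = inner (P (A \<inter> B) f) f"
    proof -
      have "P A (P B (P A f)) = P (A \<inter> B) f"
        using P_Int[OF A sets.Int[OF B A], of f] P_Int[OF B A, of f]
        by (simp add: Int_commute Int_left_commute)
      then show ?thesis using P_sym[OF A, of "P B (P A f)" f] by simp
    qed
    moreover have "emeasure (density (\<mu> f) (\<lambda>t. ennreal (indicator A t))) B = emeasure (\<mu> f) (A \<inter> B)"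
      using emeasure_restricted[of A "\<mu> f" B] A B by (simp add: ennreal_indicator)
    ultimately show "emeasure (\<mu> (P A f)) B = emeasure (density (\<mu> f) (\<lambda>t. ennreal (indicator A t))) B"
      using A B by (simp add: emeasure_\<mu>)
  qed simp
  show ?thesis
    unfolding inner_lap_\<mu> density using A by (subst integral_density) auto
qed

lemma integrable_indicator_\<mu>: "A \<in> sets borel \<Longrightarrow> integrable (\<mu> f) (\<lambda>t. indicator A t * t)"
  using integrable_real_mult_indicator[of A "\<mu> f" "\<lambda>t. t"] integrable_\<mu> by (simp add: mult.commute)

text \<open>The energy of x + y is an integral that splits over A and its complement into the
  energies of x and y. So the mixed terms <\<Delta> x, y> and <\<Delta> y, x> add up to 0, and they
  are equal by symmetry.\<close>

lemma inner_lap_Compl: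
  assumes A: "A \<in> sets borel"
  shows "inner (lap (P A f)) (P (- A) g) = 0"
proof -
  define x y where "x = P A f" and "y = P (- A) g"
  have cA: "- A \<in> sets borel" using A by simp
  have "P A y = 0" "P (- A) x = 0"
    unfolding x_def y_def using P_Int[OF A cA, of g] P_Int[OF cA A, of f] by simp_all
  then have Px: "P A (x + y) = x" "P (- A) (x + y) = y"
    using A cA by (simp_all add: P_add x_def y_def P_idem)
  have "inner (lap (x + y)) (x + y) = (\<integral>t. indicator A t * t + indicator (- A) t * t \<partial>\<mu> (x + y))"
    unfolding inner_lap_\<mu> by (intro Bochner_Integration.integral_cong) (auto simp: indicator_def)
  also have "\<dots> = inner (lap x) x + inner (lap y) y"
    using inner_lap_P[OF A, of "x + y"] inner_lap_P[OF cA, of "x + y"]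
    by (simp add: Px integrable_indicator_\<mu> A cA)
  finally have "inner (lap x) y + inner (lap y) x = 0"
    by (simp add: linear_simps[OF bounded_linear_lap] inner_add_left inner_add_right)
  moreover have "inner (lap y) x = inner (lap x) y" by (metis lap_sym inner_commute)
  ultimately show ?thesis by (simp add: x_def y_def)
qed

text \<open>Vanishing mixed energies make the off-diagonal blocks of \<open>lap\<close> zero with
  respect to the splitting by \<open>P A\<close> and \<open>P (- A)\<close>.\<close>

lemma lap_P:
  assumes A: "A \<in> sets borel"
  shows "P A (lap f) = lap (P A f)"
proof -
  have cA: "- A \<in> sets borel" using A by simp
  have stay: "P B (lap (P (- B) f)) = 0" if B: "B \<in> sets borel" for B
  proof -
    have cB: "- B \<in> sets borel" using B by simp
    have "inner (P B (lap (P (- B) f))) (P B (lap (P (- B) f))) = 0"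
      using inner_lap_Compl[OF cB, of f "P B (lap (P (- B) f))"] P_sym[OF B] by (simp add: P_idem B)
    then show ?thesis by simp
  qed
  have "P A (lap f) = P A (lap (P A f + P (- A) f))"
    by (simp add: P_Compl[OF A] lap_restr)
  also have "\<dots> = P A (lap (P A f))"
    using stay[OF A] by (simp add: linear_simps[OF bounded_linear_lap] P_add[OF A])
  also have "\<dots> = P A (lap (P A f)) + P (- A) (lap (P A f))"
    using stay[OF cA] by simp
  also have "\<dots> = lap (P A f)"
    by (simp add: P_Compl[OF A] restr_lap)
  finally show ?thesis .
qed

section \<open>Growth of powers on spectral subspaces\<close>

lemma lap_le_on_range:
  assumes f: "P {..u} f = f"
  shows "inner (lap f) f \<le> u * inner f f"
proof -
  interpret finite_measure "\<mu> f" by (rule finite_measure_\<mu>)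
  have "inner (lap f) f = (\<integral>t. indicator {..u} t * t \<partial>\<mu> f)"
    using inner_lap_P[of "{..u}" f] f by simp
  also have "\<dots> \<le> (\<integral>t. u * indicator {..u} t \<partial>\<mu> f)"
  proof (rule integral_mono)
    show "integrable (\<mu> f) (\<lambda>t. u * indicator {..u} t)"
      by (intro integrable_mult_right integrable_real_indicator) (auto simp: less_top[symmetric])
  qed (auto intro: integrable_indicator_\<mu> split: split_indicator)
  also have "\<dots> = u * inner f f" using f by (simp add: measure_\<mu>)
  finally show ?thesis .
qed

lemma lap_ge_on_range:
  assumes f: "P {u<..} f = f"
  shows "u * inner f f \<le> inner (lap f) f"
proof -
  interpret finite_measure "\<mu> f" by (rule finite_measure_\<mu>)
  have "u * inner f f = (\<integral>t. u * indicator {u<..} t \<partial>\<mu> f)" using f by (simp add: measure_\<mu>)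
  also have "\<dots> \<le> (\<integral>t. indicator {u<..} t * t \<partial>\<mu> f)"
  proof (rule integral_mono)
    show "integrable (\<mu> f) (\<lambda>t. u * indicator {u<..} t)"
      by (intro integrable_mult_right integrable_real_indicator) (auto simp: less_top[symmetric])
  qed (auto intro: integrable_indicator_\<mu> split: split_indicator)
  also have "\<dots> = inner (lap f) f"
    using inner_lap_P[of "{u<..}" f] f by simp
  finally show ?thesis .
qed

text \<open>Passes from the form bound 0 \<le> \<Delta> \<le> u to a norm bound. The energy of f - s
  \<Delta> f is nonnegative, and \<Delta> f is again in the range by \<open>lap_P\<close>, which
  bounds its own energy.\<close>

lemma norm_lap_le_on_range:
  assumes f: "P {..u} f = f" and u: "0 \<le> u"
  shows "norm (lap f) \<le> u * norm f"
proof -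
  define y where "y = lap f"
  define a where "a = inner y y"
  have y: "P {..u} y = y" using lap_P[of "{..u}" f] f by (simp add: y_def)
  have form: "0 \<le> inner (lap f) f - 2 * s * a + s * s * (u * a)" for s
  proof -
    have "0 \<le> inner (lap (f - s *\<^sub>R y)) (f - s *\<^sub>R y)" by (rule lap_nonneg)
    also have "\<dots> = inner (lap f) f - 2 * s * a + s * s * inner (lap y) y"
      by (simp add: linear_simps[OF bounded_linear_lap] inner_diff_left inner_diff_right a_def
          algebra_simps lap_sym) (simp add: y_def lap_sym inner_commute)
    also have "\<dots> \<le> inner (lap f) f - 2 * s * a + s * s * (u * a)"
      using mult_left_mono[OF lap_le_on_range[OF y], of "s * s"] by (simp add: a_def)
    finally show ?thesis .
  qed
  have p: "inner (lap f) f \<le> u * inner f f" by (rule lap_le_on_range[OF f])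
  have "a \<le> u * (u * inner f f)"
  \<comment> \<open>The best parameter is s = 1/u, giving ||\<Delta> f||^2 \<le> u <\<Delta> f, f>.
    For u = 0 the quadratic term disappears and any positive s works.\<close>
  proof (cases "u = 0")
    case True
    with form[of 1] p show ?thesis by simp
  next
    case False
    with u have "u > 0" by simp
    with form[of "1 / u"] have "a \<le> u * inner (lap f) f" by (simp add: field_simps)
    also have "\<dots> \<le> u * (u * inner f f)" using p u by (rule mult_left_mono)
    finally show ?thesis .
  qed
  then have "(norm y)\<^sup>2 \<le> (u * norm f)\<^sup>2"
    by (simp add: a_def dot_square_norm power_mult_distrib power2_eq_square ac_simps)
  then show ?thesis unfolding y_def by (rule power2_le_imp_le) (use u in simp)
qed

lemma lap_power_P: "A \<in> sets borel \<Longrightarrow> (lap ^^ n) (P A f) = P A ((lap ^^ n) f)"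
  by (induction n) (auto simp: lap_P)

lemma lap_power_bound:
  assumes f: "P {..u} f = f" and u: "0 \<le> u"
  shows "norm ((lap ^^ n) f) \<le> u ^ n * norm f"
proof (induction n)
  case (Suc n)
  have "P {..u} ((lap ^^ n) f) = (lap ^^ n) f"
    using lap_power_P[of "{..u}" n f] f by simp
  from norm_lap_le_on_range[OF this u] have "norm ((lap ^^ Suc n) f) \<le> u * norm ((lap ^^ n) f)" by simp
  also have "\<dots> \<le> u * (u ^ n * norm f)" using Suc u by (rule mult_left_mono)
  finally show ?case by (simp add: ac_simps)
qed simp

text \<open>On the range of \<open>P {b<..}\<close> the operator \<open>lap\<close> expands norms by
  at least b. Projecting f there commutes with \<open>lap\<close> and does not increase norms, so
  the component y satisfies b^n ||y|| \<le> K u^n for all n, which forces y = 0.\<close>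

lemma P_tail_eq_0:
  assumes bound: "\<And>n. norm ((lap ^^ n) f) \<le> K * u ^ n" and u: "0 \<le> u" "u < b"
  shows "P {b<..} f = 0"
proof -
  define y where "y = P {b<..} f"
  have b: "b > 0" using u by simp
  have low: "b ^ n * norm y \<le> norm ((lap ^^ n) y)" for n
  proof (induction n)
    case (Suc n)
    define z where "z = (lap ^^ n) y"
    have z: "P {b<..} z = z" by (simp add: z_def y_def lap_power_P P_idem)
    have "b * (norm z * norm z) \<le> norm (lap z) * norm z"
      using lap_ge_on_range[OF z] norm_cauchy_schwarz[of "lap z" z]
      by (simp add: dot_square_norm power2_eq_square)
    then have "b * norm z \<le> norm (lap z)"
      by (cases "norm z = 0") (simp_all add: mult_le_cancel_right flip: mult.assoc)
    moreover have "b ^ Suc n * norm y \<le> b * norm z"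
      using mult_left_mono[OF Suc, of b] b by (simp add: z_def ac_simps)
    ultimately show ?case by (simp add: z_def)
  qed simp
  have "norm y \<le> K * (u / b) ^ n" for n
  proof -
    have "b ^ n * norm y \<le> norm ((lap ^^ n) f)"
      using low[of n] norm_P_le[of "{b<..}" "(lap ^^ n) f"] by (simp add: y_def lap_power_P)
    also have "\<dots> \<le> K * u ^ n" by (rule bound)
    finally show ?thesis using b by (simp add: power_divide field_simps)
  qed
  moreover have "(\<lambda>n. K * (u / b) ^ n) \<longlonglongrightarrow> 0"
    using u b by (intro tendsto_mult_right_zero LIMSEQ_power_zero) simp
  ultimately have "norm y \<le> 0"
    by (intro LIMSEQ_le_const[where X = "\<lambda>n. K * (u / b) ^ n"]) auto
  then show ?thesis by (simp add: y_def)
qed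

text \<open>The range of the projection is described by \<^term>\<open>lap\<close> alone, so every bounded operator that
  commutes with \<^term>\<open>lap\<close> leaves it invariant. This replaces the uniqueness of the spectral measure.\<close>

lemma in_range_iff:
  assumes u: "0 \<le> u"
  shows "P {..u} f = f \<longleftrightarrow> restr f = f \<and> (\<exists>K. \<forall>n. norm ((lap ^^ n) f) \<le> K * u ^ n)"
proof
  assume f: "P {..u} f = f"
  have "restr f = f" using restr_P[of "{..u}" f] by (simp add: f)
  moreover have "\<forall>n. norm ((lap ^^ n) f) \<le> norm f * u ^ n"
    using lap_power_bound[OF f u] by (simp add: mult.commute)
  ultimately show "restr f = f \<and> (\<exists>K. \<forall>n. norm ((lap ^^ n) f) \<le> K * u ^ n)" by blast
next
  assume "restr f = f \<and> (\<exists>K. \<forall>n. norm ((lap ^^ n) f) \<le> K * u ^ n)"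
  then obtain K where f: "restr f = f" and K: "\<And>n. norm ((lap ^^ n) f) \<le> K * u ^ n" by blast
  \<comment> \<open>\<open>P_tail_eq_0\<close> needs b strictly above u; countably many such b
    exhaust the open half-line.\<close>
  define b where "b n = u + inverse (real (Suc n))" for n
  have "emeasure (\<mu> f) {b n<..} = 0" for n
    using P_tail_eq_0[OF K u, of "b n"] by (simp add: emeasure_\<mu> b_def)
  then have "emeasure (\<mu> f) (\<Union>n. {b n<..}) = 0"
    by (intro emeasure_UN_eq_0) auto
  also have "(\<Union>n. {b n<..}) = {u<..}"
  proof (intro equalityI subsetI)
    fix t assume "t \<in> {u<..}"
    then obtain n where "inverse (real (Suc n)) < t - u"
      using reals_Archimedean[of "t - u"] by auto
    then show "t \<in> (\<Union>n. {b n<..})" by (auto simp: b_def intro!: exI[of _ n])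
  next
    fix t assume "t \<in> (\<Union>n. {b n<..})"
    then obtain n where "b n < t" by auto
    moreover have "u < b n" by (simp add: b_def)
    ultimately show "t \<in> {u<..}" by simp
  qed
  finally have "P {u<..} f = 0"
    by (simp add: emeasure_\<mu> inner_P_norm)
  moreover have "- {..u} = {u<..}" by auto
  ultimately show "P {..u} f = f"
    using P_Compl[of "{..u}" f] f by simp
qed

lemma range_invariant:
  assumes u: "0 \<le> u" and J: "bounded_linear J" "\<And>f. J (lap f) = lap (J f)" "\<And>f. J (restr f) = restr (J f)"
  shows "P {..u} (J (P {..u} f)) = J (P {..u} f)"
proof -
  define x where "x = P {..u} f"
  have "P {..u} x = x" by (simp add: x_def P_idem)
  then obtain K where x: "restr x = x" and K: "\<And>n. norm ((lap ^^ n) x) \<le> K * u ^ n"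
    using in_range_iff[OF u, of x] by blast
  obtain C where C: "\<And>z. norm (J z) \<le> norm z * C" "C \<ge> 0"
    using bounded_linear.nonneg_bounded[OF J(1)] by auto
  have power: "(lap ^^ n) (J x) = J ((lap ^^ n) x)" for n
    by (induction n) (auto simp: J(2))
  have "norm ((lap ^^ n) (J x)) \<le> (K * C) * u ^ n" for n
    using C(1)[of "(lap ^^ n) x"] mult_right_mono[OF K[of n] C(2)] by (simp add: power ac_simps)
  moreover have "restr (J x) = J x" by (metis J(3) x)
  ultimately show ?thesis using in_range_iff[OF u, of "J x"] unfolding x_def by blast
qed

text \<open>Invariance of the range under J gives P J P = J P. Invariance under the adjoint J'
  gives, after transposition, P J = P J P; hence both operators appear among the hypotheses.\<close>

lemma P_commute:
  assumes u: "0 \<le> u"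
    and J: "bounded_linear J" "\<And>f. J (lap f) = lap (J f)" "\<And>f. J (restr f) = restr (J f)"
    and J': "bounded_linear J'" "\<And>f. J' (lap f) = lap (J' f)" "\<And>f. J' (restr f) = restr (J' f)"
    and adj: "\<And>f g. inner (J f) g = inner f (J' g)"
  shows "P {..u} (J f) = J (P {..u} f)"
proof -
  have A: "{..u} \<in> sets borel" by simp
  have "inner (P {..u} (J f)) g = inner (J (P {..u} f)) g" for g
  proof -
    have "inner (P {..u} (J f)) g = inner f (J' (P {..u} g))"
      by (simp add: P_sym[OF A] adj)
    also have "\<dots> = inner f (P {..u} (J' (P {..u} g)))"
      by (simp add: range_invariant[OF u J'])
    also have "\<dots> = inner (P {..u} (J (P {..u} f))) g"
      by (simp only: P_sym[OF A, symmetric] adj[symmetric])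
    also have "\<dots> = inner (J (P {..u} f)) g"
      by (simp add: range_invariant[OF u J])
    finally show ?thesis .
  qed
  then have "inner (P {..u} (J f) - J (P {..u} f)) (P {..u} (J f) - J (P {..u} f)) = 0"
    by (simp only: inner_diff_left)
  then show ?thesis by simp
qed

end

section \<open>Ball growth bounds the spectral distribution\<close>

context cayley
begin

section \<open>Words, balls and displacement by right translations\<close>

abbreviation word_prod :: "'a list \<Rightarrow> 'a" where
  "word_prod ws \<equiv> foldr (\<lambda>s y. s \<otimes> y) ws \<one>"

lemma word_prod_closed [simp]: "set ws \<subseteq> S \<Longrightarrow> word_prod ws \<in> carrier G"
  using S_carrier by (induction ws) auto

lemma word_prod_append:
  "set vs \<subseteq> S \<Longrightarrow> set ws \<subseteq> S \<Longrightarrow> word_prod (vs @ ws) = word_prod vs \<otimes> word_prod ws"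
proof (induction vs)
  case (Cons s vs)
  then show ?case using S_carrier by (auto simp: m_assoc)
qed simp

lemma generate_word: "x \<in> generate G S \<Longrightarrow> \<exists>ws. set ws \<subseteq> S \<and> word_prod ws = x"
proof (induction rule: generate.induct)
  case one
  then show ?case by (intro exI[of _ "[]"]) simp
next
  case (incl s)
  then show ?case using S_carrier by (intro exI[of _ "[s]"]) auto
next
  case (inv s)
  then show ?case using S_carrier S_inv by (intro exI[of _ "[inv s]"]) auto
next
  case (eng x y)
  then obtain vs ws where "set vs \<subseteq> S" "word_prod vs = x" "set ws \<subseteq> S" "word_prod ws = y" by blast
  moreover from this have "word_prod (vs @ ws) = x \<otimes> y" by (simp only: word_prod_append)
  ultimately show ?case by (intro exI[of _ "vs @ ws"]) simp
qed

text \<open>\<open>word_length\<close> is a least number, which carries information only when some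
  word represents x; generation supplies that word.\<close>

lemma word_ball_word:
  assumes gen: "generate G S = carrier G" and x: "x \<in> word_ball G S r"
  obtains ws where "set ws \<subseteq> S" "word_prod ws = x" "real (length ws) \<le> r"
proof -
  from x have xG: "x \<in> carrier G" and len: "real (word_length G S x) \<le> r"
    by (auto simp: word_ball_def word_dist_def)
  have "\<exists>n ws. set ws \<subseteq> S \<and> length ws = n \<and> word_prod ws = x"
    using generate_word[of x] gen xG by auto
  then have "\<exists>ws. set ws \<subseteq> S \<and> length ws = word_length G S x \<and> word_prod ws = x"
    unfolding word_length_def by (rule LeastI_ex)
  with len that show thesis by auto
qed

lemma lshift_delta: "g \<in> carrier G \<Longrightarrow> a \<in> carrier G \<Longrightarrow> lshift g (delta a) = delta (g \<otimes> a)"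
  by (rule ell2_eqI) (auto simp: inv_solve_left')

lemma restr_lshift: "g \<in> carrier G \<Longrightarrow> lshift g (restr f) = restr (lshift g f)"
  by (rule ell2_eqI) auto

lemma norm_rshift:
  assumes g: "g \<in> carrier G" and f: "restr f = f"
  shows "norm (rshift g f) = norm f"
proof -
  have "inner (rshift g f) (rshift g f) = inner f (rshift (inv g) (rshift g f))"
    by (rule inner_rshift[OF g])
  also have "rshift (inv g) (rshift g f) = restr f"
    using g by (intro ell2_eqI) (auto simp: m_assoc)
  finally show ?thesis by (simp add: f norm_eq_sqrt_inner)
qed

lemma rshift_mult:
  assumes "g \<in> carrier G" "h \<in> carrier G"
  shows "rshift (g \<otimes> h) f = rshift h (rshift g f)"
  using assms by (intro ell2_eqI) (auto simp: inv_mult_group m_assoc)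

text \<open>Right translation reverses products: \<open>rshift (s \<otimes> g)\<close> is
  \<open>rshift g\<close> after \<open>rshift s\<close>. So the displacement by s is carried along
  by \<open>rshift g\<close>, which does not increase norms, and the displacements of the letters
  add up.\<close>

lemma displacement_word:
  assumes f: "restr f = f" and d: "\<And>s. s \<in> S \<Longrightarrow> norm (f - rshift s f) \<le> d"
    and ws: "set ws \<subseteq> S"
  shows "norm (f - rshift (word_prod ws) f) \<le> real (length ws) * d"
  using ws
proof (induction ws)
  case Nil
  have "rshift \<one> f = restr f" by (rule ell2_eqI) auto
  then show ?case by (simp add: f)
next
  case (Cons s ws)
  let ?g = "word_prod ws"
  have s: "s \<in> S" "s \<in> carrier G" and g: "?g \<in> carrier G" using Cons.prems S_carrier by auto
  have split: "f - rshift (s \<otimes> ?g) f = (f - rshift ?g f) + rshift ?g (f - rshift s f)"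
    by (simp add: rshift_mult[OF s(2) g] linear_simps[OF bounded_linear_rshift[OF g]])
  have "norm (f - rshift (s \<otimes> ?g) f) \<le> norm (f - rshift ?g f) + norm (rshift ?g (f - rshift s f))"
    unfolding split by (rule norm_triangle_ineq)
  also have "\<dots> \<le> real (length ws) * d + d"
    using Cons d[OF s(1)] norm_rshift_le[OF g, of "f - rshift s f"]
    by (intro add_mono) auto
  finally show ?case by (simp add: algebra_simps)
qed

end

context spectral_resolution
begin

section \<open>The projected point mass and its translates\<close>

lemma P_lshift:
  assumes "0 \<le> u" and g: "g \<in> carrier G"
  shows "P {..u} (lshift g f) = lshift g (P {..u} f)"
  using g
  by (intro P_commute[where J' = "lshift (inv g)"] assms)
     (auto simp: bounded_linear_lshift lap_lshift restr_lshift inner_lshift)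

text \<open>Conjugation is real linear and its own adjoint for the real inner product, which is the
  setting of \<open>P_commute\<close>. Applied to the point mass, it shows that its projection is
  real valued.\<close>

lemma P_conj:
  assumes "0 \<le> u"
  shows "P {..u} (conj_ell2 f) = conj_ell2 (P {..u} f)"
proof -
  have "conj_ell2 (restr f) = restr (conj_ell2 f)" for f by (rule ell2_eqI) simp
  then show ?thesis
    by (intro P_commute[where J' = conj_ell2] assms)
       (auto simp: bounded_linear_conj lap_conj inner_conj)
qed

text \<open>Inversion fixes \<open>f\<close> and turns right translations into left translations, which commute with
  the projection.\<close>

lemma inner_rshift_P_delta:
  assumes u: "0 \<le> u" and g: "g \<in> carrier G"
  defines "f \<equiv> P {..u} (delta \<one>)"
  shows "inner (rshift g f) f = Re (coord f g)"
proof -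
  have f: "restr f = f" by (simp add: f_def)
  have shift: "lshift h f = P {..u} (delta h)" if "h \<in> carrier G" for h
    unfolding f_def using that by (simp add: P_lshift[OF u, symmetric] lshift_delta)
  \<comment> \<open>f(x) pairs f with the point mass at x; translating by the inverse of x turns
    this into the value at \<one> of the projected point mass at that inverse, and symmetry of the
    projection identifies it with the value of f there.\<close>
  have Re_inv: "Re (coord f x) = Re (coord f (inv x))" if x: "x \<in> carrier G" for x
  proof -
    have "Re (coord f x) = inner f (lshift (inv (inv x)) (delta \<one>))"
      using x by (simp add: lshift_delta inner_delta)
    also have "\<dots> = inner (lshift (inv x) f) (delta \<one>)"
      using x by (subst inner_lshift) auto
    also have "\<dots> = inner (delta (inv x)) f"
      unfolding shift[OF inv_closed[OF x]] by (simp add: P_sym f_def)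
    finally show ?thesis by (simp add: inner_commute inner_delta)
  qed
  have "conj_ell2 (delta \<one> :: 'a ell2) = delta \<one>" by (rule ell2_eqI) simp
  then have "conj_ell2 f = f" using P_conj[OF u, of "delta \<one>"] by (simp add: f_def)
  then have "cnj (coord f x) = coord f x" for x by (metis coord_conj)
  then have Im: "Im (coord f x) = 0" for x by (simp add: complex_eq_iff)
  define refl where "refl = pull (carrier G) (\<lambda>x. inv x)"
  have bij: "bij_betw (\<lambda>x. inv x) (carrier G) (carrier G)"
    by (rule bij_betw_byWitness[where f' = "\<lambda>x. inv x"]) auto
  have coord_refl: "coord (refl h) x = (if x \<in> carrier G then coord h (inv x) else 0)" for h x
    unfolding refl_def by (rule coord_pull[OF bij_betw_imp_inj_on[OF bij]])
  have refl_f: "refl f = f"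
  proof (rule ell2_eqI)
    fix x
    show "coord (refl f) x = coord f x"
    proof (cases "x \<in> carrier G")
      case True
      then show ?thesis using Re_inv[OF True] by (simp add: coord_refl complex_eq_iff Im)
    next
      case False
      then show ?thesis using coord_restr[of f x] by (simp add: coord_refl f)
    qed
  qed
  have "inner (rshift g f) f = inner (rshift g f) (refl f)" by (simp add: refl_f)
  also have "\<dots> = inner (refl (rshift g f)) f"
    unfolding refl_def by (rule inner_pull[OF bij bij, symmetric]) auto
  also have "refl (rshift g f) = lshift (inv g) (refl f)"
    using g by (intro ell2_eqI) (auto simp: coord_refl inv_mult_group)
  also have "\<dots> = P {..u} (delta (inv g))" using g by (simp add: refl_f shift)
  also have "inner \<dots> f = inner (delta (inv g)) f" by (simp add: P_sym f_def P_idem)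
  also have "\<dots> = Re (coord f g)" using Re_inv[OF g] by (simp add: inner_commute inner_delta)
  finally show ?thesis .
qed

lemma E_point_mass: "Re (l2_inner G (E {..u} (point_mass \<one>)) (point_mass \<one>)) = inner (P {..u} (delta \<one>)) (delta \<one>)"
proof -
  have r: "restr (delta \<one> :: 'a ell2) = delta \<one>" by (rule ell2_eqI) simp
  have p: "point_mass \<one> = coord (delta \<one> :: 'a ell2)" by (auto simp: point_mass_def)
  have "E {..u} (point_mass \<one>) = coord (P {..u} (delta \<one>))"
    by (simp add: coord_P r p)
  then show ?thesis by (simp add: p l2_inner_coord)
qed

lemma return_mass_le:
  assumes u: "0 \<le> u" and gen: "generate G S = carrier G"
    and r: "2 * real (card S) * u * r\<^sup>2 \<le> 1"
  shows "inner (P {..u} (delta \<one>)) (delta \<one>) * real (card (word_ball G S r)) \<le> 4"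
proof -
  define f where "f = P {..u} (delta \<one>)"
  define m where "m = inner f f"
  have f: "restr f = f" and Pf: "P {..u} f = f" by (simp_all add: f_def P_idem)
  have m_eq: "inner (P {..u} (delta \<one>)) (delta \<one>) = m"
    by (simp add: m_def f_def inner_P_norm power2_norm_eq_inner)
  have m: "m \<ge> 0" by (simp add: m_def)
  have disp: "(norm (f - rshift g f))\<^sup>2 = 2 * (m - Re (coord f g))" if g: "g \<in> carrier G" for g
  proof -
    have "(norm (f - rshift g f))\<^sup>2 = (norm f)\<^sup>2 + (norm (rshift g f))\<^sup>2 - 2 * inner (rshift g f) f"
      by (simp add: power2_norm_eq_inner inner_diff_left inner_diff_right inner_commute)
    then show ?thesis
      using inner_rshift_P_delta[OF u g] norm_rshift[OF g f]
      by (simp add: f_def[symmetric] m_def power2_norm_eq_inner)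
  qed
  define d where "d = sqrt (2 * real (card S) * u * m)"
  have d2: "d\<^sup>2 = 2 * real (card S) * u * m" using u m by (simp add: d_def)
  \<comment> \<open>All terms m - f(s) are nonnegative, being half of squared displacements, so each
    is at most their sum over S, which is |S| times the energy of f.\<close>
  have gens: "norm (f - rshift s f) \<le> d" if s: "s \<in> S" for s
  proof -
    have sG: "s \<in> carrier G" if "s \<in> S" for s using that S_carrier by auto
    have nonneg: "0 \<le> m - Re (coord f s)" if "s \<in> S" for s
      using zero_le_power2[of "norm (f - rshift s f)"] unfolding disp[OF sG[OF that]] by simp
    have "(\<Sum>s\<in>S. m - Re (coord f s)) = real (card S) * inner (lap f) f"
      using card_S_pos inner_rshift_P_delta[OF u sG]
      by (simp add: inner_lap_eq f m_def sum_subtractf right_diff_distrib f_def[symmetric])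
    also have "\<dots> \<le> real (card S) * (u * m)"
      using lap_le_on_range[OF Pf] unfolding m_def by (intro mult_left_mono) auto
    finally have "m - Re (coord f s) \<le> real (card S) * (u * m)"
      using member_le_sum[of s S "\<lambda>s. m - Re (coord f s)"] nonneg finite_S s by force
    then have "(norm (f - rshift s f))\<^sup>2 \<le> d\<^sup>2"
      unfolding d2 disp[OF sG[OF s]] by simp
    then show ?thesis by (rule power2_le_imp_le) (use u m in \<open>simp add: d_def\<close>)
  qed
  have large: "m / 2 \<le> Re (coord f g)" if g: "g \<in> word_ball G S r" for g
  proof -
    have gG: "g \<in> carrier G" using g by (simp add: word_ball_def)
    obtain ws where ws: "set ws \<subseteq> S" "word_prod ws = g" "real (length ws) \<le> r"
      using word_ball_word[OF gen g] .
    have d0: "d \<ge> 0" using u m by (simp add: d_def)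
    have "norm (f - rshift g f) \<le> real (length ws) * d"
      using displacement_word[OF f gens ws(1)] ws(2) by simp
    also have "\<dots> \<le> r * d" using ws(3) d0 by (rule mult_right_mono)
    \<comment> \<open>The hypothesis on r says exactly that (r d)^2 \<le> m. As the left side is 2
      (m - f(g)), this gives f(g) \<ge> m/2.\<close>
    finally have "(norm (f - rshift g f))\<^sup>2 \<le> (r * d)\<^sup>2" by (rule power_mono) simp
    also have "\<dots> = (2 * real (card S) * u * r\<^sup>2) * m" by (simp add: power_mult_distrib d2)
    also have "\<dots> \<le> 1 * m" using r m by (rule mult_right_mono)
    finally show ?thesis using disp[OF gG] by simp
  qed
  show ?thesis
  \<comment> \<open>For an infinite ball \<open>card\<close> is 0, so the product is 0 as it is for
    m = 0; in the remaining case one factor m can be cancelled.\<close>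
  proof (cases "finite (word_ball G S r) \<and> m > 0")
    case True
    have "real (card (word_ball G S r)) * (m / 2)\<^sup>2 = (\<Sum>g\<in>word_ball G S r. (m / 2)\<^sup>2)" by simp
    also have "\<dots> \<le> (\<Sum>g\<in>word_ball G S r. (cmod (coord f g))\<^sup>2)"
    proof (intro sum_mono power_mono)
      fix g assume "g \<in> word_ball G S r"
      from large[OF this] show "m / 2 \<le> cmod (coord f g)"
        using complex_Re_le_cmod[of "coord f g"] by linarith
    qed (use m in simp)
    also have "\<dots> \<le> m"
      unfolding m_def using sum_coord_le[of "word_ball G S r" f] True by (simp add: power2_norm_eq_inner)
    finally have "(real (card (word_ball G S r)) * m) * m \<le> 4 * m"
      by (simp add: power2_eq_square)
    then show ?thesis unfolding m_eq using True by (simp add: mult.commute)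
  qed (use m m_eq in auto)
qed

end

context cayley
begin

text \<open>Existence turns the choice in \<open>spectral_projection\<close> into a genuine spectral
  measure, to which the estimate for arbitrary \<open>E\<close> applies.\<close>

lemma spectral_distribution_le:
  assumes gen: "generate G S = carrier G" and u: "0 \<le> u"
    and r: "2 * real (card S) * u * r\<^sup>2 \<le> 1"
  shows "spectral_distribution G (pmf_of_set S) u * real (card (word_ball G S r)) \<le> 4"
proof -
  interpret spectral_resolution G S "SOME E. spectral_measure_of G (laplace_operator G (pmf_of_set S)) E"
    by unfold_locales (rule someI_ex[OF spectral_measure_exists])
  show ?thesis
    using return_mass_le[OF u gen r]
    unfolding spectral_distribution_def spectral_projection_def E_point_mass .
qed

text \<open>For u > 0 the largest admissible radius is r = c u^(-1/2) with c = (2 |S|)^(-1/2), which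
  turns the growth exponent \<epsilon> r^\<alpha> into \<epsilon> c^\<alpha>
  u^(-\<alpha>/2).\<close>

lemma spectral_distribution_preceq:
  assumes gen: "generate G S = carrier G" and \<alpha>: "0 < \<alpha>" and \<epsilon>: "0 < \<epsilon>"
    and growth: "\<forall>\<^sub>F r in at_top. exp (\<epsilon> * r powr \<alpha>) \<le> real (card (word_ball G S r))"
  shows "preceq_near_zero (spectral_distribution G (pmf_of_set S)) (exp_neg_powr (\<alpha> / 2))"
proof -
  let ?N = "spectral_distribution G (pmf_of_set S)"
  obtain R where R: "R > 0" "\<And>r. r \<ge> R \<Longrightarrow> exp (\<epsilon> * r powr \<alpha>) \<le> real (card (word_ball G S r))"
  proof -
    obtain R0 where "\<forall>r\<ge>R0. exp (\<epsilon> * r powr \<alpha>) \<le> real (card (word_ball G S r))"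
      using growth by (auto simp: eventually_at_top_linorder)
    then show thesis by (intro that[of "max R0 1"]) auto
  qed
  have N_le: "?N u \<le> 4 * exp (- (\<epsilon> * r powr \<alpha>))"
    if "0 \<le> u" "r \<ge> R" "2 * real (card S) * u * r\<^sup>2 \<le> 1" for u r
  proof -
    have "?N u * exp (\<epsilon> * r powr \<alpha>) \<le> 4"
    proof (cases "?N u \<ge> 0")
      case True
      have "?N u * exp (\<epsilon> * r powr \<alpha>) \<le> ?N u * real (card (word_ball G S r))"
        using R(2)[OF that(2)] True by (rule mult_left_mono)
      also have "\<dots> \<le> 4"
        by (rule spectral_distribution_le[OF gen]) (use that R(1) in auto)
      finally show ?thesis .
    next
      case False
      then have "?N u * exp (\<epsilon> * r powr \<alpha>) \<le> 0" by (intro mult_nonpos_nonneg) auto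
      then show ?thesis by simp
    qed
    then show ?thesis by (simp add: exp_minus field_simps)
  qed
  define c where "c = 1 / sqrt (2 * real (card S))"
  have c: "c > 0" "2 * real (card S) * c\<^sup>2 = 1"
    using card_S_pos by (simp_all add: c_def power_divide)
  \<comment> \<open>The solution of D^(-\<alpha>/2) = \<epsilon> c^\<alpha>, so that the constants
    of the exponent are absorbed into the argument.\<close>
  define D where "D = (\<epsilon> * c powr \<alpha>) powr (- (2 / \<alpha>))"
  have D: "D > 0" using c \<epsilon> by (simp add: D_def)
  \<comment> \<open>Below \<delta> the radius c u^(-1/2) exceeds \<open>R\<close>, where the growth
    bound is valid.\<close>
  define \<delta> where "\<delta> = (c / R)\<^sup>2"
  have \<delta>: "\<delta> > 0" using c R by (simp add: \<delta>_def)
  have "?N u \<le> 4 * exp_neg_powr (\<alpha> / 2) (D * u)" if u: "u \<in> {0..<\<delta>}" for u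
  proof (cases "u = 0")
    case True
    \<comment> \<open>At u = 0 every radius is admissible. Letting r tend to infinity gives N(0)
      \<le> 0, matching the value 0 assigned to the comparison function.\<close>
    have "((\<lambda>r. 4 * exp (- (\<epsilon> * r powr \<alpha>))) \<longlongrightarrow> 4 * 0) at_top"
    proof (intro tendsto_mult tendsto_const)
      have "filterlim (\<lambda>r. \<epsilon> * r powr \<alpha>) at_top at_top"
        by (rule filterlim_tendsto_pos_mult_at_top[OF tendsto_const \<epsilon>])
           (rule real_powr_at_top[OF \<alpha>])
      then have "filterlim (\<lambda>r. - (\<epsilon> * r powr \<alpha>)) at_bot at_top"
        by (simp add: filterlim_uminus_at_top)
      then show "((\<lambda>r. exp (- (\<epsilon> * r powr \<alpha>))) \<longlongrightarrow> 0) at_top"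
        by (rule filterlim_compose[OF exp_at_bot])
    qed
    moreover have "\<forall>\<^sub>F r in at_top. ?N 0 \<le> 4 * exp (- (\<epsilon> * r powr \<alpha>))"
      using eventually_ge_at_top[of R] by eventually_elim (rule N_le, auto)
    ultimately have "?N 0 \<le> 4 * 0"
      by (intro tendsto_lowerbound) auto
    with True show ?thesis by (simp add: exp_neg_powr_def)
  next
    case False
    with u have u0: "u > 0" by simp
    define r where "r = c * u powr (- (1 / 2))"
    have su: "u powr (- (1 / 2)) = 1 / sqrt u" using u0 by (simp add: powr_minus powr_half_sqrt field_simps)
    have "sqrt u < c / R"
      using u c R by (intro real_less_lsqrt) (auto simp: \<delta>_def)
    then have "r \<ge> R" using u0 R c by (simp add: r_def su field_simps)
    moreover have "2 * real (card S) * u * r\<^sup>2 \<le> 1"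
    proof -
      have "u * r\<^sup>2 = c\<^sup>2" using u0 by (simp add: r_def su power_divide power_mult_distrib)
      then show ?thesis using c(2) by (simp add: mult.assoc)
    qed
    ultimately have "?N u \<le> 4 * exp (- (\<epsilon> * r powr \<alpha>))"
      using u0 by (intro N_le) auto
    also have "\<epsilon> * r powr \<alpha> = (D * u) powr (- (\<alpha> / 2))"
    proof -
      have "(D * u) powr (- (\<alpha> / 2)) = D powr (- (\<alpha> / 2)) * u powr (- (\<alpha> / 2))"
        using D u0 by (simp add: powr_mult)
      also have "D powr (- (\<alpha> / 2)) = \<epsilon> * c powr \<alpha>"
        using \<epsilon> c \<alpha> by (simp add: D_def powr_powr)
      also have "\<epsilon> * c powr \<alpha> * u powr (- (\<alpha> / 2)) = \<epsilon> * r powr \<alpha>"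
        using c u0 by (simp add: r_def powr_mult powr_powr)
      finally show ?thesis ..
    qed
    finally show ?thesis using D u0 by (simp add: exp_neg_powr_def)
  qed
  then show ?thesis
    unfolding preceq_near_zero_def using D \<delta>
    by (intro exI[of _ 4] conjI exI[of _ D] exI[of _ \<delta>]) auto
qed

end

text \<open>For an empty generating set the group is trivial; bounded balls will contradict either
  growth assumption.\<close>

lemma card_word_ball_trivial:
  assumes "group G" "generate G {} = carrier G"
  shows "card (word_ball G {} r) \<le> 1"
proof -
  interpret group G by fact
  have "carrier G = {\<one>\<^bsub>G\<^esub>}" using assms(2) generate_empty by simp
  then have "word_ball G {} r \<subseteq> {\<one>\<^bsub>G\<^esub>}" by (auto simp: word_ball_def)
  then show ?thesis using card_mono[of "{\<one>\<^bsub>G\<^esub>}"] by fastforce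
qed

lemma exponential_growth_exp:
  assumes "exponential_growth G S"
  shows "\<exists>\<epsilon>>0. \<forall>\<^sub>F r in at_top. exp (\<epsilon> * r powr 1) \<le> real (card (word_ball G S r))"
proof -
  obtain c where c: "c > 1" "\<forall>\<^sub>F n in sequentially. c ^ n \<le> real (card (word_ball G S (real n)))"
    using assms by (auto simp: exponential_growth_def)
  then obtain n0 where n0: "\<And>n. n \<ge> n0 \<Longrightarrow> c ^ n \<le> real (card (word_ball G S (real n)))"
    by (auto simp: eventually_sequentially)
  \<comment> \<open>Rounding r down loses at most 1, hence at most half of r once r \<ge> 2; the
    factor 1/2 pays for this.\<close>
  define \<epsilon> where "\<epsilon> = ln c / 2"
  have \<epsilon>: "\<epsilon> > 0" using c by (simp add: \<epsilon>_def)
  have "exp (\<epsilon> * r powr 1) \<le> real (card (word_ball G S r))" if r: "r \<ge> max 2 (real n0 + 1)" for r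
  proof -
    define n where "n = nat \<lfloor>r\<rfloor>"
    have n: "real n \<le> r" "r - 1 \<le> real n" "n \<ge> n0"
      using r by (auto simp: n_def) linarith+
    have "exp (\<epsilon> * r powr 1) \<le> exp (real n * ln c)"
    proof -
      have "r / 2 \<le> real n" using n r by linarith
      then have "ln c * (r / 2) \<le> ln c * real n" using c by (intro mult_left_mono) auto
      then show ?thesis using r by (simp add: \<epsilon>_def mult.commute)
    qed
    also have "\<dots> = c ^ n" using c by (simp add: exp_of_nat_mult)
    also have "\<dots> \<le> real (card (word_ball G S (real n)))" by (rule n0[OF n(3)])
    also have "\<dots> \<le> real (card (word_ball G S r))"
    proof (intro of_nat_mono card_mono)
      \<comment> \<open>Monotonicity of \<open>card\<close> requires a finite ball of radius r. It
        lies in a ball of integer radius, which is finite because its cardinality is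
        positive.\<close>
      define k where "k = nat \<lceil>r\<rceil>"
      have k: "k \<ge> n0" "r \<le> real k" using r by (auto simp: k_def) linarith+
      have "0 < c ^ k" using c by simp
      also have "\<dots> \<le> real (card (word_ball G S (real k)))" by (rule n0[OF k(1)])
      finally have "finite (word_ball G S (real k))" by (simp add: card_gt_0_iff)
      then show "finite (word_ball G S r)"
        by (rule finite_subset[rotated]) (use k(2) in \<open>auto simp: word_ball_def\<close>)
    qed (use n(1) in \<open>auto simp: word_ball_def\<close>)
    finally show ?thesis .
  qed
  then have "\<forall>\<^sub>F r in at_top. exp (\<epsilon> * r powr 1) \<le> real (card (word_ball G S r))"
    by (rule eventually_at_top_linorderI)
  with \<epsilon> show ?thesis by blast
qed

theorem corollary1p8:
  fixes G :: "('a, 'b) monoid_scheme" and S :: "'a set"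
  assumes "group G"
    and "amenable G"
    and "finite S"
    and "symmetric_subset G S"
    and "generate G S = carrier G"
  shows "(\<forall>\<alpha>::real. 0 < \<alpha> \<and> \<alpha> \<le> 1 \<and>
            (\<exists>\<epsilon>>0. \<forall>\<^sub>F r::real in at_top. exp (\<epsilon> * r powr \<alpha>) \<le> real (card (word_ball G S r))) \<longrightarrow>
            preceq_near_zero (spectral_distribution G (pmf_of_set S)) (exp_neg_powr (\<alpha> / 2))) \<and>
         (exponential_growth G S \<longrightarrow>
            preceq_near_zero (spectral_distribution G (pmf_of_set S)) (exp_neg_powr (1 / 2)))"
proof (cases "S = {}")
  case True
  have ball: "real (card (word_ball G S r)) \<le> 1" for r
    using card_word_ball_trivial[of G r] assms True by simp
  \<comment> \<open>The exponential exceeds 1 for every r > 0, while the balls have at most one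
    element.\<close>
  have "\<not> (\<forall>\<^sub>F r in at_top. exp (\<epsilon> * r powr \<alpha>) \<le> real (card (word_ball G S r)))"
    if "\<epsilon> > 0" for \<epsilon> \<alpha> :: real
  proof
    assume "\<forall>\<^sub>F r in at_top. exp (\<epsilon> * r powr \<alpha>) \<le> real (card (word_ball G S r))"
    with eventually_gt_at_top[of 0] have "\<forall>\<^sub>F r :: real in at_top. False"
    proof eventually_elim
      case (elim r)
      then have "exp (\<epsilon> * r powr \<alpha>) \<le> 1" using ball[of r] by linarith
      moreover have "0 < \<epsilon> * r powr \<alpha>" using elim that by simp
      ultimately show False by simp
    qed
    then show False by simp
  qed
  then show ?thesis using exponential_growth_exp by blast
next
  case False
  interpret group G by fact
  interpret cayley G S
    by unfold_locales (use assms False in \<open>auto simp: symmetric_subset_def\<close>)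
  have "preceq_near_zero (spectral_distribution G (pmf_of_set S)) (exp_neg_powr (\<alpha> / 2))"
    if "0 < \<alpha>" "\<exists>\<epsilon>>0. \<forall>\<^sub>F r in at_top. exp (\<epsilon> * r powr \<alpha>) \<le> real (card (word_ball G S r))" for \<alpha> :: real
    using that spectral_distribution_preceq[OF assms(5)] by blast
  from this this[of 1] show ?thesis using exponential_growth_exp[of G S] by auto
qed

end
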